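(* Let $H=\sum_{J\in S}H_J$ be a $\mathsf k$-site-local Hamiltonian with parameters $\mathsf N_H,\mathsf N_P,\mathsf c_P,\mathsf N_{ind}$ as defined in the context, let $t>0$, $\varepsilon>0$, and let $S_p$ be a $p$-th order product formula over the terms $H_J$ (with $p$ and $\Upsilon(p)$ fixed constants). Then, to achieve $\|S_p(t/r)^r-e^{-iHt}\|=\mathcal O(\varepsilon)$ it suffices to choose a Trotter number $$r=\mathcal O\!\Big(\mathsf N_{ind}\,\mathsf N_H^{1/p}\,\frac{(\mathsf N_P\mathsf c_P t)^{1+1/p}}{\varepsilon^{1/p}}\Big).$$ Furthermore, if $r$ is chosen with the tight scaling $r=\Theta\big(\mathsf N_{ind}\mathsf N_H^{1/p}(\mathsf N_P\mathsf c_P t)^{1+1/p}\varepsilon^{-1/p}\big)$, and each factor $e^{-ita_\upsilon^{(J)}H_J/r}$ is itself implemented by a $p$-th order product formula over the Pauli decomposition of $H_J$ with accuracy as required for total error $\mathcal O(\varepsilon)$, then the total elementary gate count $\chi$ of the resulting circuit approximating $e^{-iHt}$ to error $\mathcal O(\varepsilon)$ satisfies $$\chi=\mathcal O\!\Big(\mathsf N_{ind}\,\mathsf N_P\,\frac{(\mathsf N_H\mathsf N_P\mathsf c_P t)^{1+1/p}}{\varepsilon^{1/p}}\Big).$$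
   Context: Let $\Lambda$ be a finite set of lattice sites, $\mathsf N_\Lambda=|\Lambda|$, each site carrying $\mathsf n_q$ qubits. A $\mathsf k$-site-local Hamiltonian is $H=\sum_{J\in S}H_J$, where $S$ is a set of ordered $\mathsf k$-tuples $J=(j_1,\dots,j_{\mathsf k})$ of sites, each $H_J$ is Hermitian and acts nontrivially only on the qubits of the sites in $J$; $\mathsf N_H=|S|$. Each $H_J$ has a Pauli decomposition $H_J=\sum_{i=1}^{\mathsf N_P^{(J)}}c_i^{(J)}P_i^{(J)}$ with distinct Pauli strings $P_i^{(J)}$ and nonzero complex coefficients; $\mathsf N_P=\max_J\mathsf N_P^{(J)}$ and $\mathsf c_P=\max_{J,i}|c_i^{(J)}|$. The induced 1-norm is $|||H|||_1=\max_{\ell\in\{1,\dots,\mathsf k\}}\max_{j\in\Lambda}\sum_{J\in S:\,j_\ell=j}\|H_J\|$, and $\mathsf N_{ind}$ is the number of terms in the sum attaining this maximum; thus $|||H|||_1\le\mathsf c_P\mathsf N_P\mathsf N_{ind}$ and $\|H\|_1:=\sum_J\|H_J\|\le\mathsf c_P\mathsf N_P\mathsf N_H$. A product formula for $H=\sum_\gamma H_\gamma$ is $S(\tau)=\prod_{\upsilon=1}^{\Upsilon}\mathcal P_\upsilon\big(\prod_\gamma e^{-i\tau a_\upsilon^{(\gamma)}H_\gamma}\big)$ with real $a_\upsilon^{(\gamma)}$, $\sum_\upsilon a_\upsilon^{(\gamma)}=1$, $\mathcal P_\upsilon$ a fixed reordering of factors; it has order $p$ if $S(\tau)=e^{-iH\tau}+\mathcal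 O(\tau^{p+1})$; $r$ (Trotter number) is the number of repetitions in $S(t/r)^r$. Cost model: the exponential of a single (scaled) Pauli string is counted as $\mathcal O(1)$ elementary gates. Asymptotics are in $\mathsf N_H,\mathsf N_P,\mathsf c_P,\mathsf N_{ind},t,1/\varepsilon$ with $p$ fixed. *)

theory Defs
  imports "HOL-Analysis.Analysis" "HOL-Library.Landau_Symbols"
begin

text \<open>Sites are natural numbers; a qubit is a pair (site, local index).
  For a finite set Q of qubits, computational basis states are the
  configurations Q -> bool (extensional), and operators are complex
  matrices indexed by configurations.\<close>

type_synonym qubit = "nat \<times> nat"
type_synonym cfg = "qubit \<Rightarrow> bool"
type_synonym op = "cfg \<Rightarrow> cfg \<Rightarrow> complex"

definition cfgs :: "qubit set \<Rightarrow> cfg set" where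
  "cfgs Q = PiE Q (\<lambda>_. UNIV)"

definition qubits :: "nat set \<Rightarrow> nat \<Rightarrow> qubit set" where
  "qubits \<Lambda> nq = \<Lambda> \<times> {..<nq}"

definition mident :: "op" where
  "mident = (\<lambda>x y. if x = y then 1 else 0)"

definition mmult :: "qubit set \<Rightarrow> op \<Rightarrow> op \<Rightarrow> op" where
  "mmult Q A B = (\<lambda>x y. \<Sum>z\<in>cfgs Q. A x z * B z y)"

definition msmult :: "complex \<Rightarrow> op \<Rightarrow> op" where
  "msmult c A = (\<lambda>x y. c * A x y)"

definition mdiff :: "op \<Rightarrow> op \<Rightarrow> op" where
  "mdiff A B = (\<lambda>x y. A x y - B x y)"

definition msum_list :: "op list \<Rightarrow> op" where
  "msum_list As = (\<lambda>x y. sum_list (map (\<lambda>A. A x y) As))"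

fun mpow :: "qubit set \<Rightarrow> op \<Rightarrow> nat \<Rightarrow> op" where
  "mpow Q A 0 = mident"
| "mpow Q A (Suc n) = mmult Q A (mpow Q A n)"

fun mprod :: "qubit set \<Rightarrow> op list \<Rightarrow> op" where
  "mprod Q [] = mident"
| "mprod Q (A # As) = mmult Q A (mprod Q As)"

definition mexp :: "qubit set \<Rightarrow> op \<Rightarrow> op" where
  "mexp Q A = (\<lambda>x y. \<Sum>n. mpow Q A n x y / of_nat (fact n))"

definition herm :: "qubit set \<Rightarrow> op \<Rightarrow> bool" where
  "herm Q A \<longleftrightarrow> (\<forall>x\<in>cfgs Q. \<forall>y\<in>cfgs Q. A y x = cnj (A x y))"

definition vnorm :: "qubit set \<Rightarrow> (cfg \<Rightarrow> complex) \<Rightarrow> real" where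
  "vnorm Q v = sqrt (\<Sum>x\<in>cfgs Q. (cmod (v x))\<^sup>2)"

definition mapply :: "qubit set \<Rightarrow> op \<Rightarrow> (cfg \<Rightarrow> complex) \<Rightarrow> (cfg \<Rightarrow> complex)" where
  "mapply Q A v = (\<lambda>x. \<Sum>y\<in>cfgs Q. A x y * v y)"

definition opnorm :: "qubit set \<Rightarrow> op \<Rightarrow> real" where
  "opnorm Q A = (SUP v\<in>{v. vnorm Q v = 1}. vnorm Q (mapply Q A v))"

datatype pauli = PI | PX | PY | PZ

text \<open>Single-qubit Pauli matrices, basis False = |0>, True = |1>.\<close>
fun pmat :: "pauli \<Rightarrow> bool \<Rightarrow> bool \<Rightarrow> complex" where
  "pmat PI x y = (if x = y then 1 else 0)"
| "pmat PX x y = (if x \<noteq> y then 1 else 0)"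
| "pmat PY x y = (if \<not> x \<and> y then - \<i> else if x \<and> \<not> y then \<i> else 0)"
| "pmat PZ x y = (if x = y then (if x then -1 else 1) else 0)"

type_synonym pstring = "qubit \<Rightarrow> pauli"

definition pstr :: "qubit set \<Rightarrow> pstring \<Rightarrow> op" where
  "pstr Q P = (\<lambda>x y. \<Prod>q\<in>Q. pmat (P q) (x q) (y q))"

text \<open>A term index J is a list of sites (an ordered k-tuple); dec J is the
  Pauli decomposition of H_J as a list of (coefficient, Pauli string).\<close>

type_synonym pdec = "nat list \<Rightarrow> (complex \<times> pstring) list"

definition pterms :: "qubit set \<Rightarrow> pdec \<Rightarrow> nat list \<Rightarrow> op list" where
  "pterms Q dec J = map (\<lambda>(c, P). msmult c (pstr Q P)) (dec J)"

definition HJ :: "qubit set \<Rightarrow> pdec \<Rightarrow> nat list \<Rightarrow> op" where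
  "HJ Q dec J = msum_list (pterms Q dec J)"

definition Htot :: "qubit set \<Rightarrow> nat list set \<Rightarrow> pdec \<Rightarrow> op" where
  "Htot Q S dec = (\<lambda>x y. \<Sum>J\<in>S. HJ Q dec J x y)"

definition klocal_ham ::
  "nat set \<Rightarrow> nat \<Rightarrow> nat \<Rightarrow> nat list set \<Rightarrow> pdec \<Rightarrow> bool" where
  "klocal_ham \<Lambda> nq k S dec \<longleftrightarrow>
     finite \<Lambda> \<and> \<Lambda> \<noteq> {} \<and> finite S \<and>
     (\<forall>J\<in>S. length J = k \<and> set J \<subseteq> \<Lambda>) \<and>
     (\<forall>J\<in>S. distinct (map snd (dec J))) \<and>
     (\<forall>J\<in>S. \<forall>(c, P)\<in>set (dec J). c \<noteq> 0 \<and>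
              (\<forall>q. q \<notin> set J \<times> {..<nq} \<longrightarrow> P q = PI)) \<and>
     (\<forall>J\<in>S. herm (qubits \<Lambda> nq) (HJ (qubits \<Lambda> nq) dec J))"

definition NH :: "nat list set \<Rightarrow> nat" where
  "NH S = card S"

definition NP :: "nat list set \<Rightarrow> pdec \<Rightarrow> nat" where
  "NP S dec = Max (insert 0 ((\<lambda>J. length (dec J)) ` S))"

definition cP :: "nat list set \<Rightarrow> pdec \<Rightarrow> real" where
  "cP S dec = Max (insert 0 {cmod c | c J P. J \<in> S \<and> (c, P) \<in> set (dec J)})"

definition ind_sum :: "qubit set \<Rightarrow> nat list set \<Rightarrow> pdec \<Rightarrow> nat \<Rightarrow> nat \<Rightarrow> real" where
  "ind_sum Q S dec l j = (\<Sum>J\<in>{J\<in>S. J ! l = j}. opnorm Q (HJ Q dec J))"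

definition ind1norm :: "nat set \<Rightarrow> nat \<Rightarrow> nat \<Rightarrow> nat list set \<Rightarrow> pdec \<Rightarrow> real" where
  "ind1norm \<Lambda> nq k S dec =
     Max ((\<lambda>(l, j). ind_sum (qubits \<Lambda> nq) S dec l j) ` ({..<k} \<times> \<Lambda>))"

definition Nind :: "nat set \<Rightarrow> nat \<Rightarrow> nat \<Rightarrow> nat list set \<Rightarrow> pdec \<Rightarrow> nat" where
  "Nind \<Lambda> nq k S dec =
     Min ((\<lambda>(l, j). card {J\<in>S. J ! l = j}) `
          {(l, j) \<in> {..<k} \<times> \<Lambda>. ind_sum (qubits \<Lambda> nq) S dec l j = ind1norm \<Lambda> nq k S dec})"

text \<open>A product formula over terms h_0, ..., h_{G-1} is a list of \<Upsilon> stages;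
  each stage is a list of pairs (term index, coefficient a) listing every term
  exactly once (the order is the stage's reordering P_v).  Evaluated at tau
  it is the ordered product of the factors exp(-i tau a h_g).\<close>

type_synonym pform = "(nat \<times> real) list list"

definition valid_pf :: "nat \<Rightarrow> nat \<Rightarrow> real \<Rightarrow> pform \<Rightarrow> bool" where
  "valid_pf G \<Upsilon> A pf \<longleftrightarrow>
     length pf = \<Upsilon> \<and>
     (\<forall>st\<in>set pf. distinct (map fst st) \<and> set (map fst st) = {..<G}) \<and>
     (\<forall>st\<in>set pf. \<forall>(g, a)\<in>set st. \<bar>a\<bar> \<le> A) \<and>
     (\<forall>g<G. (\<Sum>st\<leftarrow>pf. \<Sum>(g', a)\<leftarrow>st. if g' = g then a else 0) = 1)"

definition pf_eval :: "qubit set \<Rightarrow> op list \<Rightarrow> pform \<Rightarrow> real \<Rightarrow> op" where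
  "pf_eval Q hs pf \<tau> =
     mprod Q (map (\<lambda>st. mprod Q (map (\<lambda>(g, a).
        mexp Q (msmult (- \<i> * complex_of_real (\<tau> * a)) (hs ! g))) st)) pf)"

definition pf_order :: "qubit set \<Rightarrow> op list \<Rightarrow> pform \<Rightarrow> nat \<Rightarrow> bool" where
  "pf_order Q hs pf p \<longleftrightarrow>
     (\<lambda>\<tau>::real. opnorm Q (mdiff (pf_eval Q hs pf \<tau>)
                  (mexp Q (msmult (- \<i> * complex_of_real \<tau>) (msum_list hs)))))
       \<in> O[at 0](\<lambda>\<tau>. \<tau> ^ (p + 1))"

text \<open>Outer formula pf over the terms H_{Js!g}; each factor exp(-i t a H_J / r)
  of stage v is replaced by (S_J(t a/(r m)))^m with inner formula ipf J over
  the Pauli terms of H_J and inner Trotter number m = m v g.\<close>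

definition circuit ::
  "qubit set \<Rightarrow> pdec \<Rightarrow> nat list list \<Rightarrow> pform \<Rightarrow> (nat list \<Rightarrow> pform)
     \<Rightarrow> (nat \<Rightarrow> nat \<Rightarrow> nat) \<Rightarrow> real \<Rightarrow> nat \<Rightarrow> op" where
  "circuit Q dec Js pf ipf m t r =
     mpow Q (mprod Q (map (\<lambda>v. mprod Q (map (\<lambda>(g, a).
        mpow Q (pf_eval Q (pterms Q dec (Js ! g)) (ipf (Js ! g))
                  (t * a / (real r * real (m v g)))) (m v g)) (pf ! v)))
       [0..<length pf])) r"

text \<open>Number of (scaled) Pauli-string exponentials in the circuit; each costs
  O(1) elementary gates in the cost model.\<close>
definition gate_count ::
  "nat list list \<Rightarrow> pform \<Rightarrow> (nat list \<Rightarrow> pform) \<Rightarrow> (nat \<Rightarrow> nat \<Rightarrow> nat) \<Rightarrow> nat \<Rightarrow> nat" where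
  "gate_count Js pf ipf m r =
     r * (\<Sum>v<length pf. \<Sum>(g, a)\<leftarrow>pf ! v. m v g * length (concat (ipf (Js ! g))))"

end

theory Submission
  imports Defs "HOL-Library.Sublist"
begin

text \<open>
  For anti-Hermitian $A_1, \dots, A_s$ the product $S(\tau) = e^{\tau A_1} \cdots e^{\tau A_s}$
  satisfies $S' = F S$, where $F(\tau)$ is the sum over $j$ of $A_j$ conjugated by the
  exponentials to its left. Expanding these conjugations from the inside out, with a Taylor
  remainder at each stage, gives $F(\tau) = \sum_{q<p} \tau^q C_q + R(\tau)$, where $R$ is bounded by
  $\tau^p$ times the norms of $p$-fold nested commutators. If $S$ has order $p$ with respect to
  $e^{\tau H}$, then comparing leading terms of $(e^{-\tau H} S)' = e^{-\tau H} (F - H) S$ forces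
  $C_0 = H$ and $C_q = 0$ for $0 < q < p$, and integration bounds the error of one step. A nested
  commutator of depth $n$ of $k$-local terms commutes with every term that avoids a set of at most
  $(n+1)k$ sites, so each further commutator costs a factor $O(|||H|||_1)$. For the
  Pauli terms of a single $H_J$ the trivial commutator bound suffices, and one inner step per factor
  is already accurate enough.

  To use exponentials and derivatives in a Banach algebra although the matrix size varies with
  the statement, all matrices are embedded into the bounded operators on one space of
  square-summable families.
\<close>

section \<open>Trotter error with commutator scaling in a Banach algebra\<close>

text \<open>The constants may depend only on \<open>p\<close>, \<open>k\<close>,
  \<open>\<Upsilon>\<close> and \<open>A\<close>, whereas the constant hidden in
  \<open>pf_order\<close> depends on the Hamiltonian in an uncontrolled way. The order condition is
  therefore used only qualitatively, and every quantitative bound comes from the remainder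
  \<open>R\<close>, whose estimate holds for all times and not only near 0. Uniformity also rules
  out any factor that grows with the matrix dimension, so all estimates are in the operator norm,
  with exponentials bounded by 1. The algebra is real: the factor \<open>-i\<close> is put into the
  matrix before it is embedded, and product formulas take only real multiples. For a single Pauli
  term, a contractive exponential requires a real coefficient, which has to be deduced from
  Hermiticity of the whole sum \<open>H_J\<close>. One inner step suffices because the accumulated
  inner error is of size N_H (N_P c_P t)^(p+1) / r^p, which is the outer bound without the factor
  N_ind^p.\<close>

definition commutator :: "'a::ring \<Rightarrow> 'a \<Rightarrow> 'a" where
  "commutator A X = A * X - X * A"

text \<open>Substitute for anti-Hermiticity in an algebra without involution. As \<open>s\<close>
  may be negative, the inverse exponentials are contractions too.\<close>

definition contraction_group :: "'a::{real_normed_algebra_1,banach} \<Rightarrow> bool" where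
  "contraction_group A \<longleftrightarrow> (\<forall>s. norm (exp (s *\<^sub>R A)) \<le> 1)"

definition conj_exp :: "real \<Rightarrow> 'a::{real_normed_algebra_1,banach} \<Rightarrow> 'a \<Rightarrow> 'a" where
  "conj_exp s A X = exp (s *\<^sub>R A) * X * exp (- (s *\<^sub>R A))"

lemma contraction_groupD:
  assumes "contraction_group A"
  shows "norm (exp (s *\<^sub>R A)) \<le> 1" "norm (exp (- (s *\<^sub>R A))) \<le> 1"
  using assms[unfolded contraction_group_def, rule_format, of s]
    assms[unfolded contraction_group_def, rule_format, of "- s"] by auto

lemma contraction_group_scaleR:
  assumes "contraction_group A"
  shows "contraction_group (c *\<^sub>R A)"
  using assms by (simp add: contraction_group_def)

lemma norm_mult_le_right:
  fixes x y :: "'a::real_normed_algebra_1"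
  assumes "norm x \<le> 1"
  shows "norm (x * y) \<le> norm y" "norm (y * x) \<le> norm y"
  using norm_mult_ineq[of x y] norm_mult_ineq[of y x] assms
    mult_left_le[of "norm x" "norm y"] mult_left_le_one_le[of "norm y" "norm x"]
  by auto

section \<open>Conjugation by a one-parameter group and its Taylor expansion\<close>

lemma norm_conj_exp:
  assumes "contraction_group A"
  shows "norm (conj_exp s A X) \<le> norm X"
  unfolding conj_exp_def
  by (meson order_trans norm_mult_le_right contraction_groupD[OF assms])

lemma conj_exp_linear:
  "conj_exp s A (X + Y) = conj_exp s A X + conj_exp s A Y"
  "conj_exp s A (X - Y) = conj_exp s A X - conj_exp s A Y"
  "conj_exp s A (c *\<^sub>R X) = c *\<^sub>R conj_exp s A X"
  by (simp_all add: conj_exp_def algebra_simps)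

lemma exp_neg_scaleR_has_vector_derivative:
  fixes A :: "'a::{real_normed_algebra_1,banach}"
  shows "((\<lambda>t. exp (- (t *\<^sub>R A))) has_vector_derivative - (exp (- (t *\<^sub>R A)) * A)) (at t)"
    "((\<lambda>t. exp (- (t *\<^sub>R A))) has_vector_derivative - (A * exp (- (t *\<^sub>R A)))) (at t)"
  using exp_scaleR_has_vector_derivative_right[of "- A" t UNIV]
    exp_scaleR_has_vector_derivative_left[of "- A" t] by auto

lemma conj_exp_has_vector_derivative:
  "((\<lambda>s. conj_exp s A X) has_vector_derivative conj_exp s A (commutator A X)) (at s)"
proof -
  have "((\<lambda>s. exp (s *\<^sub>R A) * X * exp (- (s *\<^sub>R A))) has_vector_derivative
      exp (s *\<^sub>R A) * X * (- (A * exp (- (s *\<^sub>R A)))) +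
        (exp (s *\<^sub>R A) * A * X) * exp (- (s *\<^sub>R A))) (at s)"
    by (rule has_vector_derivative_mult has_vector_derivative_mult_left
        exp_neg_scaleR_has_vector_derivative exp_scaleR_has_vector_derivative_right)+
  then show ?thesis
    by (simp add: conj_exp_def commutator_def algebra_simps)
qed

text \<open>Mean value bound on the symmetric interval, so that negative times are covered: a
  product formula may run a factor backwards.\<close>

lemma norm_diff_le_of_vector_derivative:
  fixes f :: "real \<Rightarrow> 'a::real_normed_vector"
  assumes "\<And>s. (f has_vector_derivative f' s) (at s)"
    and "\<And>s. \<bar>s\<bar> \<le> \<bar>t\<bar> \<Longrightarrow> norm (f' s) \<le> B"
  shows "norm (f t - f 0) \<le> B * \<bar>t\<bar>"
proof -
  have "norm (f t - f 0) \<le> B * norm (t - 0)"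
  proof (rule differentiable_bound[where S = "{-\<bar>t\<bar>..\<bar>t\<bar>}"])
    fix s assume s: "s \<in> {-\<bar>t\<bar>..\<bar>t\<bar>}"
    show "(f has_derivative (\<lambda>h. h *\<^sub>R f' s)) (at s within {-\<bar>t\<bar>..\<bar>t\<bar>})"
      using assms(1)[of s] by (simp add: has_vector_derivative_def has_derivative_at_withinI)
    have "norm (f' s) \<le> B" using assms(2)[of s] s by auto
    then show "onorm (\<lambda>h. h *\<^sub>R f' s) \<le> B"
      by (intro onorm_le) (simp add: mult_left_mono mult.commute[of B])
  qed auto
  then show ?thesis by simp
qed

text \<open>The remainder of order \<open>n + 1\<close> for \<open>X\<close> has as derivative the
  remainder of order \<open>n\<close> for \<open>commutator A X\<close>, so the induction runs over
  all \<open>X\<close> and \<open>t\<close>. The mean value bound replaces integration, at the price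
  of the factor \<open>1 / fact n\<close>.\<close>

lemma conj_exp_Taylor:
  assumes "contraction_group A"
  shows "norm (conj_exp t A X - (\<Sum>i<n. (t ^ i / fact i) *\<^sub>R (commutator A ^^ i) X))
    \<le> \<bar>t\<bar> ^ n * norm ((commutator A ^^ n) X)"
proof (induction n arbitrary: X t)
  case 0
  then show ?case using norm_conj_exp[OF assms] by simp
next
  case (Suc n)
  define f where "f s = conj_exp s A X - (\<Sum>i<Suc n. (s ^ i / fact i) *\<^sub>R (commutator A ^^ i) X)" for s
  define f' where "f' s = conj_exp s A (commutator A X)
      - (\<Sum>i<n. (s ^ i / fact i) *\<^sub>R (commutator A ^^ i) (commutator A X))" for s
  have "(f has_vector_derivative f' s) (at s)" for s
  proof -
    have "((\<lambda>s. (s ^ Suc i / fact (Suc i)) *\<^sub>R (commutator A ^^ Suc i) X) has_vector_derivative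
       (s ^ i / fact i) *\<^sub>R (commutator A ^^ i) (commutator A X)) (at s)" for i
    proof -
      have "((\<lambda>s::real. s ^ Suc i / fact (Suc i)) has_real_derivative (s ^ i / fact i)) (at s)"
        by (auto intro!: derivative_eq_intros simp del: power_Suc)
      then show ?thesis
        unfolding has_real_derivative_iff_has_vector_derivative funpow_Suc_right o_apply
        by (rule bounded_linear.has_vector_derivative[OF bounded_linear_scaleR_left])
    qed
    then have "((\<lambda>s. conj_exp s A X - (X + (\<Sum>i<n. (s ^ Suc i / fact (Suc i)) *\<^sub>R (commutator A ^^ Suc i) X)))
      has_vector_derivative conj_exp s A (commutator A X) - (0 + (\<Sum>i<n. (s ^ i / fact i) *\<^sub>R (commutator A ^^ i) (commutator A X)))) (at s)"
      by (intro has_vector_derivative_diff has_vector_derivative_add conj_exp_has_vector_derivative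
          has_vector_derivative_const has_vector_derivative_sum) auto
    \<comment> \<open>The summand \<open>i = 0\<close> is the constant \<open>X\<close>; the others
      differentiate termwise to the Taylor sum of \<open>commutator A X\<close>.\<close>
    moreover have "f = (\<lambda>s. conj_exp s A X - (X + (\<Sum>i<n. (s ^ Suc i / fact (Suc i)) *\<^sub>R (commutator A ^^ Suc i) X)))"
      by (rule ext) (simp add: f_def sum.lessThan_Suc_shift del: sum.lessThan_Suc)
    ultimately show ?thesis by (simp add: f'_def)
  qed
  moreover have "norm (f' s) \<le> \<bar>t\<bar> ^ n * norm ((commutator A ^^ Suc n) X)" if "\<bar>s\<bar> \<le> \<bar>t\<bar>" for s
  proof -
    have "norm (f' s) \<le> \<bar>s\<bar> ^ n * norm ((commutator A ^^ n) (commutator A X))"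
      unfolding f'_def by (rule Suc)
    also have "\<dots> \<le> \<bar>t\<bar> ^ n * norm ((commutator A ^^ Suc n) X)"
      using that by (simp add: funpow_Suc_right mult_right_mono power_mono del: funpow.simps)
    finally show ?thesis .
  qed
  ultimately have "norm (f t - f 0) \<le> \<bar>t\<bar> ^ n * norm ((commutator A ^^ Suc n) X) * \<bar>t\<bar>"
    by (rule norm_diff_le_of_vector_derivative)
  moreover have "f 0 = 0"
    by (simp add: f_def sum.lessThan_Suc_shift conj_exp_def del: sum.lessThan_Suc)
  ultimately show ?case
    by (simp add: f_def mult_ac)
qed

text \<open>The list is given from the innermost conjugation to the outermost one.\<close>

fun conj_exps :: "real \<Rightarrow> 'a::{real_normed_algebra_1,banach} list \<Rightarrow> 'a \<Rightarrow> 'a" where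
  "conj_exps s [] X = X"
| "conj_exps s (A # As) X = conj_exps s As (conj_exp s A X)"

lemma conj_exps_linear:
  "conj_exps s As (X + Y) = conj_exps s As X + conj_exps s As Y"
  "conj_exps s As (X - Y) = conj_exps s As X - conj_exps s As Y"
  "conj_exps s As (c *\<^sub>R X) = c *\<^sub>R conj_exps s As X"
  by (induction As arbitrary: X Y) (simp_all add: conj_exp_linear)

lemma conj_exps_sum: "conj_exps s As (sum f I) = (\<Sum>i\<in>I. conj_exps s As (f i))"
proof (induction I rule: infinite_finite_induct)
  case empty
  show ?case using conj_exps_linear(3)[of s As 0 0] by simp
next
  case (infinite I)
  then show ?case using conj_exps_linear(3)[of s As 0 0] by simp
qed (simp add: conj_exps_linear)

lemma norm_conj_exps:
  assumes "\<forall>A\<in>set As. contraction_group A"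
  shows "norm (conj_exps s As X) \<le> norm X"
  using assms
proof (induction As arbitrary: X)
  case (Cons A As)
  then show ?case
    using norm_conj_exp[of A s X] by (simp, meson order_trans)
qed simp

section \<open>Polynomial approximation with a tracked remainder\<close>

text \<open>The coefficients stay existential because only the order condition will determine them;
  the remainder constant \<open>b\<close> is explicit and valid for all \<open>t\<close>. For
  \<open>n = 0\<close> the predicate just bounds \<open>f\<close>.\<close>

definition poly_approx :: "nat \<Rightarrow> (real \<Rightarrow> 'a::real_normed_vector) \<Rightarrow> real \<Rightarrow> bool" where
  "poly_approx n f b \<longleftrightarrow>
     (\<exists>C. \<forall>t. norm (f t - (\<Sum>q<n. t ^ q *\<^sub>R C q)) \<le> \<bar>t\<bar> ^ n * b)"

lemma poly_approx_add:
  assumes "poly_approx n f a" "poly_approx n g b"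
  shows "poly_approx n (\<lambda>t. f t + g t) (a + b)"
proof -
  obtain C D where C: "\<And>t. norm (f t - (\<Sum>q<n. t ^ q *\<^sub>R C q)) \<le> \<bar>t\<bar> ^ n * a"
    and D: "\<And>t. norm (g t - (\<Sum>q<n. t ^ q *\<^sub>R D q)) \<le> \<bar>t\<bar> ^ n * b"
    using assms unfolding poly_approx_def by auto
  show ?thesis unfolding poly_approx_def
  proof (intro exI[of _ "\<lambda>q. C q + D q"] allI)
    fix t
    show "norm (f t + g t - (\<Sum>q<n. t ^ q *\<^sub>R (C q + D q))) \<le> \<bar>t\<bar> ^ n * (a + b)"
      using norm_triangle_mono[OF C[of t] D[of t]]
      by (simp add: algebra_simps sum.distrib)
  qed
qed

lemma poly_approx_const: "n > 0 \<Longrightarrow> poly_approx n (\<lambda>t. X) 0"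
  unfolding poly_approx_def
  by (rule exI[of _ "\<lambda>q. if q = 0 then X else 0"]) (simp add: if_distrib[of "scaleR _"] sum.If_cases cong: if_cong)

lemma poly_approx_zero: "poly_approx n (\<lambda>t. 0) 0"
  unfolding poly_approx_def by (rule exI[of _ "\<lambda>q. 0"]) simp

lemma poly_approx_small:
  assumes "\<And>t. norm (f t) \<le> \<bar>t\<bar> ^ n * b"
  shows "poly_approx n f b"
  unfolding poly_approx_def using assms by (intro exI[of _ "\<lambda>q. 0"]) simp

lemma poly_approx_sum:
  assumes "finite I" "\<And>i. i \<in> I \<Longrightarrow> poly_approx n (f i) (b i)"
  shows "poly_approx n (\<lambda>t. \<Sum>i\<in>I. f i t) (\<Sum>i\<in>I. b i)"
  using assms by (induction I rule: finite_induct) (auto intro!: poly_approx_zero poly_approx_add)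

text \<open>Used with the Taylor coefficients \<open>c = 1 / fact i\<close>; they are at most 1, so
  the remainder constant does not grow.\<close>

lemma poly_approx_shift:
  assumes f: "poly_approx n f b" and c: "\<bar>c\<bar> \<le> 1" and b: "b \<ge> 0"
  shows "poly_approx (n + i) (\<lambda>t. (c * t ^ i) *\<^sub>R f t) b"
proof -
  obtain C where C: "\<And>t. norm (f t - (\<Sum>q<n. t ^ q *\<^sub>R C q)) \<le> \<bar>t\<bar> ^ n * b"
    using f unfolding poly_approx_def by auto
  show ?thesis unfolding poly_approx_def
  proof (intro exI[of _ "\<lambda>q. if q < i then 0 else c *\<^sub>R C (q - i)"] allI)
    fix t :: real
    have "(\<Sum>q<n + i. t ^ q *\<^sub>R (if q < i then 0 else c *\<^sub>R C (q - i)))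
        = (\<Sum>q\<in>{i..<n + i}. t ^ q *\<^sub>R c *\<^sub>R C (q - i))"
      by (rule sum.mono_neutral_cong_right) auto
    also have "\<dots> = (\<Sum>q\<in>{0..<n}. t ^ (q + i) *\<^sub>R c *\<^sub>R C q)"
      using sum.shift_bounds_nat_ivl[of "\<lambda>q. t ^ q *\<^sub>R c *\<^sub>R C (q - i)" 0 i n] by simp
    also have "\<dots> = (c * t ^ i) *\<^sub>R (\<Sum>q<n. t ^ q *\<^sub>R C q)"
      by (simp add: scaleR_sum_right power_add mult_ac atLeast0LessThan)
    finally have *: "(c * t ^ i) *\<^sub>R f t - (\<Sum>q<n + i. t ^ q *\<^sub>R (if q < i then 0 else c *\<^sub>R C (q - i)))
        = (c * t ^ i) *\<^sub>R (f t - (\<Sum>q<n. t ^ q *\<^sub>R C q))"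
      by (simp add: algebra_simps)
    have "norm ((c * t ^ i) *\<^sub>R (f t - (\<Sum>q<n. t ^ q *\<^sub>R C q))) \<le> (1 * \<bar>t\<bar> ^ i) * (\<bar>t\<bar> ^ n * b)"
      unfolding norm_scaleR abs_mult power_abs
      by (intro mult_mono C c order_refl) (use b in auto)
    then show "norm ((c * t ^ i) *\<^sub>R f t - (\<Sum>q<n + i. t ^ q *\<^sub>R (if q < i then 0 else c *\<^sub>R C (q - i))))
       \<le> \<bar>t\<bar> ^ (n + i) * b"
      unfolding * by (simp add: power_add mult_ac)
  qed
qed

section \<open>Weights of nested commutators\<close>

text \<open>The sum, over all exponents with i_1 + ... + i_s = n, of the norms of ad(A_s)^(i_s) ...
  ad(A_1)^(i_1) X, where ad(A) is the commutator with A. The head of the list acts first.\<close>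

fun comm_weight :: "'a::{real_normed_algebra_1,banach} list \<Rightarrow> nat \<Rightarrow> 'a \<Rightarrow> real" where
  "comm_weight [] n X = (if n = 0 then norm X else 0)"
| "comm_weight (A # As) n X = (\<Sum>i\<le>n. comm_weight As (n - i) ((commutator A ^^ i) X))"

lemma comm_weight_nonneg: "comm_weight As n X \<ge> 0"
  by (induction As arbitrary: n X) (auto intro: sum_nonneg)

lemma comm_weight_0 [simp]: "comm_weight As 0 X = norm X"
  by (induction As arbitrary: X) auto

text \<open>Expanding the innermost conjugation first keeps the remainders inside conjugations
  by contractions; the exponentials of the remaining factors then never enter a commutator.\<close>

lemma poly_approx_conj_exps:
  assumes "\<forall>A\<in>set As. contraction_group A"
  shows "poly_approx n (\<lambda>t. conj_exps t As X) (comm_weight As n X)"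
  using assms
proof (induction As arbitrary: n X)
  case Nil
  show ?case
    using poly_approx_const[of n X] poly_approx_small[of "\<lambda>t. X" 0 "norm X"] by (cases "n = 0") auto
next
  case (Cons A As)
  define R where "R t = conj_exp t A X - (\<Sum>i<n. (t ^ i / fact i) *\<^sub>R (commutator A ^^ i) X)" for t
  have 1: "poly_approx n (\<lambda>t. (1 / fact i * t ^ i) *\<^sub>R conj_exps t As ((commutator A ^^ i) X))
      (comm_weight As (n - i) ((commutator A ^^ i) X))" if "i \<in> {..<n}" for i
  proof -
    have "poly_approx (n - i) (\<lambda>t. conj_exps t As ((commutator A ^^ i) X))
      (comm_weight As (n - i) ((commutator A ^^ i) X))"
      using Cons by simp
    from poly_approx_shift[OF this _ comm_weight_nonneg, of "1 / fact i" i] show ?thesis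
      using that fact_ge_1[of i, where 'a = real] by simp
  qed
  have 2: "poly_approx n (\<lambda>t. conj_exps t As (R t)) (norm ((commutator A ^^ n) X))"
  proof (rule poly_approx_small)
    fix t
    have "norm (conj_exps t As (R t)) \<le> norm (R t)"
      using Cons.prems by (intro norm_conj_exps) auto
    also have "\<dots> \<le> \<bar>t\<bar> ^ n * norm ((commutator A ^^ n) X)"
      unfolding R_def using Cons.prems by (intro conj_exp_Taylor) auto
    finally show "norm (conj_exps t As (R t)) \<le> \<bar>t\<bar> ^ n * norm ((commutator A ^^ n) X)" .
  qed
  have "conj_exps t (A # As) X =
      (\<Sum>i<n. (1 / fact i * t ^ i) *\<^sub>R conj_exps t As ((commutator A ^^ i) X)) + conj_exps t As (R t)" for t
  proof -
    have "conj_exp t A X = (\<Sum>i<n. (1 / fact i * t ^ i) *\<^sub>R (commutator A ^^ i) X) + R t"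
      by (simp add: R_def)
    then show ?thesis
      by (simp add: conj_exps_linear conj_exps_sum del: times_divide_eq_left)
  qed
  \<comment> \<open>The summand \<open>i = n\<close> is exactly the Taylor remainder of the
    innermost stage, because \<open>comm_weight As 0\<close> is the norm.\<close>
  moreover have "comm_weight (A # As) n X =
      (\<Sum>i<n. comm_weight As (n - i) ((commutator A ^^ i) X)) + norm ((commutator A ^^ n) X)"
    by (simp add: lessThan_Suc_atMost[symmetric])
  ultimately show ?case
    using poly_approx_add[OF poly_approx_sum[OF finite_lessThan 1] 2] by simp
qed

text \<open>Separates exponent 0 for \<open>A\<close> from positive exponents. In the second case
  one commutator with \<open>A\<close> is split off and \<open>A\<close> remains available, so a
  weight can be analysed one commutator at a time.\<close>

lemma comm_weight_Cons_Suc: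
  "comm_weight (A # As) (Suc n) X = comm_weight As (Suc n) X + comm_weight (A # As) n (commutator A X)"
  by (simp add: sum.atMost_Suc_shift funpow_Suc_right del: funpow.simps sum.atMost_Suc)

text \<open>\<open>P n X\<close> is an invariant of \<open>n\<close>-fold nested commutators, e.g. a bound on their support.\<close>

lemma comm_weight_le:
  assumes "K \<ge> 0"
    and comm: "\<And>n X. n < N \<Longrightarrow> P n X \<Longrightarrow> (\<Sum>A\<leftarrow>As. norm (commutator A X)) \<le> K * norm X"
    and step: "\<And>n X A. n < N \<Longrightarrow> P n X \<Longrightarrow> A \<in> set As \<Longrightarrow> P (Suc n) (commutator A X)"
  shows "suffix Bs As \<Longrightarrow> P n X \<Longrightarrow> n + m \<le> N \<Longrightarrow> comm_weight Bs m X \<le> K ^ m * norm X"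
proof (induction m arbitrary: Bs n X)
  case (Suc m)
  \<comment> \<open>The recursion is summed along the list: the next commutator is taken with some
    \<open>A\<close>, after which only \<open>A\<close> and later entries act. These form a suffix
    again, so the outer induction hypothesis applies to each.\<close>
  have "suffix Cs As \<Longrightarrow> comm_weight Cs (Suc m) X \<le> (\<Sum>A\<leftarrow>Cs. K ^ m * norm (commutator A X))" for Cs
  proof (induction Cs)
    case (Cons A Cs)
    have "A \<in> set As" using Cons.prems by (auto simp: suffix_def)
    then have "comm_weight (A # Cs) m (commutator A X) \<le> K ^ m * norm (commutator A X)"
      using Suc.prems Cons.prems by (intro Suc.IH[where n = "Suc n"] step) auto
    then show ?case
      unfolding comm_weight_Cons_Suc using Cons.IH Cons.prems
      by (simp add: suffix_Cons suffix_ConsD)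
  qed simp
  from this[OF Suc.prems(1)]
  have "comm_weight Bs (Suc m) X \<le> K ^ m * (\<Sum>A\<leftarrow>Bs. norm (commutator A X))"
    by (simp only: sum_list_const_mult)
  also have "\<dots> \<le> K ^ m * (K * norm X)"
  proof (rule mult_left_mono)
    obtain Cs where "As = Cs @ Bs" using Suc.prems(1) by (auto simp: suffix_def)
    then have "(\<Sum>A\<leftarrow>Bs. norm (commutator A X)) \<le> (\<Sum>A\<leftarrow>As. norm (commutator A X))"
      by (auto intro!: sum_list_nonneg)
    also have "\<dots> \<le> K * norm X" using Suc.prems by (intro comm) auto
    finally show "(\<Sum>A\<leftarrow>Bs. norm (commutator A X)) \<le> K * norm X" .
  qed (use \<open>K \<ge> 0\<close> in simp)
  finally show ?case by (simp only: power_Suc mult_ac)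
qed simp

section \<open>The logarithmic derivative of a product of exponentials\<close>

definition prod_exps :: "'a::{real_normed_algebra_1,banach} list \<Rightarrow> real \<Rightarrow> 'a" where
  "prod_exps As t = prod_list (map (\<lambda>A. exp (t *\<^sub>R A)) As)"

text \<open>The left logarithmic derivative of \<open>prod_exps As\<close>: moving the generator of
  the tail to the left past \<open>exp (t A)\<close> conjugates it.\<close>

fun generator :: "real \<Rightarrow> 'a::{real_normed_algebra_1,banach} list \<Rightarrow> 'a" where
  "generator t [] = 0"
| "generator t (A # As) = A + conj_exp t A (generator t As)"

lemma conj_exp_mult_exp: "conj_exp t A X * exp (t *\<^sub>R A) = exp (t *\<^sub>R A) * X"
  using exp_minus_inverse[of "- (t *\<^sub>R A)"] by (simp add: conj_exp_def mult.assoc)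

lemma prod_exps_has_vector_derivative:
  "(prod_exps As has_vector_derivative generator t As * prod_exps As t) (at t)"
proof (induction As)
  case Nil
  show ?case by (simp add: prod_exps_def[abs_def])
next
  case (Cons A As)
  have "((\<lambda>t. exp (t *\<^sub>R A) * prod_exps As t) has_vector_derivative
      exp (t *\<^sub>R A) * (generator t As * prod_exps As t) + A * exp (t *\<^sub>R A) * prod_exps As t) (at t)"
    by (rule has_vector_derivative_mult exp_scaleR_has_vector_derivative_left Cons)+
  moreover have "prod_exps (A # As) = (\<lambda>t. exp (t *\<^sub>R A) * prod_exps As t)"
    by (auto simp: prod_exps_def)
  moreover have "generator t (A # As) * (exp (t *\<^sub>R A) * prod_exps As t) =
      exp (t *\<^sub>R A) * (generator t As * prod_exps As t) + A * exp (t *\<^sub>R A) * prod_exps As t"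
    using conj_exp_mult_exp[of t A "generator t As"]
    by (simp add: distrib_right mult.assoc[symmetric])
  ultimately show ?case by simp
qed

lemma conj_exps_append: "conj_exps t (As @ Bs) X = conj_exps t Bs (conj_exps t As X)"
  by (induction As arbitrary: X) auto

lemma conj_exp_sum: "conj_exp t A (sum f I) = (\<Sum>i\<in>I. conj_exp t A (f i))"
  using conj_exps_sum[of t "[A]"] by simp

text \<open>\<open>rev\<close> reconciles two orders: the exponential adjacent to
  \<open>As ! j\<close> is that of the preceding entry, and \<open>conj_exps\<close> takes the
  innermost conjugation first.\<close>

lemma generator_eq_sum:
  "generator t As = (\<Sum>j<length As. conj_exps t (rev (take j As)) (As ! j))"
proof (induction As)
  case (Cons A As)
  then show ?case
    by (simp add: sum.lessThan_Suc_shift conj_exp_sum conj_exps_append del: sum.lessThan_Suc)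
qed simp

lemma poly_approx_generator:
  assumes "\<forall>A\<in>set As. contraction_group A"
    and "K \<ge> 0"
    and comm: "\<And>n X. n < p \<Longrightarrow> P n X \<Longrightarrow> (\<Sum>A\<leftarrow>As. norm (commutator A X)) \<le> K * norm X"
    and step: "\<And>n X A. n < p \<Longrightarrow> P n X \<Longrightarrow> A \<in> set As \<Longrightarrow> P (Suc n) (commutator A X)"
    and base: "\<And>A. A \<in> set As \<Longrightarrow> P 0 A"
  shows "poly_approx p (\<lambda>t. generator t As) (K ^ p * (\<Sum>A\<leftarrow>As. norm A))"
proof -
  have "poly_approx p (\<lambda>t. \<Sum>j<length As. conj_exps t (rev (take j As)) (As ! j))
      (\<Sum>j<length As. K ^ p * norm (As ! j))"
  proof (rule poly_approx_sum)
    fix j assume j: "j \<in> {..<length As}"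
    have 1: "poly_approx p (\<lambda>t. conj_exps t (rev (take j As)) (As ! j)) (comm_weight (rev (take j As)) p (As ! j))"
      using assms(1) by (intro poly_approx_conj_exps) (auto dest: in_set_takeD)
    have 2: "comm_weight (rev (take j As)) p (As ! j) \<le> K ^ p * norm (As ! j)"
    \<comment> \<open>A reversed prefix of \<open>As\<close> is a suffix of \<open>rev As\<close>,
      and the hypotheses on commutators do not depend on the order of the list.\<close>
    proof (rule comm_weight_le[where N = p and P = P and As = "rev As" and n = 0])
      have "rev As = rev (drop j As) @ rev (take j As)"
        by (metis append_take_drop_id rev_append)
      then show "suffix (rev (take j As)) (rev As)" by (auto simp: suffix_def)
    qed (use assms j in \<open>auto simp: rev_map[symmetric]\<close>)
    show "poly_approx p (\<lambda>t. conj_exps t (rev (take j As)) (As ! j)) (K ^ p * norm (As ! j))"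
      using 1 unfolding poly_approx_def
      by (meson order_trans mult_left_mono[OF 2] zero_le_power abs_ge_zero)
  qed auto
  then show ?thesis
    by (simp add: generator_eq_sum sum_list_sum_nth sum_distrib_left atLeast0LessThan)
qed

text \<open>If the leading coefficient \<open>G 0\<close> of the derivative were nonzero, integrating it would
  produce a term of exact order \<open>q + 1\<close>.\<close>

lemma leading_coeff_zero:
  fixes D :: "real \<Rightarrow> 'a::real_normed_vector"
  assumes der: "\<And>t. (D has_vector_derivative D' t) (at t)"
    and D': "\<forall>\<^sub>F t in at 0. norm (D' t - t ^ q *\<^sub>R G t) \<le> c * \<bar>t\<bar> ^ Suc q"
    and D'0: "norm (D' 0 - 0 ^ q *\<^sub>R G 0) = 0"
    and G: "isCont G 0"
    and D: "\<forall>\<^sub>F t in at 0. norm (D t - D 0) \<le> c' * \<bar>t\<bar> ^ Suc (Suc q)"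
  shows "G 0 = 0"
proof (rule ccontr)
  assume "G 0 \<noteq> 0"
  \<comment> \<open>With this choice the integrated leading term has norm exactly
    \<open>4 * \<epsilon> * t ^ Suc q\<close>, while the two error contributions below sum to at
    most \<open>3 * \<epsilon> * t ^ Suc q\<close>.\<close>
  define \<epsilon> where "\<epsilon> = norm (G 0) / (4 * real (Suc q))"
  have \<epsilon>: "\<epsilon> > 0" using \<open>G 0 \<noteq> 0\<close> by (simp add: \<epsilon>_def)
  have "\<forall>\<^sub>F t in at (0::real). c * \<bar>t\<bar> < \<epsilon>" "\<forall>\<^sub>F t in at (0::real). c' * \<bar>t\<bar> < \<epsilon>"
  proof -
    have "((\<lambda>t. c * \<bar>t\<bar>) \<longlongrightarrow> c * \<bar>0\<bar>) (at (0::real))" "((\<lambda>t. c' * \<bar>t\<bar>) \<longlongrightarrow> c' * \<bar>0\<bar>) (at (0::real))"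
      by (intro tendsto_intros)+
    then show "\<forall>\<^sub>F t in at (0::real). c * \<bar>t\<bar> < \<epsilon>" "\<forall>\<^sub>F t in at (0::real). c' * \<bar>t\<bar> < \<epsilon>"
      using \<epsilon> by (auto dest!: order_tendstoD(2))
  qed
  moreover have "\<forall>\<^sub>F t in at 0. norm (G t - G 0) < \<epsilon>"
    using G \<epsilon> by (auto simp: isCont_def tendsto_iff dist_norm)
  ultimately have "\<forall>\<^sub>F t in at 0. c * \<bar>t\<bar> < \<epsilon> \<and> c' * \<bar>t\<bar> < \<epsilon> \<and> norm (G t - G 0) < \<epsilon>
     \<and> norm (D' t - t ^ q *\<^sub>R G t) \<le> c * \<bar>t\<bar> ^ Suc q \<and> norm (D t - D 0) \<le> c' * \<bar>t\<bar> ^ Suc (Suc q)"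
    using D' D by eventually_elim auto
  then obtain d where d: "d > 0" and near: "\<And>t. t \<noteq> 0 \<Longrightarrow> \<bar>t\<bar> < d \<Longrightarrow> c * \<bar>t\<bar> < \<epsilon> \<and> c' * \<bar>t\<bar> < \<epsilon>
     \<and> norm (G t - G 0) < \<epsilon> \<and> norm (D' t - t ^ q *\<^sub>R G t) \<le> c * \<bar>t\<bar> ^ Suc q
     \<and> norm (D t - D 0) \<le> c' * \<bar>t\<bar> ^ Suc (Suc q)"
    by (auto simp: eventually_at dist_norm)
  \<comment> \<open>A single positive time inside the neighbourhood suffices for the
    contradiction.\<close>
  define t where "t = d / 2"
  have t: "t > 0" "t < d" using d by (auto simp: t_def)
  define E where "E s = D s - (s ^ Suc q / Suc q) *\<^sub>R G 0" for s
  have E': "(E has_vector_derivative D' s - s ^ q *\<^sub>R G 0) (at s)" for s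
  proof -
    have "((\<lambda>s::real. s ^ Suc q / Suc q) has_real_derivative s ^ q) (at s)"
      using DERIV_cdivide[OF DERIV_pow[of "Suc q" s], of "real (Suc q)"]
      by (simp del: of_nat_Suc power_Suc)
    then have "((\<lambda>s. (s ^ Suc q / Suc q) *\<^sub>R G 0) has_vector_derivative s ^ q *\<^sub>R G 0) (at s)"
      unfolding has_real_derivative_iff_has_vector_derivative
      by (rule bounded_linear.has_vector_derivative[OF bounded_linear_scaleR_left])
    then show ?thesis
      unfolding E_def[abs_def] by (intro has_vector_derivative_diff der)
  qed
  have "norm (D' s - s ^ q *\<^sub>R G 0) \<le> 2 * \<epsilon> * t ^ q" if s: "\<bar>s\<bar> \<le> \<bar>t\<bar>" for s
  proof (cases "s = 0")
    \<comment> \<open>The filter \<open>at 0\<close> omits the point 0, which the mean value bound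
      visits; this is what \<open>D'0\<close> is for.\<close>
    case True
    then show ?thesis using D'0 \<epsilon> t by simp
  next
    case False
    have "D' s - s ^ q *\<^sub>R G 0 = (D' s - s ^ q *\<^sub>R G s) + s ^ q *\<^sub>R (G s - G 0)"
      by (simp add: algebra_simps)
    then have "norm (D' s - s ^ q *\<^sub>R G 0) \<le> norm (D' s - s ^ q *\<^sub>R G s) + norm (s ^ q *\<^sub>R (G s - G 0))"
      by (simp only: norm_triangle_ineq)
    also have "\<dots> \<le> (c * \<bar>s\<bar>) * \<bar>s\<bar> ^ q + \<bar>s\<bar> ^ q * norm (G s - G 0)"
      using near[of s] False s t by (simp add: power_abs mult_ac)
    also have "\<dots> \<le> \<epsilon> * \<bar>s\<bar> ^ q + \<bar>s\<bar> ^ q * \<epsilon>"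
      using near[of s] False s t by (intro add_mono mult_right_mono mult_left_mono) auto
    also have "\<dots> = 2 * \<epsilon> * \<bar>s\<bar> ^ q" by simp
    also have "\<dots> \<le> 2 * \<epsilon> * t ^ q" using s t \<epsilon> by (intro mult_left_mono power_mono) auto
    finally show ?thesis .
  qed
  from norm_diff_le_of_vector_derivative[OF E' this]
  have "norm (E t - E 0) \<le> 2 * \<epsilon> * t ^ q * \<bar>t\<bar>" .
  then have 1: "norm (E t - E 0) \<le> 2 * \<epsilon> * t ^ Suc q" using t by (simp add: mult_ac)
  have "norm (D t - D 0) \<le> (c' * \<bar>t\<bar>) * t ^ Suc q" using near[of t] t by (simp add: mult_ac)
  also have "\<dots> \<le> \<epsilon> * t ^ Suc q" using near[of t] t by (intro mult_right_mono) auto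
  finally have 2: "norm (D t - D 0) \<le> \<epsilon> * t ^ Suc q" .
  have "(t ^ Suc q / Suc q) *\<^sub>R G 0 = (D t - D 0) - (E t - E 0)"
    by (simp add: E_def)
  then have "norm ((t ^ Suc q / Suc q) *\<^sub>R G 0) \<le> \<epsilon> * t ^ Suc q + 2 * \<epsilon> * t ^ Suc q"
    using norm_triangle_ineq4[of "D t - D 0" "E t - E 0"] 1 2 by simp
  moreover have "norm ((t ^ Suc q / Suc q) *\<^sub>R G 0) = 4 * \<epsilon> * t ^ Suc q"
    using t by (simp add: \<epsilon>_def field_simps)
  moreover have "t ^ Suc q * \<epsilon> > 0" using t \<epsilon> by simp
  ultimately show False by (simp add: mult_ac)
qed

text \<open>\<open>C\<close> expands \<open>F - H\<close>, so \<open>C 0\<close> vanishes like the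
  others. Once all coefficients below \<open>q\<close> are zero, the derivative of e^(-tH) S is t^q
  G(t) up to higher order, with \<open>G 0 = C q\<close>, whereas the function itself differs from 1
  only at order \<open>p + 1\<close>, which exceeds \<open>q + 1\<close>.\<close>

lemma coeffs_zero_of_order:
  fixes S F :: "real \<Rightarrow> 'a::{real_normed_algebra_1,banach}"
  assumes H: "contraction_group H"
    and S': "\<And>t. (S has_vector_derivative F t * S t) (at t)" and S0: "S 0 = 1"
    and F: "\<And>t. norm (F t - H - (\<Sum>q<p. t ^ q *\<^sub>R C q)) \<le> \<bar>t\<bar> ^ p * b"
    and ord: "\<forall>\<^sub>F t in at 0. norm (S t - exp (t *\<^sub>R H)) \<le> c * \<bar>t\<bar> ^ (p + 1)"
  shows "q < p \<Longrightarrow> C q = 0"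
proof (induction q rule: less_induct)
  case (less q)
  define D where "D t = exp (- (t *\<^sub>R H)) * S t" for t
  define D' where "D' t = exp (- (t *\<^sub>R H)) * (F t - H) * S t" for t
  define G where "G t = exp (- (t *\<^sub>R H)) * C q * S t" for t
  have contS: "isCont S t" for t
    using has_vector_derivative_continuous[OF S'[of t]] by simp
  have contE: "isCont (\<lambda>t. exp (- (t *\<^sub>R H))) t" for t
    by (rule has_vector_derivative_continuous[OF exp_neg_scaleR_has_vector_derivative(1), simplified])
  have D_der: "(D has_vector_derivative D' t) (at t)" for t
  proof -
    have "(D has_vector_derivative exp (- (t *\<^sub>R H)) * (F t * S t) + - (exp (- (t *\<^sub>R H)) * H) * S t) (at t)"
      unfolding D_def[abs_def]
      by (rule has_vector_derivative_mult exp_neg_scaleR_has_vector_derivative S')+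
    then show ?thesis by (simp add: D'_def algebra_simps)
  qed
  \<comment> \<open>\<open>|t| \<le> 1\<close> lets every higher power be replaced by
    \<open>|t| ^ Suc q\<close>.\<close>
  have tail: "norm (F t - H - t ^ q *\<^sub>R C q) \<le> (b + (\<Sum>i\<in>{Suc q..<p}. norm (C i))) * \<bar>t\<bar> ^ Suc q"
    if t: "\<bar>t\<bar> \<le> 1" for t
  proof -
    have "(\<Sum>i<p. t ^ i *\<^sub>R C i) = t ^ q *\<^sub>R C q + (\<Sum>i\<in>{Suc q..<p}. t ^ i *\<^sub>R C i)"
    proof -
      have "{..<p} = {..<q} \<union> {q..<p}" using less.prems by auto
      then have "(\<Sum>i<p. t ^ i *\<^sub>R C i) = (\<Sum>i<q. t ^ i *\<^sub>R C i) + (\<Sum>i\<in>{q..<p}. t ^ i *\<^sub>R C i)"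
        by (simp add: sum.union_disjoint ivl_disj_int)
      also have "(\<Sum>i<q. t ^ i *\<^sub>R C i) = 0"
        using less.IH less.prems by (intro sum.neutral) auto
      finally show ?thesis using less.prems by (simp add: sum.atLeast_Suc_lessThan)
    qed
    then have eq: "F t - H - t ^ q *\<^sub>R C q = (F t - H - (\<Sum>i<p. t ^ i *\<^sub>R C i)) + (\<Sum>i\<in>{Suc q..<p}. t ^ i *\<^sub>R C i)"
      by simp
    have "norm (F t - H - t ^ q *\<^sub>R C q) \<le> \<bar>t\<bar> ^ p * b + (\<Sum>i\<in>{Suc q..<p}. norm (t ^ i *\<^sub>R C i))"
      unfolding eq by (rule norm_triangle_mono[OF F norm_sum])
    also have "\<dots> \<le> \<bar>t\<bar> ^ Suc q * b + (\<Sum>i\<in>{Suc q..<p}. \<bar>t\<bar> ^ Suc q * norm (C i))"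
    proof (intro add_mono sum_mono mult_right_mono)
      show "\<bar>t\<bar> ^ p \<le> \<bar>t\<bar> ^ Suc q" using t less.prems by (intro power_decreasing) auto
      show "0 \<le> b"
        using order_trans[OF norm_ge_zero F[of 1]] by (simp only: abs_one power_one mult_1)
      show "norm (t ^ i *\<^sub>R C i) \<le> \<bar>t\<bar> ^ Suc q * norm (C i)" if "i \<in> {Suc q..<p}" for i
        unfolding norm_scaleR power_abs using that t
        by (intro mult_right_mono) (auto simp: power_abs intro: power_decreasing simp del: power_Suc)
    qed
    finally show ?thesis by (simp add: algebra_simps sum_distrib_left)
  qed
  have "G 0 = 0"
  proof (rule leading_coeff_zero[where D = D and D' = D' and q = q])
    show "isCont G 0" unfolding G_def[abs_def] by (intro continuous_intros contE contS)
    show "norm (D' 0 - 0 ^ q *\<^sub>R G 0) = 0"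
      using tail[of 0] by (simp add: D'_def G_def S0)
    \<comment> \<open>Continuity and \<open>S 0 = 1\<close> bound \<open>S\<close> by 2 near 0,
      which is where the factor 2 below comes from.\<close>
    have "\<forall>\<^sub>F t in at 0. norm (S t) < 2"
      using order_tendstoD(2)[OF tendsto_norm[OF contS[of 0, unfolded isCont_def]], of 2] S0 by simp
    moreover have "\<forall>\<^sub>F t in at (0::real). \<bar>t\<bar> \<le> 1"
      by (auto simp: eventually_at dist_norm intro!: exI[of _ 1])
    ultimately show "\<forall>\<^sub>F t in at 0. norm (D' t - t ^ q *\<^sub>R G t)
        \<le> ((b + (\<Sum>i\<in>{Suc q..<p}. norm (C i))) * 2) * \<bar>t\<bar> ^ Suc q"
    proof eventually_elim
      case (elim t)
      have "D' t - t ^ q *\<^sub>R G t = exp (- (t *\<^sub>R H)) * (F t - H - t ^ q *\<^sub>R C q) * S t"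
        by (simp add: D'_def G_def algebra_simps)
      also have "norm \<dots> \<le> norm ((F t - H - t ^ q *\<^sub>R C q) * S t)"
        unfolding mult.assoc by (rule norm_mult_le_right contraction_groupD H)+
      also have "\<dots> \<le> ((b + (\<Sum>i\<in>{Suc q..<p}. norm (C i))) * \<bar>t\<bar> ^ Suc q) * 2"
        by (rule order_trans[OF norm_mult_ineq], rule mult_mono)
          (use elim tail[of t] order_trans[OF norm_ge_zero tail[of t]] in auto)
      finally show ?case by (simp only: mult_ac)
    qed
    show "\<forall>\<^sub>F t in at 0. norm (D t - D 0) \<le> \<bar>c\<bar> * \<bar>t\<bar> ^ Suc (Suc q)"
      using ord \<open>\<forall>\<^sub>F t in at (0::real). \<bar>t\<bar> \<le> 1\<close>
    proof eventually_elim
      case (elim t)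
      have "D t - D 0 = exp (- (t *\<^sub>R H)) * (S t - exp (t *\<^sub>R H))"
        using exp_minus_inverse[of "- (t *\<^sub>R H)"] by (simp add: D_def S0 algebra_simps)
      also have "norm \<dots> \<le> norm (S t - exp (t *\<^sub>R H))"
        by (rule norm_mult_le_right contraction_groupD H)+
      also have "\<dots> \<le> \<bar>c\<bar> * \<bar>t\<bar> ^ (p + 1)"
        using elim by (meson order_trans mult_right_mono abs_ge_self zero_le_power abs_ge_zero)
      also have "\<dots> \<le> \<bar>c\<bar> * \<bar>t\<bar> ^ Suc (Suc q)"
        using elim less.prems by (intro mult_left_mono power_decreasing) auto
      finally show ?case .
    qed
  qed (fact D_der)
  then show ?case by (simp add: G_def S0)
qed

text \<open>e^(-tH) S(t) starts at 1, and its derivative is bounded by the norm of F - H because the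
  exponential and the product are contractions. With the low coefficients gone, F - H is pure
  remainder, and the mean value bound adds the last power of \<open>t\<close>.\<close>

theorem trotter_error:
  fixes As :: "'a::{real_normed_algebra_1,banach} list"
  assumes As: "\<forall>A\<in>set As. contraction_group A" and H: "contraction_group H"
    and "K \<ge> 0"
    and comm: "\<And>n X. n < p \<Longrightarrow> P n X \<Longrightarrow> (\<Sum>A\<leftarrow>As. norm (commutator A X)) \<le> K * norm X"
    and step: "\<And>n X A. n < p \<Longrightarrow> P n X \<Longrightarrow> A \<in> set As \<Longrightarrow> P (Suc n) (commutator A X)"
    and base: "\<And>A. A \<in> set As \<Longrightarrow> P 0 A"
    and p: "p \<ge> 1"
    and ord: "(\<lambda>t. norm (prod_exps As t - exp (t *\<^sub>R H))) \<in> O[at 0](\<lambda>t. t ^ (p + 1))"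
  shows "norm (prod_exps As t - exp (t *\<^sub>R H)) \<le> K ^ p * (\<Sum>A\<leftarrow>As. norm A) * \<bar>t\<bar> ^ (p + 1)"
proof -
  define b where "b = K ^ p * (\<Sum>A\<leftarrow>As. norm A)"
  \<comment> \<open>For \<open>p \<ge> 1\<close> the constant \<open>- H\<close> is a polynomial
    with remainder 0, so subtracting it leaves \<open>b\<close> unchanged.\<close>
  have "poly_approx p (\<lambda>t. generator t As + - H) (b + 0)"
    unfolding b_def
    by (intro poly_approx_add poly_approx_generator[where P = P] poly_approx_const) (use assms in auto)
  then obtain C where C: "\<And>t. norm (generator t As - H - (\<Sum>q<p. t ^ q *\<^sub>R C q)) \<le> \<bar>t\<bar> ^ p * b"
    unfolding poly_approx_def by auto
  have S0: "prod_exps As 0 = 1"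
    by (induction As) (auto simp: prod_exps_def)
  obtain c where c: "\<forall>\<^sub>F t in at 0. norm (prod_exps As t - exp (t *\<^sub>R H)) \<le> c * \<bar>t\<bar> ^ (p + 1)"
    using landau_o.bigE[OF ord] by (auto simp: power_abs abs_mult)
  have "C q = 0" if "q < p" for q
    by (rule coeffs_zero_of_order[OF H prod_exps_has_vector_derivative S0 C c that])
  then have F: "norm (generator s As - H) \<le> \<bar>s\<bar> ^ p * b" for s
    using C[of s] by simp
  have contr: "norm (prod_exps As s) \<le> 1" for s
    using As
  proof (induction As)
    case (Cons A As)
    then show ?case
      using norm_mult_le_right(1)[OF contraction_groupD(1)[of A s], of "prod_exps As s"]
      by (simp add: prod_exps_def)
  qed (simp add: prod_exps_def)
  define D where "D s = exp (- (s *\<^sub>R H)) * prod_exps As s" for s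
  define D' where "D' s = exp (- (s *\<^sub>R H)) * ((generator s As - H) * prod_exps As s)" for s
  have "(D has_vector_derivative D' s) (at s)" for s
  proof -
    have "(D has_vector_derivative exp (- (s *\<^sub>R H)) * (generator s As * prod_exps As s)
        + - (exp (- (s *\<^sub>R H)) * H) * prod_exps As s) (at s)"
      unfolding D_def[abs_def]
      by (rule has_vector_derivative_mult exp_neg_scaleR_has_vector_derivative prod_exps_has_vector_derivative)+
    then show ?thesis by (simp add: D'_def algebra_simps)
  qed
  moreover have "norm (D' s) \<le> \<bar>t\<bar> ^ p * b" if "\<bar>s\<bar> \<le> \<bar>t\<bar>" for s
  proof -
    have "b \<ge> 0" using \<open>K \<ge> 0\<close> by (auto simp: b_def intro!: mult_nonneg_nonneg sum_list_nonneg)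
    have "norm (D' s) \<le> norm (generator s As - H)"
      unfolding D'_def by (meson order_trans norm_mult_le_right contraction_groupD(2)[OF H] contr)
    also have "\<dots> \<le> \<bar>t\<bar> ^ p * b"
      using that \<open>b \<ge> 0\<close> by (intro order_trans[OF F] mult_right_mono power_mono) auto
    finally show ?thesis .
  qed
  ultimately have "norm (D t - D 0) \<le> \<bar>t\<bar> ^ p * b * \<bar>t\<bar>"
    by (rule norm_diff_le_of_vector_derivative)
  moreover have "prod_exps As t - exp (t *\<^sub>R H) = exp (t *\<^sub>R H) * (D t - D 0)"
    using exp_minus_inverse[of "t *\<^sub>R H"]
    by (simp add: D_def S0 right_diff_distrib mult.assoc[symmetric])
  ultimately show ?thesis
    using norm_mult_le_right(1)[OF contraction_groupD(1)[OF H, of t], of "D t - D 0"]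
    by (simp add: b_def mult_ac)
qed

section \<open>Bounded operators on square-summable families\<close>

typedef 'i ell2 = "{f :: 'i \<Rightarrow> complex. (\<lambda>x. (cmod (f x))\<^sup>2) summable_on UNIV}"
  morphisms coord Abs_ell2
  by (rule exI[of _ "\<lambda>_. 0"]) auto

setup_lifting type_definition_ell2

lemma Re_mult_cnj_self: "Re (z * cnj z) = (cmod z)\<^sup>2"
  unfolding cmod_power2 by (simp add: power2_eq_square)

lemma square_summable_mult:
  assumes "(\<lambda>x. (cmod (f x))\<^sup>2) summable_on UNIV" "(\<lambda>x. (cmod (g x))\<^sup>2) summable_on UNIV"
  shows "(\<lambda>x. Re (f x * cnj (g x))) summable_on UNIV"
proof (rule summable_on_iff_abs_summable_on_real[THEN iffD2],
    rule Infinite_Sum.abs_summable_on_comparison_test)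
  show "(\<lambda>x. norm ((cmod (f x))\<^sup>2 + (cmod (g x))\<^sup>2)) summable_on UNIV"
    using assms by (simp add: summable_on_add)
  fix x
  have "\<bar>Re (f x * cnj (g x))\<bar> \<le> cmod (f x) * cmod (g x)"
    using abs_Re_le_cmod[of "f x * cnj (g x)"] by (simp add: norm_mult)
  also have "\<dots> \<le> (cmod (f x))\<^sup>2 + (cmod (g x))\<^sup>2"
    using sum_squares_bound[of "cmod (f x)" "cmod (g x)"]
      mult_nonneg_nonneg[OF norm_ge_zero norm_ge_zero, of "f x" "g x"] by linarith
  finally show "norm (Re (f x * cnj (g x))) \<le> norm ((cmod (f x))\<^sup>2 + (cmod (g x))\<^sup>2)"
    by simp
qed

lemma square_summable_add:
  assumes "(\<lambda>x. (cmod (f x))\<^sup>2) summable_on UNIV" "(\<lambda>x. (cmod (g x))\<^sup>2) summable_on UNIV"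
  shows "(\<lambda>x. (cmod (f x + g x))\<^sup>2) summable_on UNIV"
proof -
  have "(cmod (f x + g x))\<^sup>2 = (cmod (f x))\<^sup>2 + (cmod (g x))\<^sup>2 + 2 * Re (f x * cnj (g x))" for x
    unfolding cmod_power2 by (simp add: power2_eq_square algebra_simps)
  then show ?thesis
    using summable_on_add[OF summable_on_add[OF assms]
        summable_on_cmult_right[OF square_summable_mult[OF assms], of 2]] by simp
qed

lemma square_summable_scaleR:
  assumes "(\<lambda>x. (cmod (f x))\<^sup>2) summable_on UNIV"
  shows "(\<lambda>x. (cmod (c *\<^sub>R f x))\<^sup>2) summable_on UNIV"
  using assms by (simp add: power_mult_distrib summable_on_cmult_right)

instantiation ell2 :: (type) real_inner
begin

lift_definition zero_ell2 :: "'a ell2" is "\<lambda>_. 0" by simp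

lift_definition plus_ell2 :: "'a ell2 \<Rightarrow> 'a ell2 \<Rightarrow> 'a ell2" is "\<lambda>f g x. f x + g x"
  by (rule square_summable_add)

lift_definition uminus_ell2 :: "'a ell2 \<Rightarrow> 'a ell2" is "\<lambda>f x. - f x" by simp

lift_definition minus_ell2 :: "'a ell2 \<Rightarrow> 'a ell2 \<Rightarrow> 'a ell2" is "\<lambda>f g x. f x - g x"
proof -
  fix f g :: "'a \<Rightarrow> complex"
  assume "(\<lambda>x. (cmod (f x))\<^sup>2) summable_on UNIV" "(\<lambda>x. (cmod (g x))\<^sup>2) summable_on UNIV"
  then show "(\<lambda>x. (cmod (f x - g x))\<^sup>2) summable_on UNIV"
    using square_summable_add[of f "\<lambda>x. - g x"] by simp
qed

lift_definition scaleR_ell2 :: "real \<Rightarrow> 'a ell2 \<Rightarrow> 'a ell2" is "\<lambda>c f x. c *\<^sub>R f x"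
  by (rule square_summable_scaleR)

text \<open>The real part of the Hermitian inner product. It induces the usual norm and makes
  multiplication by \<open>i\<close> a skew map.\<close>

lift_definition inner_ell2 :: "'a ell2 \<Rightarrow> 'a ell2 \<Rightarrow> real"
  is "\<lambda>f g. \<Sum>\<^sub>\<infinity>x. Re (f x * cnj (g x))" .

definition "norm_ell2 (v :: 'a ell2) = sqrt (inner v v)"
definition "dist_ell2 (v :: 'a ell2) w = norm (v - w)"
definition "sgn_ell2 (v :: 'a ell2) = scaleR (inverse (norm v)) v"
definition [code del]:
  "(uniformity :: ('a ell2 \<times> 'a ell2) filter) = (INF e\<in>{0 <..}. principal {(x, y). dist x y < e})"
definition [code del]:
  "open_ell2 (S :: 'a ell2 set) = (\<forall>x\<in>S. \<forall>\<^sub>F (x', y) in uniformity. x' = x \<longrightarrow> y \<in> S)"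

instance
proof
  fix u v w :: "'a ell2" and a b :: real
  show "dist v w = norm (v - w)" "sgn v = scaleR (inverse (norm v)) v" "norm v = sqrt (inner v v)"
    "uniformity = (INF e\<in>{0 <..}. principal {(x :: 'a ell2, y). dist x y < e})"
    by (simp_all add: dist_ell2_def sgn_ell2_def norm_ell2_def uniformity_ell2_def)
  show "open S = (\<forall>x\<in>S. \<forall>\<^sub>F (x', y) in uniformity. x' = x \<longrightarrow> y \<in> S)" for S :: "'a ell2 set"
    by (simp add: open_ell2_def)
  show "u + v + w = u + (v + w)" "u + v = v + u" "0 + u = u" "- u + u = 0" "u - v = u + - v"
    "a *\<^sub>R (u + v) = a *\<^sub>R u + a *\<^sub>R v" "(a + b) *\<^sub>R u = a *\<^sub>R u + b *\<^sub>R u"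
    "a *\<^sub>R b *\<^sub>R u = (a * b) *\<^sub>R u" "1 *\<^sub>R u = u"
    by (transfer; simp add: algebra_simps fun_eq_iff scaleR_conv_of_real)+
  show "inner u v = inner v u"
    by transfer (simp add: mult.commute)
  show "inner (u + v) w = inner u w + inner v w"
    by transfer (simp add: distrib_right infsum_add[symmetric] square_summable_mult[simplified])
  show "inner (a *\<^sub>R u) v = a * inner u v"
    by transfer (simp add: infsum_cmult_right'[symmetric] algebra_simps)
  show "0 \<le> inner u u"
    by transfer (auto intro!: infsum_nonneg)
  show "inner u u = 0 \<longleftrightarrow> u = 0"
  proof transfer
    fix f :: "'a \<Rightarrow> complex" assume f: "(\<lambda>x. (cmod (f x))\<^sup>2) summable_on UNIV"
    have eq: "(\<Sum>\<^sub>\<infinity>x. Re (f x * cnj (f x))) = (\<Sum>\<^sub>\<infinity>x. (cmod (f x))\<^sup>2)"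
      by (simp only: Re_mult_cnj_self)
    show "(\<Sum>\<^sub>\<infinity>x. Re (f x * cnj (f x))) = 0 \<longleftrightarrow> f = (\<lambda>_. 0)"
    proof
      assume "(\<Sum>\<^sub>\<infinity>x. Re (f x * cnj (f x))) = 0"
      then have "(cmod (f x))\<^sup>2 = 0" for x
        unfolding eq by (intro nonneg_infsum_le_0D[OF _ f]) simp_all
      then show "f = (\<lambda>_. 0)" by auto
    qed simp
  qed
qed

end

lemma norm_ell2_power2: "(norm (v :: 'i ell2))\<^sup>2 = (\<Sum>\<^sub>\<infinity>x. (cmod (coord v x))\<^sup>2)"
  unfolding power2_norm_eq_inner[of v] inner_ell2.rep_eq by (simp only: Re_mult_cnj_self)

lemma coord_simps [simp]:
  "coord 0 x = 0" "coord (v + w) x = coord v x + coord w x" "coord (- v) x = - coord v x"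
  "coord (v - w) x = coord v x - coord w x" "coord (c *\<^sub>R v) x = c *\<^sub>R coord v x"
  by (transfer, simp)+

lemma coord_square_summable: "(\<lambda>x. (cmod (coord v x))\<^sup>2) summable_on UNIV"
  by transfer

lemma coord_inverse: "(\<lambda>x. (cmod (f x))\<^sup>2) summable_on UNIV \<Longrightarrow> coord (Abs_ell2 f) = f"
  by (simp add: Abs_ell2_inverse)

lemma norm_coord_le: "cmod (coord v x) \<le> norm v"
proof -
  have "(cmod (coord v x))\<^sup>2 \<le> (norm v)\<^sup>2"
    using finite_sum_le_infsum[OF coord_square_summable[of v], of "{x}"]
    by (simp add: norm_ell2_power2)
  then show ?thesis by (simp add: power2_le_iff_abs_le)
qed

lemma norm_ell2_le:
  assumes "\<And>F. finite F \<Longrightarrow> (\<Sum>x\<in>F. (cmod (coord v x))\<^sup>2) \<le> b\<^sup>2" "b \<ge> 0"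
  shows "norm v \<le> b"
proof -
  have "(norm v)\<^sup>2 \<le> b\<^sup>2"
    unfolding norm_ell2_power2 using assms by (intro infsum_le_finite_sums coord_square_summable) auto
  then show ?thesis using assms(2) by (simp add: power2_le_iff_abs_le)
qed

lemma sum_coord_le: "finite F \<Longrightarrow> (\<Sum>x\<in>F. (cmod (coord v x))\<^sup>2) \<le> (norm v)\<^sup>2"
  unfolding norm_ell2_power2 by (rule finite_sum_le_infsum[OF coord_square_summable]) auto

instance ell2 :: (type) banach
proof
  fix X :: "nat \<Rightarrow> 'a ell2" assume X: "Cauchy X"
  have "Cauchy (\<lambda>n. coord (X n) x)" for x
  proof (rule CauchyI)
    fix e :: real assume "e > 0"
    then obtain M where "\<forall>m\<ge>M. \<forall>n\<ge>M. norm (X m - X n) < e"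
      using X by (meson CauchyD)
    then show "\<exists>M. \<forall>m\<ge>M. \<forall>n\<ge>M. norm (coord (X m) x - coord (X n) x) < e"
      using norm_coord_le[of "X _ - X _" x] by (metis coord_simps(4) order.strict_trans1)
  qed
  then have "\<exists>l. (\<lambda>n. coord (X n) x) \<longlonglongrightarrow> l" for x
    by (meson Cauchy_convergent convergent_def)
  then obtain l where l: "\<And>x. (\<lambda>n. coord (X n) x) \<longlonglongrightarrow> l x" by metis
  \<comment> \<open>Finite partial sums pass to the pointwise limit. The same estimate serves twice:
    it makes \<open>l\<close> square-summable and it gives convergence in norm.\<close>
  have bound: "(\<Sum>x\<in>F. (cmod (coord (X n) x - l x))\<^sup>2) \<le> e\<^sup>2"
    if "\<forall>m\<ge>M. \<forall>n\<ge>M. norm (X m - X n) < e" "n \<ge> M" "finite F" for e M n F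
  proof (rule tendsto_upperbound)
    show "(\<lambda>m. \<Sum>x\<in>F. (cmod (coord (X n) x - coord (X m) x))\<^sup>2)
       \<longlonglongrightarrow> (\<Sum>x\<in>F. (cmod (coord (X n) x - l x))\<^sup>2)"
      by (intro tendsto_intros l)
    show "\<forall>\<^sub>F m in sequentially. (\<Sum>x\<in>F. (cmod (coord (X n) x - coord (X m) x))\<^sup>2) \<le> e\<^sup>2"
      using eventually_ge_at_top[of M]
    proof eventually_elim
      case (elim m)
      have "(\<Sum>x\<in>F. (cmod (coord (X n) x - coord (X m) x))\<^sup>2) \<le> (norm (X n - X m))\<^sup>2"
        using sum_coord_le[OF \<open>finite F\<close>, of "X n - X m"] by simp
      also have "\<dots> \<le> e\<^sup>2"
        using that elim by (intro power_mono) (auto intro: less_imp_le)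
      finally show ?case .
    qed
  qed simp
  obtain M where M: "\<forall>m\<ge>M. \<forall>n\<ge>M. norm (X m - X n) < 1"
    using X by (meson CauchyD zero_less_one)
  have "(\<lambda>x. (cmod (coord (X M) x - l x))\<^sup>2) summable_on UNIV"
    by (rule nonneg_bdd_above_summable_on) (use bound[OF M order_refl] in \<open>auto intro!: bdd_aboveI2\<close>)
  \<comment> \<open>\<open>l\<close> is written as \<open>X M - (X M - l)\<close>, whose second part
    has just been shown square-summable.\<close>
  then have "(\<lambda>x. (cmod (coord (X M) x + - (coord (X M) x - l x)))\<^sup>2) summable_on UNIV"
    by (intro square_summable_add coord_square_summable) (simp add: norm_minus_commute)
  then have L: "coord (Abs_ell2 l) = l"
    by (intro coord_inverse) simp
  have "X \<longlonglongrightarrow> Abs_ell2 l"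
  proof (rule LIMSEQ_I)
    fix e :: real assume e: "e > 0"
    then obtain M where M: "\<forall>m\<ge>M. \<forall>n\<ge>M. norm (X m - X n) < e / 2"
      using X by (meson CauchyD half_gt_zero)
    have "norm (X n - Abs_ell2 l) < e" if "n \<ge> M" for n
    proof -
      have "norm (X n - Abs_ell2 l) \<le> e / 2"
        using bound[OF M that] e by (intro norm_ell2_le) (auto simp: L)
      then show ?thesis using e by simp
    qed
    then show "\<exists>M. \<forall>n\<ge>M. norm (X n - Abs_ell2 l) < e" by blast
  qed
  then show "convergent X" by (auto simp: convergent_def)
qed

lift_definition basis_ell2 :: "'i \<Rightarrow> 'i ell2" is "\<lambda>x y. if y = x then 1 else 0"
proof -
  fix x :: 'i
  have "(\<lambda>y. (cmod (if y = x then 1 else 0))\<^sup>2) summable_on {x}" by simp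
  then show "(\<lambda>y. (cmod (if y = x then 1 else 0))\<^sup>2) summable_on UNIV"
    by (rule summable_on_cong_neutral[THEN iffD1, rotated -1]) auto
qed

lemma basis_ell2_nonzero: "basis_ell2 x \<noteq> 0"
  by (metis basis_ell2.rep_eq coord_simps(1) zero_neq_one)

lemma eq_ell2_iff: "v = w \<longleftrightarrow> (\<forall>x. coord v x = coord w x)"
  by (metis coord_inject ext)

section \<open>The Banach algebra of bounded operators\<close>

text \<open>A copy of the bounded endomorphisms as a type of its own, so that composition can be the
  ring multiplication.\<close>

typedef 'i bop = "UNIV :: ('i ell2 \<Rightarrow>\<^sub>L 'i ell2) set"
  morphisms blinfun_of Abs_bop ..

setup_lifting type_definition_bop

instantiation bop :: (type) real_normed_algebra_1
begin

lift_definition zero_bop :: "'a bop" is 0 .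
lift_definition one_bop :: "'a bop" is id_blinfun .
lift_definition plus_bop :: "'a bop \<Rightarrow> 'a bop \<Rightarrow> 'a bop" is "(+)" .
lift_definition minus_bop :: "'a bop \<Rightarrow> 'a bop \<Rightarrow> 'a bop" is "(-)" .
lift_definition uminus_bop :: "'a bop \<Rightarrow> 'a bop" is uminus .
lift_definition times_bop :: "'a bop \<Rightarrow> 'a bop \<Rightarrow> 'a bop" is "(o\<^sub>L)" .
lift_definition scaleR_bop :: "real \<Rightarrow> 'a bop \<Rightarrow> 'a bop" is "(*\<^sub>R)" .
lift_definition norm_bop :: "'a bop \<Rightarrow> real" is norm .
definition "dist_bop (v :: 'a bop) w = norm (v - w)"
definition "sgn_bop (v :: 'a bop) = scaleR (inverse (norm v)) v"
definition [code del]: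
  "(uniformity :: ('a bop \<times> 'a bop) filter) = (INF e\<in>{0 <..}. principal {(x, y). dist x y < e})"
definition [code del]:
  "open_bop (S :: 'a bop set) = (\<forall>x\<in>S. \<forall>\<^sub>F (x', y) in uniformity. x' = x \<longrightarrow> y \<in> S)"

instance
proof
  fix u v w :: "'a bop" and a b :: real
  show "dist v w = norm (v - w)" "sgn v = scaleR (inverse (norm v)) v"
    "uniformity = (INF e\<in>{0 <..}. principal {(x :: 'a bop, y). dist x y < e})"
    by (simp_all add: dist_bop_def sgn_bop_def uniformity_bop_def)
  show "open S = (\<forall>x\<in>S. \<forall>\<^sub>F (x', y) in uniformity. x' = x \<longrightarrow> y \<in> S)" for S :: "'a bop set"
    by (simp add: open_bop_def)
  show "u + v + w = u + (v + w)" "u + v = v + u" "0 + u = u" "- u + u = 0" "u - v = u + - v"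
    "a *\<^sub>R (u + v) = a *\<^sub>R u + a *\<^sub>R v" "(a + b) *\<^sub>R u = a *\<^sub>R u + b *\<^sub>R u"
    "a *\<^sub>R b *\<^sub>R u = (a * b) *\<^sub>R u" "1 *\<^sub>R u = u"
    by (transfer; simp add: algebra_simps)+
  show "u * v * w = u * (v * w)" "1 * u = u" "u * 1 = u" "(u + v) * w = u * w + v * w"
    "u * (v + w) = u * v + u * w" "a *\<^sub>R u * v = a *\<^sub>R (u * v)" "u * a *\<^sub>R v = a *\<^sub>R (u * v)"
    by (transfer; rule blinfun_eqI; simp add: blinfun.bilinear_simps)+
  show "norm (u + v) \<le> norm u + norm v"
    by transfer (rule norm_triangle_ineq)
  show "norm (a *\<^sub>R u) = \<bar>a\<bar> * norm u" by transfer simp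
  show "norm u = 0 \<longleftrightarrow> u = 0" by transfer simp
  show "norm (u * v) \<le> norm u * norm v"
    by transfer (rule norm_blinfun_compose)
  show "(0 :: 'a bop) \<noteq> 1"
  proof transfer
    \<comment> \<open>Every type has the element \<open>undefined\<close>, so the space has a
      nonzero vector and the algebra is nontrivial.\<close>
    have "blinfun_apply id_blinfun (basis_ell2 undefined :: 'a ell2) \<noteq> blinfun_apply 0 (basis_ell2 undefined)"
      by (simp add: basis_ell2_nonzero)
    then show "(0 :: 'a ell2 \<Rightarrow>\<^sub>L 'a ell2) \<noteq> id_blinfun" by metis
  qed
  show "norm (1 :: 'a bop) = 1"
  proof transfer
    have "onorm (\<lambda>v :: 'a ell2. v) = 1"
    proof (rule antisym)
      show "onorm (\<lambda>v :: 'a ell2. v) \<le> 1" by (rule onorm_id_le)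
      show "1 \<le> onorm (\<lambda>v :: 'a ell2. v)"
        using onorm[OF bounded_linear_ident, of "basis_ell2 undefined :: 'a ell2"]
          basis_ell2_nonzero[of "undefined :: 'a"] by simp
    qed
    then show "norm (id_blinfun :: 'a ell2 \<Rightarrow>\<^sub>L 'a ell2) = 1"
      by (simp add: norm_blinfun.rep_eq id_blinfun.rep_eq)
  qed
qed

end

instance bop :: (type) banach
proof
  fix X :: "nat \<Rightarrow> 'a bop" assume "Cauchy X"
  have dist: "dist u v = dist (blinfun_of u) (blinfun_of v)" for u v :: "'a bop"
    by (simp add: dist_norm norm_bop.rep_eq minus_bop.rep_eq)
  have "Cauchy (\<lambda>n. blinfun_of (X n))"
    using \<open>Cauchy X\<close> by (simp add: Cauchy_def dist)
  then obtain L where "(\<lambda>n. blinfun_of (X n)) \<longlonglongrightarrow> L"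
    by (meson Cauchy_convergent convergent_def)
  then have "X \<longlonglongrightarrow> Abs_bop L"
    by (simp add: tendsto_iff dist Abs_bop_inverse)
  then show "convergent X" by (auto simp: convergent_def)
qed

definition bapply :: "'i bop \<Rightarrow> 'i ell2 \<Rightarrow> 'i ell2" where
  "bapply T = blinfun_apply (blinfun_of T)"

lemmas bapply_rep_eqs = bapply_def plus_bop.rep_eq scaleR_bop.rep_eq norm_bop.rep_eq
  times_bop.rep_eq one_bop.rep_eq

lemma bounded_bilinear_bapply: "bounded_bilinear bapply"
proof
  fix T U :: "'i bop" and v w :: "'i ell2" and c :: real
  show "bapply (T + U) v = bapply T v + bapply U v" "bapply T (v + w) = bapply T v + bapply T w"
    "bapply (c *\<^sub>R T) v = c *\<^sub>R bapply T v" "bapply T (c *\<^sub>R v) = c *\<^sub>R bapply T v"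
    by (simp_all add: bapply_rep_eqs blinfun.bilinear_simps)
  have "norm (bapply T v) \<le> norm T * norm v" for T :: "'i bop" and v
    by (simp add: bapply_rep_eqs norm_blinfun)
  then show "\<exists>K. \<forall>T v. norm (bapply T v :: 'i ell2) \<le> norm T * norm v * K"
    by (intro exI[of _ 1]) simp
qed

interpretation bapply: bounded_bilinear bapply
  by (rule bounded_bilinear_bapply)

lemma norm_bapply: "norm (bapply T v) \<le> norm T * norm v"
  by (simp add: bapply_rep_eqs norm_blinfun)

lemma norm_bop_bound: "b \<ge> 0 \<Longrightarrow> (\<And>v. norm (bapply T v) \<le> b * norm v) \<Longrightarrow> norm T \<le> b"
  unfolding bapply_rep_eqs by (rule norm_blinfun_bound)

lemma bop_eqI: "(\<And>v. bapply T v = bapply U v) \<Longrightarrow> T = U"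
  by (metis bapply_def blinfun_eqI blinfun_of_inject)

lemma bapply_mult [simp]: "bapply (T * U) v = bapply T (bapply U v)"
  by (simp add: bapply_rep_eqs)

lemma bapply_one [simp]: "bapply 1 v = v"
  by (simp add: bapply_rep_eqs)

text \<open>Along f(t) = e^(tT) v the derivative of \<open>inner f f\<close> is twice
  \<open>inner f (T f)\<close>, which is 0, so the norm of \<open>v\<close> is preserved.\<close>

lemma contraction_group_of_skew:
  assumes skew: "\<And>v. inner v (bapply T v) = 0"
  shows "contraction_group T"
  unfolding contraction_group_def
proof
  fix t
  show "norm (exp (t *\<^sub>R T)) \<le> 1"
  proof (rule norm_bop_bound)
    fix v
    define f where "f t = bapply (exp (t *\<^sub>R T)) v" for t
    have f: "(f has_vector_derivative bapply T (f t)) (at t)" for t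
      using bounded_linear.has_vector_derivative[OF bapply.bounded_linear_left[of v]
          exp_scaleR_has_vector_derivative_left[of T t]]
      by (simp add: f_def[abs_def])
    have "((\<lambda>t. inner (f t) (f t)) has_vector_derivative
        inner (f t) (bapply T (f t)) + inner (bapply T (f t)) (f t)) (at t)" for t
      by (rule bounded_bilinear.has_vector_derivative[OF bounded_bilinear_inner f f])
    then have "((\<lambda>t. inner (f t) (f t)) has_vector_derivative 0) (at t)" for t
      by (simp add: skew inner_commute[of "bapply T _"])
    then have "norm (inner (f t) (f t) - inner (f 0) (f 0)) \<le> 0 * \<bar>t\<bar>"
      by (rule norm_diff_le_of_vector_derivative) simp
    then have "norm (f t) = norm (f 0)" by (simp add: norm_eq_sqrt_inner)
    then show "norm (bapply (exp (t *\<^sub>R T)) v) \<le> 1 * norm v"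
      by (simp add: f_def)
  qed simp
qed

section \<open>Matrices as operators\<close>

lemma finite_cfgs: "finite Q \<Longrightarrow> finite (cfgs Q)"
  by (simp add: cfgs_def finite_PiE)

lemma cfgs_nonempty: "cfgs Q \<noteq> {}"
  by (simp add: cfgs_def PiE_eq_empty_iff)

lemma coord_Abs_finite:
  assumes "finite I" "\<And>x. x \<notin> I \<Longrightarrow> f x = 0"
  shows "coord (Abs_ell2 f) = f"
proof (rule coord_inverse)
  have "(\<lambda>x. (cmod (f x))\<^sup>2) summable_on I" using assms(1) by simp
  then show "(\<lambda>x. (cmod (f x))\<^sup>2) summable_on UNIV"
    by (rule summable_on_cong_neutral[THEN iffD1, rotated -1]) (auto simp: assms(2))
qed

lemma inner_ell2_finite:
  assumes "finite I" "\<And>x. x \<notin> I \<Longrightarrow> coord w x = 0"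
  shows "inner v w = (\<Sum>x\<in>I. Re (coord v x * cnj (coord w x)))"
proof -
  have "inner v w = (\<Sum>\<^sub>\<infinity>x\<in>I. Re (coord v x * cnj (coord w x)))"
    unfolding inner_ell2.rep_eq by (rule infsum_cong_neutral) (auto simp: assms(2))
  then show ?thesis using assms(1) by simp
qed

lemma norm_ell2_finite:
  assumes "finite I" "\<And>x. x \<notin> I \<Longrightarrow> coord v x = 0"
  shows "norm v = L2_set (\<lambda>x. cmod (coord v x)) I"
proof -
  have "inner v v = (\<Sum>x\<in>I. Re (coord v x * cnj (coord v x)))"
    using assms by (rule inner_ell2_finite)
  then show ?thesis by (simp only: norm_ell2_def L2_set_def Re_mult_cnj_self)
qed

section \<open>Embedding of vectors and matrices\<close>

definition emb_vec :: "qubit set \<Rightarrow> (cfg \<Rightarrow> complex) \<Rightarrow> cfg ell2" where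
  "emb_vec Q f = Abs_ell2 (\<lambda>x. if x \<in> cfgs Q then f x else 0)"

lemma coord_emb_vec: "finite Q \<Longrightarrow> coord (emb_vec Q f) x = (if x \<in> cfgs Q then f x else 0)"
  unfolding emb_vec_def by (subst coord_Abs_finite[OF finite_cfgs]) auto

lemma vnorm_eq: "vnorm Q f = L2_set (\<lambda>x. cmod (f x)) (cfgs Q)"
  by (simp add: vnorm_def L2_set_def)

lemma norm_emb_vec: "finite Q \<Longrightarrow> norm (emb_vec Q f) = vnorm Q f"
  unfolding vnorm_eq
  by (subst norm_ell2_finite[OF finite_cfgs]) (auto simp: coord_emb_vec intro!: L2_set_cong)

lemma vnorm_coord_le: "finite Q \<Longrightarrow> vnorm Q (coord v) \<le> norm v"
  using sum_coord_le[OF finite_cfgs, of Q v] by (simp add: vnorm_def real_le_lsqrt)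

text \<open>The matrix acts on the coordinates in \<open>cfgs Q\<close> and the operator is zero on
  all others, so matrices over different \<open>Q\<close> share one algebra and only the entries
  within \<open>cfgs Q\<close> count.\<close>

definition emb :: "qubit set \<Rightarrow> op \<Rightarrow> cfg bop" where
  "emb Q A = Abs_bop (Blinfun (\<lambda>v. emb_vec Q (mapply Q A (coord v))))"

lemma mapply_linear:
  "mapply Q A (\<lambda>x. f x + g x) x = mapply Q A f x + mapply Q A g x"
  "mapply Q A (\<lambda>x. c * f x) x = c * mapply Q A f x"
  by (simp_all add: mapply_def sum.distrib algebra_simps sum_distrib_left)

lemma bapply_emb:
  assumes Q: "finite Q"
  shows "bapply (emb Q A) v = emb_vec Q (mapply Q A (coord v))"
proof -
  have "bounded_linear (\<lambda>v. emb_vec Q (mapply Q A (coord v)))"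
  proof
    show "emb_vec Q (mapply Q A (coord (v + w)))
        = emb_vec Q (mapply Q A (coord v)) + emb_vec Q (mapply Q A (coord w))" for v w
      by (auto simp: eq_ell2_iff coord_emb_vec Q mapply_linear[symmetric] intro!: arg_cong[of _ _ "\<lambda>f. mapply Q A f _"])
    show "emb_vec Q (mapply Q A (coord (c *\<^sub>R v))) = c *\<^sub>R emb_vec Q (mapply Q A (coord v))" for c v
      by (auto simp: eq_ell2_iff coord_emb_vec Q scaleR_conv_of_real mapply_linear[symmetric] intro!: arg_cong[of _ _ "\<lambda>f. mapply Q A f _"])
    \<comment> \<open>A crude bound by the sum of all entries; only boundedness is at stake
      here.\<close>
    have "norm (emb_vec Q (mapply Q A (coord v))) \<le> norm v * (\<Sum>x\<in>cfgs Q. \<Sum>y\<in>cfgs Q. cmod (A x y))" for v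
    proof -
      have "norm (emb_vec Q (mapply Q A (coord v))) \<le> (\<Sum>x\<in>cfgs Q. cmod (mapply Q A (coord v) x))"
        unfolding norm_emb_vec[OF Q] vnorm_eq by (rule L2_set_le_sum) simp
      also have "\<dots> \<le> (\<Sum>x\<in>cfgs Q. \<Sum>y\<in>cfgs Q. norm v * cmod (A x y))"
        unfolding mapply_def
        by (intro sum_mono order_trans[OF norm_sum]) (simp add: norm_mult mult.commute[of "norm v"] mult_left_mono norm_coord_le)
      finally show ?thesis by (simp add: sum_distrib_left)
    qed
    then show "\<exists>K. \<forall>v. norm (emb_vec Q (mapply Q A (coord v))) \<le> norm v * K" by blast
  qed
  then show ?thesis
    by (simp add: emb_def bapply_def Abs_bop_inverse bounded_linear_Blinfun_apply)
qed

lemma coord_emb: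
  "finite Q \<Longrightarrow> coord (bapply (emb Q A) v) x = (if x \<in> cfgs Q then \<Sum>y\<in>cfgs Q. A x y * coord v y else 0)"
  by (simp add: bapply_emb coord_emb_vec mapply_def)

lemma bop_eq_iff: "T = U \<longleftrightarrow> (\<forall>v x. coord (bapply T v) x = coord (bapply U v) x)"
  by (metis bop_eqI eq_ell2_iff)

lemma emb_cong: "finite Q \<Longrightarrow> (\<And>x y. x \<in> cfgs Q \<Longrightarrow> y \<in> cfgs Q \<Longrightarrow> A x y = B x y) \<Longrightarrow> emb Q A = emb Q B"
  by (auto simp: bop_eq_iff coord_emb intro!: sum.cong)

lemma emb_eq_iff:
  assumes Q: "finite Q"
  shows "emb Q A = emb Q B \<longleftrightarrow> (\<forall>x\<in>cfgs Q. \<forall>y\<in>cfgs Q. A x y = B x y)"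
proof
  assume eq: "emb Q A = emb Q B"
  show "\<forall>x\<in>cfgs Q. \<forall>y\<in>cfgs Q. A x y = B x y"
  proof safe
    fix x y assume xy: "x \<in> cfgs Q" "y \<in> cfgs Q"
    have "coord (bapply (emb Q C) (basis_ell2 y)) x = C x y" for C
      using xy Q finite_cfgs[OF Q] by (simp add: coord_emb basis_ell2.rep_eq if_distrib[of "(*) _"] cong: if_cong)
    then show "A x y = B x y" using eq by metis
  qed
qed (auto intro: emb_cong[OF Q])

lemma emb_mdiff: "finite Q \<Longrightarrow> emb Q (mdiff A B) = emb Q A - emb Q B"
  by (auto simp: bop_eq_iff coord_emb mdiff_def bapply.diff_left sum_subtractf algebra_simps)

lemma emb_scaleR: "finite Q \<Longrightarrow> emb Q (msmult (of_real c) A) = c *\<^sub>R emb Q A"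
  by (auto simp: bop_eq_iff coord_emb msmult_def bapply.scaleR_left scaleR_sum_right)
    (simp add: scaleR_conv_of_real mult.assoc)

lemma emb_zero: "finite Q \<Longrightarrow> emb Q (\<lambda>x y. 0) = 0"
  by (auto simp: bop_eq_iff coord_emb bapply.zero_left)

lemma emb_add: "finite Q \<Longrightarrow> emb Q (\<lambda>x y. A x y + B x y) = emb Q A + emb Q B"
  by (auto simp: bop_eq_iff coord_emb bapply.add_left sum.distrib algebra_simps)

lemma emb_msum_list: "finite Q \<Longrightarrow> emb Q (msum_list As) = (\<Sum>A\<leftarrow>As. emb Q A)"
proof (induction As)
  case Nil
  then show ?case by (simp add: msum_list_def emb_zero)
next
  case (Cons A As)
  then show ?case using emb_add[of Q A "msum_list As"] by (simp add: msum_list_def)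
qed

lemma emb_mmult:
  assumes "finite Q"
  shows "emb Q (mmult Q A B) = emb Q A * emb Q B"
  unfolding bop_eq_iff
proof (intro allI)
  fix v x
  have "(\<Sum>y\<in>cfgs Q. (\<Sum>z\<in>cfgs Q. A x z * B z y) * coord v y) = (\<Sum>z\<in>cfgs Q. A x z * (\<Sum>y\<in>cfgs Q. B z y * coord v y))"
    by (simp add: sum_distrib_left sum_distrib_right mult.assoc, rule sum.swap)
  then show "coord (bapply (emb Q (mmult Q A B)) v) x = coord (bapply (emb Q A * emb Q B) v) x"
    using assms by (simp add: coord_emb mmult_def)
qed

lemma emb_mident_mult:
  assumes "finite Q"
  shows "emb Q mident * emb Q A = emb Q A" "emb Q A * emb Q mident = emb Q A"
  using assms finite_cfgs[OF assms]
  by (auto simp: emb_mmult[symmetric] mmult_def mident_def intro!: emb_cong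
      simp: if_distrib[of "\<lambda>c. c * _"] if_distrib[of "(*) _"] cong: if_cong)

text \<open>The exponential of an embedded matrix is the identity off the span of \<open>cfgs Q\<close>, so it
  is the image of \<open>mexp\<close> only under this unital extension.\<close>

definition unit_emb :: "qubit set \<Rightarrow> op \<Rightarrow> cfg bop" where
  "unit_emb Q A = emb Q A + (1 - emb Q mident)"

lemma unit_emb_mident: "unit_emb Q mident = 1"
  by (simp add: unit_emb_def)

lemma unit_emb_mmult: "finite Q \<Longrightarrow> unit_emb Q (mmult Q A B) = unit_emb Q A * unit_emb Q B"
  by (simp add: unit_emb_def emb_mmult algebra_simps emb_mident_mult)

lemma unit_emb_mpow: "finite Q \<Longrightarrow> unit_emb Q (mpow Q A n) = unit_emb Q A ^ n"
  by (induction n) (simp_all add: unit_emb_mident unit_emb_mmult)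

lemma unit_emb_mprod: "finite Q \<Longrightarrow> unit_emb Q (mprod Q As) = prod_list (map (unit_emb Q) As)"
  by (induction As) (simp_all add: unit_emb_mident unit_emb_mmult)

lemma emb_mdiff_unit: "finite Q \<Longrightarrow> emb Q (mdiff A B) = unit_emb Q A - unit_emb Q B"
  by (simp add: unit_emb_def emb_mdiff)

lemma coord_unit_emb: "finite Q \<Longrightarrow> coord (bapply (unit_emb Q A) v) x =
    (if x \<in> cfgs Q then \<Sum>y\<in>cfgs Q. A x y * coord v y else coord v x)"
  using finite_cfgs[of Q]
  by (simp add: unit_emb_def bapply.add_left bapply.diff_left coord_emb mident_def
      if_distrib[of "\<lambda>c. c * _"] cong: if_cong)

text \<open>The case \<open>n = 0\<close> is separate because the zeroth power is the identity of
  the whole space, while \<open>emb Q mident\<close> is only the projection onto the span of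
  \<open>cfgs Q\<close>.\<close>

lemma emb_power:
  assumes "finite Q"
  shows "coord (bapply (emb Q A ^ n) v) x =
    (if x \<in> cfgs Q then \<Sum>y\<in>cfgs Q. mpow Q A n x y * coord v y else if n = 0 then coord v x else 0)"
proof (cases n)
  case 0
  then show ?thesis
    using finite_cfgs[OF assms] by (simp add: mident_def if_distrib[of "\<lambda>c. c * _"] cong: if_cong)
next
  case (Suc m)
  have "emb Q A ^ Suc m = emb Q (mpow Q A (Suc m))"
    using assms by (induction m) (simp_all add: emb_mmult emb_mident_mult)
  then show ?thesis using assms by (simp add: Suc coord_emb del: mpow.simps)
qed

lemma bounded_linear_coord: "bounded_linear (\<lambda>v. coord v x)"
  by (rule bounded_linear_intro[where K = 1]) (auto simp: norm_coord_le)

lemma exp_emb: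
  assumes Q: "finite Q"
  shows "exp (emb Q A) = unit_emb Q (mexp Q A)"
  unfolding bop_eq_iff
proof (intro allI)
  fix v x
  define T where "T = emb Q A"
  \<comment> \<open>Evaluation at a fixed vector and coordinate is a bounded linear functional of
    the operator, so the exponential series can be read off coordinatewise.\<close>
  have S: "(\<lambda>n. coord (bapply (T ^ n) v) x /\<^sub>R fact n) sums coord (bapply (exp T) v) x" for v x
  proof -
    have "bounded_linear (\<lambda>T. coord (bapply T v) x)"
      by (rule bounded_linear_compose[OF bounded_linear_coord bapply.bounded_linear_left])
    from bounded_linear.sums[OF this exp_converges[of T]] show ?thesis
      by (simp add: bapply.scaleR_left)
  qed
  show "coord (bapply (exp (emb Q A)) v) x = coord (bapply (unit_emb Q (mexp Q A)) v) x"
  proof (cases "x \<in> cfgs Q")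
    case False
    have "(\<lambda>n. coord (bapply (T ^ n) v) x /\<^sub>R fact n) = (\<lambda>n. if n = 0 then coord v x else 0)"
      using False by (auto simp: T_def emb_power[OF Q])
    then have "(\<lambda>n. coord (bapply (T ^ n) v) x /\<^sub>R fact n) sums coord v x"
      using sums_single[of 0 "\<lambda>_. coord v x"] by simp
    then show ?thesis using S[of v x] sums_unique2 False Q by (auto simp: T_def coord_unit_emb)
  next
    case True
    \<comment> \<open>Basis vectors isolate single entries, so convergence of the operator series
      gives convergence of the series that defines \<open>mexp\<close>.\<close>
    have entry: "(\<lambda>n. mpow Q A n x y / of_nat (fact n)) sums mexp Q A x y" if "y \<in> cfgs Q" for y
    proof -
      have "(\<lambda>n. mpow Q A n x y / of_nat (fact n)) = (\<lambda>n. coord (bapply (T ^ n) (basis_ell2 y)) x /\<^sub>R fact n)"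
        using True that finite_cfgs[OF Q]
        by (auto simp: T_def emb_power[OF Q] basis_ell2.rep_eq if_distrib[of "(*) _"] scaleR_conv_of_real field_simps cong: if_cong)
      then have "summable (\<lambda>n. mpow Q A n x y / of_nat (fact n))"
        using S[of "basis_ell2 y" x] by (simp add: sums_iff)
      then show ?thesis unfolding mexp_def by (rule summable_sums)
    qed
    have "(\<lambda>n. \<Sum>y\<in>cfgs Q. mpow Q A n x y / of_nat (fact n) * coord v y) sums (\<Sum>y\<in>cfgs Q. mexp Q A x y * coord v y)"
      by (intro sums_sum sums_mult2 entry)
    moreover have "(\<lambda>n. \<Sum>y\<in>cfgs Q. mpow Q A n x y / of_nat (fact n) * coord v y) = (\<lambda>n. coord (bapply (T ^ n) v) x /\<^sub>R fact n)"
      using True by (auto simp: T_def emb_power[OF Q] scaleR_conv_of_real sum_distrib_left field_simps)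
    ultimately show ?thesis using S[of v x] sums_unique2 True Q by (auto simp: T_def coord_unit_emb)
  qed
qed

text \<open>\<open>ub\<close> makes the set of values bounded, without which the supremum in
  \<open>opnorm\<close> would be meaningless; the converse inequality rescales an arbitrary vector
  to norm 1.\<close>

lemma norm_emb_eq_opnorm:
  assumes Q: "finite Q"
  shows "norm (emb Q A) = opnorm Q A"
proof -
  have ub: "vnorm Q (mapply Q A v) \<le> norm (emb Q A) * vnorm Q v" for v
  proof -
    have "mapply Q A v = mapply Q A (coord (emb_vec Q v))"
      by (auto simp: mapply_def coord_emb_vec[OF Q] intro!: sum.cong)
    then show ?thesis
      using norm_bapply[of "emb Q A" "emb_vec Q v"] by (simp add: bapply_emb norm_emb_vec Q)
  qed
  have scale: "vnorm Q (\<lambda>x. of_real c * f x) = \<bar>c\<bar> * vnorm Q f" for c f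
    by (simp add: vnorm_def norm_mult power_mult_distrib sum_distrib_left[symmetric] real_sqrt_mult)
  obtain x0 where x0: "x0 \<in> cfgs Q" using cfgs_nonempty by auto
  have "vnorm Q (\<lambda>x. if x = x0 then 1 else 0) = 1"
    using x0 finite_cfgs[OF Q] by (simp add: vnorm_def if_distrib[of cmod] if_distrib[of "\<lambda>x. x\<^sup>2"] cong: if_cong)
  then have ne: "{v. vnorm Q v = 1} \<noteq> {}" by blast
  have bdd: "bdd_above ((\<lambda>v. vnorm Q (mapply Q A v)) ` {v. vnorm Q v = 1})"
  proof (rule bdd_aboveI2)
    fix v assume "v \<in> {v. vnorm Q v = 1}"
    then show "vnorm Q (mapply Q A v) \<le> norm (emb Q A)" using ub[of v] by simp
  qed
  have le: "opnorm Q A \<le> norm (emb Q A)"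
    unfolding opnorm_def
  proof (rule cSUP_least[OF ne])
    fix v assume "v \<in> {v. vnorm Q v = 1}"
    then show "vnorm Q (mapply Q A v) \<le> norm (emb Q A)" using ub[of v] by simp
  qed
  have each: "vnorm Q (mapply Q A v) \<le> opnorm Q A * vnorm Q v" for v
  proof (cases "vnorm Q v = 0")
    case True
    then show ?thesis using ub[of v] by simp
  next
    case False
    define c where "c = 1 / vnorm Q v"
    have "vnorm Q (\<lambda>x. of_real c * v x) = 1"
      unfolding scale using False by (simp add: c_def vnorm_eq)
    then have "vnorm Q (mapply Q A (\<lambda>x. of_real c * v x)) \<le> opnorm Q A"
      unfolding opnorm_def using bdd by (intro cSUP_upper) auto
    moreover have "mapply Q A (\<lambda>x. of_real c * v x) = (\<lambda>x. of_real c * mapply Q A v x)"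
      by (rule ext) (rule mapply_linear)
    ultimately show ?thesis
      using False by (simp add: scale) (simp add: c_def vnorm_eq field_simps less_le)
  qed
  have nonneg: "opnorm Q A \<ge> 0"
  proof -
    obtain v where "vnorm Q v = 1" using ne by auto
    then have "vnorm Q (mapply Q A v) \<le> opnorm Q A" using each[of v] by simp
    moreover have "0 \<le> vnorm Q (mapply Q A v)" by (simp add: vnorm_eq)
    ultimately show ?thesis by linarith
  qed
  have "norm (emb Q A) \<le> opnorm Q A"
  proof (rule norm_bop_bound[OF nonneg])
    fix v
    have "norm (bapply (emb Q A) v) \<le> opnorm Q A * vnorm Q (coord v)"
      using each by (simp add: bapply_emb norm_emb_vec Q)
    also have "\<dots> \<le> opnorm Q A * norm v"
      by (intro mult_left_mono vnorm_coord_le Q nonneg)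
    finally show "norm (bapply (emb Q A) v) \<le> opnorm Q A * norm v" .
  qed
  with le show ?thesis by simp
qed

section \<open>Hermitian matrices\<close>

lemma herm_self_adjoint:
  assumes Q: "finite Q" and A: "herm Q A"
  shows "inner (bapply (emb Q A) v) w = inner v (bapply (emb Q A) w)"
proof -
  have sym: "cnj (A x y) = A y x" if "x \<in> cfgs Q" "y \<in> cfgs Q" for x y
    by (rule A[unfolded herm_def, rule_format, OF that, symmetric])
  have "(\<Sum>x\<in>cfgs Q. coord w x * cnj (\<Sum>y\<in>cfgs Q. A x y * coord v y))
      = (\<Sum>x\<in>cfgs Q. \<Sum>y\<in>cfgs Q. coord w x * cnj (A x y) * cnj (coord v y))"
    by (simp add: sum_distrib_left mult.assoc)
  also have "\<dots> = (\<Sum>y\<in>cfgs Q. \<Sum>x\<in>cfgs Q. coord w x * A y x * cnj (coord v y))"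
    by (subst sum.swap) (intro sum.cong refl, simp add: sym)
  also have "\<dots> = cnj (\<Sum>y\<in>cfgs Q. coord v y * cnj (\<Sum>x\<in>cfgs Q. A y x * coord w x))"
    by (simp add: sum_distrib_left mult_ac)
  finally have "Re (\<Sum>x\<in>cfgs Q. coord w x * cnj (\<Sum>y\<in>cfgs Q. A x y * coord v y))
      = Re (\<Sum>y\<in>cfgs Q. coord v y * cnj (\<Sum>x\<in>cfgs Q. A y x * coord w x))"
    by (simp only: cnj.sel)
  moreover have "inner u (bapply (emb Q A) v) = Re (\<Sum>x\<in>cfgs Q. coord u x * cnj (\<Sum>y\<in>cfgs Q. A x y * coord v y))" for u v
    by (subst inner_ell2_finite[OF finite_cfgs[OF Q]]) (auto simp: coord_emb Q)
  ultimately show ?thesis by (simp add: inner_commute[of _ w])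
qed

text \<open>For Hermitian \<open>A\<close> the number <v, A v>, written \<open>s\<close> below, is
  real; multiplying \<open>A\<close> by \<open>-i\<close> makes it imaginary, and the inner product
  sees only the real part.\<close>

lemma herm_skew:
  assumes Q: "finite Q" and A: "herm Q A"
  shows "inner v (bapply (emb Q (msmult (- \<i>) A)) v) = 0"
proof -
  have sym: "cnj (A x y) = A y x" if "x \<in> cfgs Q" "y \<in> cfgs Q" for x y
    by (rule A[unfolded herm_def, rule_format, OF that, symmetric])
  define s where "s = (\<Sum>x\<in>cfgs Q. coord v x * cnj (\<Sum>y\<in>cfgs Q. A x y * coord v y))"
  have "s = (\<Sum>x\<in>cfgs Q. \<Sum>y\<in>cfgs Q. coord v x * cnj (A x y) * cnj (coord v y))"
    by (simp add: s_def sum_distrib_left mult.assoc)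
  also have "\<dots> = (\<Sum>y\<in>cfgs Q. \<Sum>x\<in>cfgs Q. coord v x * A y x * cnj (coord v y))"
    by (subst sum.swap) (intro sum.cong refl, simp add: sym)
  also have "\<dots> = cnj s"
    by (simp add: s_def sum_distrib_left mult_ac)
  finally have "Im s = Im (cnj s)" by (rule arg_cong)
  then have "Im s = 0" by simp
  moreover have "inner v (bapply (emb Q (msmult (- \<i>) A)) v) = Re (\<i> * s)"
  proof -
    have "inner v (bapply (emb Q (msmult (- \<i>) A)) v)
       = Re (\<Sum>x\<in>cfgs Q. coord v x * cnj (\<Sum>y\<in>cfgs Q. - \<i> * A x y * coord v y))"
      by (subst inner_ell2_finite[OF finite_cfgs[OF Q]]) (auto simp: coord_emb Q msmult_def)
    also have "(\<Sum>x\<in>cfgs Q. coord v x * cnj (\<Sum>y\<in>cfgs Q. - \<i> * A x y * coord v y)) = \<i> * s"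
      by (simp add: s_def sum_distrib_left mult_ac)
    finally show ?thesis .
  qed
  ultimately show ?thesis by simp
qed

lemma contraction_group_herm:
  "finite Q \<Longrightarrow> herm Q A \<Longrightarrow> contraction_group (emb Q (msmult (- \<i>) A))"
  by (rule contraction_group_of_skew) (rule herm_skew)

lemma norm_emb_mident_le: "finite Q \<Longrightarrow> norm (emb Q mident) \<le> 1"
proof (rule norm_bop_bound)
  fix v assume Q: "finite Q"
  have "mapply Q mident (coord v) x = coord v x" if "x \<in> cfgs Q" for x
    using that finite_cfgs[OF Q] by (simp add: mapply_def mident_def if_distrib[of "\<lambda>c. c * _"] cong: if_cong)
  then have "norm (bapply (emb Q mident) v) = vnorm Q (coord v)"
    unfolding bapply_emb[OF Q] norm_emb_vec[OF Q] vnorm_eq by (auto intro: L2_set_cong)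
  then show "norm (bapply (emb Q mident) v) \<le> 1 * norm v"
    using vnorm_coord_le[OF Q] by simp
qed simp

text \<open>|A v|^2 = <v, A A v> = <v, I v>, where I is the contraction \<open>emb Q mident\<close>.
  This bounds Pauli strings independently of the dimension.\<close>

lemma norm_emb_involution_le:
  assumes Q: "finite Q" and "herm Q A" and "emb Q A * emb Q A = emb Q mident"
  shows "norm (emb Q A) \<le> 1"
proof (rule norm_bop_bound)
  fix v
  have "(norm (bapply (emb Q A) v))\<^sup>2 = inner v (bapply (emb Q mident) v)"
    unfolding assms(3)[symmetric] bapply_mult power2_norm_eq_inner by (rule herm_self_adjoint[OF assms(1,2)])
  also have "\<dots> \<le> norm v * norm (bapply (emb Q mident) v)" by (rule norm_cauchy_schwarz)
  also have "\<dots> \<le> norm v * (1 * norm v)"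
    by (intro mult_left_mono order_trans[OF norm_bapply] mult_right_mono norm_emb_mident_le Q) auto
  finally show "norm (bapply (emb Q A) v) \<le> 1 * norm v"
    by (simp add: power2_eq_square[symmetric] power2_le_iff_abs_le)
qed simp

section \<open>Pauli strings\<close>

lemma pmat_cnj: "cnj (pmat P x y) = pmat P y x"
  by (cases P) auto

lemma pmat_square: "(\<Sum>b\<in>UNIV. pmat P x b * pmat P b y) = (if x = y then 1 else 0)"
  by (cases P; cases x; cases y) (simp_all add: UNIV_bool)

lemma pmat_trace: "(\<Sum>x\<in>UNIV. \<Sum>b\<in>UNIV. pmat P x b * pmat P' b x) = (if P = P' then 2 else 0)"
  by (cases P; cases P') (simp_all add: UNIV_bool)

lemma pmat_commute_PI:
  assumes "P = PI \<or> P' = PI"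
  shows "(\<Sum>b\<in>UNIV. pmat P x b * pmat P' b y) = (\<Sum>b\<in>UNIV. pmat P' x b * pmat P b y)"
  using assms by (cases x; cases y) (auto simp: UNIV_bool)

text \<open>Distributivity turns the sum over configurations into a product of one-qubit sums, so
  identities between Pauli strings reduce to 2 by 2 matrices.\<close>

lemma mmult_pstr:
  assumes "finite Q"
  shows "mmult Q (pstr Q P) (pstr Q P') x y = (\<Prod>q\<in>Q. \<Sum>b\<in>UNIV. pmat (P q) (x q) b * pmat (P' q) b (y q))"
  using assms by (simp add: mmult_def pstr_def cfgs_def prod_sum_PiE prod.distrib)

lemma herm_pstr: "herm Q (pstr Q P)"
  by (simp add: herm_def pstr_def pmat_cnj)

lemma emb_pstr_square:
  assumes "finite Q"
  shows "emb Q (pstr Q P) * emb Q (pstr Q P) = emb Q mident"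
  unfolding emb_mmult[OF assms, symmetric]
proof (rule emb_cong[OF assms])
  fix x y assume xy: "x \<in> cfgs Q" "y \<in> cfgs Q"
  have "(\<Prod>q\<in>Q. if x q = y q then 1 else 0 :: complex) = (if x = y then 1 else 0)"
  proof (cases "x = y")
    case False
    \<comment> \<open>Configurations are extensional on \<open>Q\<close>, so distinct ones differ at
      a qubit in \<open>Q\<close>.\<close>
    then obtain q where "q \<in> Q" "x q \<noteq> y q" using xy PiE_ext[of x Q "\<lambda>_. UNIV" y] unfolding cfgs_def by blast
    then have "(\<Prod>q\<in>Q. if x q = y q then 1 else 0 :: complex) = 0"
      using assms by (intro prod_zero) auto
    then show ?thesis using False by simp
  qed simp
  then show "mmult Q (pstr Q P) (pstr Q P) x y = mident x y"
    by (simp add: mmult_pstr assms pmat_square mident_def)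
qed

lemma norm_emb_pstr_le: "finite Q \<Longrightarrow> norm (emb Q (pstr Q P)) \<le> 1"
  by (intro norm_emb_involution_le herm_pstr emb_pstr_square)

lemma norm_emb_msmult_le:
  assumes Q: "finite Q"
  shows "norm (emb Q (msmult c A)) \<le> cmod c * norm (emb Q A)"
proof (rule norm_bop_bound)
  fix v
  have "mapply Q (msmult c A) (coord v) = (\<lambda>x. c * mapply Q A (coord v) x)"
    by (simp add: mapply_def msmult_def sum_distrib_left mult.assoc)
  then have "norm (bapply (emb Q (msmult c A)) v) = cmod c * norm (bapply (emb Q A) v)"
    by (simp add: bapply_emb norm_emb_vec Q vnorm_eq L2_set_def norm_mult power_mult_distrib
        sum_distrib_left[symmetric] real_sqrt_mult)
  then show "norm (bapply (emb Q (msmult c A)) v) \<le> cmod c * norm (emb Q A) * norm v"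
    using mult_left_mono[OF norm_bapply[of "emb Q A" v], of "cmod c"] by (simp add: mult.assoc)
qed simp

lemma emb_msmult_commute:
  assumes "finite Q" "emb Q A * emb Q B = emb Q B * emb Q A"
  shows "emb Q (msmult c A) * emb Q (msmult d B) = emb Q (msmult d B) * emb Q (msmult c A)"
proof -
  have M: "mmult Q (msmult c A) (msmult d B) = msmult (c * d) (mmult Q A B)" for A B c d
    by (simp add: fun_eq_iff mmult_def msmult_def sum_distrib_left mult_ac)
  moreover have "\<forall>x\<in>cfgs Q. \<forall>y\<in>cfgs Q. mmult Q A B x y = mmult Q B A x y"
    using assms by (simp add: emb_mmult[symmetric] emb_eq_iff)
  ultimately show ?thesis
    unfolding emb_mmult[OF assms(1), symmetric] emb_eq_iff[OF assms(1)]
    by (simp only: M) (simp add: msmult_def mult.commute[of c])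
qed

lemma sum_list_mult_commute:
  fixes xs ys :: "'a::ring list"
  assumes "\<And>x y. x \<in> set xs \<Longrightarrow> y \<in> set ys \<Longrightarrow> x * y = y * x"
  shows "sum_list xs * sum_list ys = sum_list ys * sum_list xs"
proof -
  have *: "x * sum_list ys = sum_list ys * x" if "\<And>y. y \<in> set ys \<Longrightarrow> x * y = y * x" for x and ys :: "'a list"
    using that by (induction ys) (auto simp: distrib_left distrib_right)
  have "y * sum_list xs = sum_list xs * y" if "y \<in> set ys" for y
    by (rule *) (use assms that in \<open>metis\<close>)
  then show ?thesis by (intro *) auto
qed

lemma msmult_HJ:
  "msmult c (HJ Q dec J) = msum_list (map (\<lambda>(d, P). msmult (c * d) (pstr Q P)) (dec J))"
  by (induction "dec J") (auto simp: fun_eq_iff HJ_def pterms_def msum_list_def msmult_def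
      sum_list_const_mult[symmetric] o_def case_prod_beta mult.assoc)

text \<open>At each qubit one of the two strings is the identity, so the strings commute qubit by
  qubit and the sums by bilinearity.\<close>

lemma emb_HJ_commute:
  assumes Q: "finite Q"
    and disj: "\<And>c P d P' q. (c, P) \<in> set (dec J) \<Longrightarrow> (d, P') \<in> set (dec K) \<Longrightarrow> P q = PI \<or> P' q = PI"
  shows "emb Q (msmult c (HJ Q dec J)) * emb Q (msmult c (HJ Q dec K))
       = emb Q (msmult c (HJ Q dec K)) * emb Q (msmult c (HJ Q dec J))"
  unfolding msmult_HJ emb_msum_list[OF Q]
proof (rule sum_list_mult_commute, clarsimp)
  fix a P b P' assume "(a, P) \<in> set (dec J)" "(b, P') \<in> set (dec K)"
  then have "P q = PI \<or> P' q = PI" for q by (rule disj)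
  then have "emb Q (pstr Q P) * emb Q (pstr Q P') = emb Q (pstr Q P') * emb Q (pstr Q P)"
    unfolding emb_mmult[OF Q, symmetric] emb_eq_iff[OF Q] mmult_pstr[OF Q]
    by (intro ballI prod.cong refl pmat_commute_PI)
  then show "emb Q (msmult (c * a) (pstr Q P)) * emb Q (msmult (c * b) (pstr Q P'))
      = emb Q (msmult (c * b) (pstr Q P')) * emb Q (msmult (c * a) (pstr Q P))"
    by (rule emb_msmult_commute[OF Q])
qed

lemma norm_sum_list_le:
  fixes f :: "'b \<Rightarrow> 'a::real_normed_vector"
  shows "norm (\<Sum>x\<leftarrow>xs. f x) \<le> (\<Sum>x\<leftarrow>xs. norm (f x))"
  by (induction xs) (auto intro: norm_triangle_mono)

lemma opnorm_HJ_le: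
  assumes Q: "finite Q"
  shows "opnorm Q (HJ Q dec J) \<le> (\<Sum>(c, P)\<leftarrow>dec J. cmod c)"
proof -
  have "norm (emb Q (HJ Q dec J)) \<le> (\<Sum>A\<leftarrow>pterms Q dec J. norm (emb Q A))"
    unfolding HJ_def emb_msum_list[OF Q]
    by (rule norm_sum_list_le)
  also have "\<dots> \<le> (\<Sum>(c, P)\<leftarrow>dec J. cmod c)"
    unfolding pterms_def map_map o_def case_prod_beta
    by (intro sum_list_mono order_trans[OF norm_emb_msmult_le[OF Q]] mult_left_le norm_emb_pstr_le Q) auto
  finally show ?thesis by (simp add: norm_emb_eq_opnorm Q)
qed

text \<open>The coefficient of \<open>P'\<close> in a Hermitian sum is recovered as \<open>tr (H P') / 2^n\<close>, by
  orthogonality of Pauli strings.\<close>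

lemma pauli_coeff_real:
  assumes Q: "finite Q" and herm: "herm Q (HJ Q dec J)"
    and dist: "distinct (map snd (dec J))"
    and supp: "\<And>c P q. (c, P) \<in> set (dec J) \<Longrightarrow> q \<notin> Q \<Longrightarrow> P q = PI"
    and c: "(c, P) \<in> set (dec J)"
  shows "cnj c = c"
proof -
  define tr where "tr A = (\<Sum>x\<in>cfgs Q. \<Sum>z\<in>cfgs Q. A x z * pstr Q P z x)" for A
  have tr_pstr: "tr (msmult d (pstr Q P')) = (if P' = P then d * 2 ^ card Q else 0)"
    if "(d, P') \<in> set (dec J)" for d P'
  proof -
    have "tr (msmult d (pstr Q P')) = d * (\<Sum>x\<in>cfgs Q. mmult Q (pstr Q P') (pstr Q P) x x)"
      by (simp add: tr_def msmult_def mmult_def sum_distrib_left mult.assoc)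
    also have "(\<Sum>x\<in>cfgs Q. mmult Q (pstr Q P') (pstr Q P) x x)
        = (\<Prod>q\<in>Q. \<Sum>x\<in>UNIV. \<Sum>b\<in>UNIV. pmat (P' q) x b * pmat (P q) b x)"
      unfolding mmult_pstr[OF Q] cfgs_def by (subst prod_sum_PiE[OF Q]) auto
    also have "\<dots> = (\<Prod>q\<in>Q. if P' q = P q then 2 else 0)"
      by (simp add: pmat_trace)
    also have "\<dots> = (if P' = P then 2 ^ card Q else 0)"
    proof (cases "P' = P")
      case False
      \<comment> \<open>Both strings are trivial outside \<open>Q\<close>, so they differ at a qubit
        of \<open>Q\<close>, where the one-qubit trace vanishes.\<close>
      then obtain q where "P' q \<noteq> P q" by (meson ext)
      moreover from this have "q \<in> Q" using supp[OF c] supp[OF that] by metis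
      ultimately have "(\<Prod>q\<in>Q. if P' q = P q then 2 else 0 :: complex) = 0"
        using Q by (intro prod_zero) auto
      then show ?thesis using False by simp
    qed simp
    finally show ?thesis by simp
  qed
  have tr_sum: "tr (msum_list As) = (\<Sum>A\<leftarrow>As. tr A)" for As
    by (induction As) (simp_all add: tr_def msum_list_def distrib_right sum.distrib)
  have "tr (HJ Q dec J) = (\<Sum>(d, P')\<leftarrow>dec J. tr (msmult d (pstr Q P')))"
    by (simp add: HJ_def tr_sum pterms_def o_def case_prod_unfold)
  also have "\<dots> = (\<Sum>(d, P')\<leftarrow>dec J. if P' = P then d * 2 ^ card Q else 0)"
    using tr_pstr by (intro arg_cong[of _ _ sum_list] map_cong) auto
  also have "\<dots> = (\<Sum>(d, P')\<in>set (dec J). if P' = P then d * 2 ^ card Q else 0)"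
    using dist by (intro sum_list_distinct_conv_sum_set) (simp add: distinct_map)
  \<comment> \<open>Strings are distinct within the decomposition, so \<open>P' = P\<close> singles
    out the pair \<open>(c, P)\<close>.\<close>
  also have "\<dots> = (\<Sum>dP\<in>set (dec J). if dP = (c, P) then c * 2 ^ card Q else 0)"
  proof (intro sum.cong refl)
    fix dP assume dP: "dP \<in> set (dec J)"
    have "dP = (c, P)" if "snd dP = P"
      using inj_onD[of snd "set (dec J)" dP "(c, P)"] dist dP c that by (simp add: distinct_map)
    moreover have "snd dP \<noteq> P \<Longrightarrow> dP \<noteq> (c, P)" by auto
    ultimately show "(case dP of (d, P') \<Rightarrow> if P' = P then d * 2 ^ card Q else 0)
        = (if dP = (c, P) then c * 2 ^ card Q else 0)"
      by (cases "snd dP = P") (simp_all add: case_prod_unfold)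
  qed
  also have "\<dots> = c * 2 ^ card Q" using c by simp
  finally have tr: "tr (HJ Q dec J) = c * 2 ^ card Q" .
  \<comment> \<open>The trace of a product of two Hermitian matrices is real.\<close>
  have "cnj (tr (HJ Q dec J)) = (\<Sum>x\<in>cfgs Q. \<Sum>z\<in>cfgs Q. cnj (HJ Q dec J x z) * cnj (pstr Q P z x))"
    by (simp add: tr_def)
  also have "\<dots> = (\<Sum>x\<in>cfgs Q. \<Sum>z\<in>cfgs Q. HJ Q dec J z x * pstr Q P x z)"
  proof (intro sum.cong refl)
    fix x z assume "x \<in> cfgs Q" "z \<in> cfgs Q"
    then show "cnj (HJ Q dec J x z) * cnj (pstr Q P z x) = HJ Q dec J z x * pstr Q P x z"
      using herm[unfolded herm_def, rule_format, of x z] herm_pstr[of Q P, unfolded herm_def, rule_format, of z x]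
      by (simp only:)
  qed
  also have "\<dots> = tr (HJ Q dec J)"
    unfolding tr_def by (rule sum.swap)
  finally show ?thesis unfolding tr by simp
qed

lemma herm_msmult_real:
  assumes A: "herm Q A" and c: "cnj c = c"
  shows "herm Q (msmult c A)"
  unfolding herm_def msmult_def
proof (intro ballI)
  fix x y assume "x \<in> cfgs Q" "y \<in> cfgs Q"
  then have "A y x = cnj (A x y)" by (rule A[unfolded herm_def, rule_format])
  then show "c * A y x = cnj (c * A x y)" by (simp only: complex_cnj_mult c)
qed

lemma herm_msum_list:
  assumes "\<And>A. A \<in> set As \<Longrightarrow> herm Q A"
  shows "herm Q (msum_list As)"
  unfolding herm_def
proof (intro ballI)
  fix x y assume xy: "x \<in> cfgs Q" "y \<in> cfgs Q"
  have "(\<Sum>A\<leftarrow>As. A y x) = (\<Sum>A\<leftarrow>As. cnj (A x y))"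
    using assms xy unfolding herm_def by (intro arg_cong[of _ _ sum_list] map_cong) blast+
  also have "\<dots> = cnj (\<Sum>A\<leftarrow>As. A x y)"
    by (induction As) simp_all
  finally show "msum_list As y x = cnj (msum_list As x y)"
    by (simp only: msum_list_def)
qed

section \<open>Product formulas\<close>

text \<open>The coefficients \<open>a\<close> are absorbed into the generators, so that one common
  time serves all factors, as \<open>prod_exps\<close> requires.\<close>

definition pf_factors :: "(nat \<Rightarrow> 'a::real_vector) \<Rightarrow> pform \<Rightarrow> 'a list" where
  "pf_factors h pf = concat (map (map (\<lambda>(g, a). a *\<^sub>R h g)) pf)"

lemma msmult_msmult: "msmult c (msmult d A) = msmult (c * d) A"
  by (simp add: msmult_def mult.assoc)

lemma unit_emb_mexp:
  assumes "finite Q"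
  shows "unit_emb Q (mexp Q (msmult (- \<i> * of_real t) A)) = exp (t *\<^sub>R emb Q (msmult (- \<i>) A))"
  using emb_scaleR[OF assms, of t "msmult (- \<i>) A"]
  by (simp add: exp_emb[OF assms, symmetric] msmult_msmult mult.commute)

lemma unit_emb_pf_eval:
  assumes Q: "finite Q"
  shows "unit_emb Q (pf_eval Q hs pf t) = prod_exps (pf_factors (\<lambda>g. emb Q (msmult (- \<i>) (hs ! g))) pf) t"
proof -
  have stage: "prod_list (map (unit_emb Q) (map (\<lambda>(g, a). mexp Q (msmult (- \<i> * of_real (t * a)) (hs ! g))) st))
     = prod_list (map (\<lambda>A. exp (t *\<^sub>R A)) (map (\<lambda>(g, a). a *\<^sub>R emb Q (msmult (- \<i>) (hs ! g))) st))" for st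
    unfolding map_map o_def case_prod_unfold unit_emb_mexp[OF Q] by simp
  show ?thesis
    unfolding pf_eval_def unit_emb_mprod[OF Q] prod_exps_def pf_factors_def
    by (induction pf) (simp_all only: list.map concat.simps map_append prod_list.Cons prod_list.append
        prod_list.Nil unit_emb_mprod[OF Q] stage)
qed

section \<open>Accumulation of errors in products of contractions\<close>

lemma norm_prod_list_le_1:
  fixes f :: "'b \<Rightarrow> 'a::real_normed_algebra_1"
  assumes "\<And>x. x \<in> set xs \<Longrightarrow> norm (f x) \<le> 1"
  shows "norm (prod_list (map f xs)) \<le> 1"
  using assms
proof (induction xs)
  case (Cons x xs)
  then show ?case
    using norm_mult_le_right(1)[of "f x" "prod_list (map f xs)"] by fastforce
qed simp

text \<open>Factors are exchanged one at a time; everything to the left and right has norm at most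
  1, so the errors add without amplification.\<close>

lemma norm_prod_list_diff:
  fixes f g :: "'b \<Rightarrow> 'a::real_normed_algebra_1"
  assumes "\<And>x. x \<in> set xs \<Longrightarrow> norm (f x) \<le> 1" "\<And>x. x \<in> set xs \<Longrightarrow> norm (g x) \<le> 1"
  shows "norm (prod_list (map f xs) - prod_list (map g xs)) \<le> (\<Sum>x\<leftarrow>xs. norm (f x - g x))"
  using assms
proof (induction xs)
  case (Cons x xs)
  have "prod_list (map f (x # xs)) - prod_list (map g (x # xs))
      = (f x - g x) * prod_list (map f xs) + g x * (prod_list (map f xs) - prod_list (map g xs))"
    by (simp add: algebra_simps)
  also have "norm \<dots> \<le> norm (f x - g x) + norm (prod_list (map f xs) - prod_list (map g xs))"
    by (intro norm_triangle_mono norm_mult_le_right norm_prod_list_le_1 Cons.prems) auto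
  finally show ?case using Cons by simp
qed simp

lemma norm_power_diff_le:
  fixes x y :: "'a::real_normed_algebra_1"
  assumes "norm x \<le> 1" "norm y \<le> 1"
  shows "norm (x ^ n - y ^ n) \<le> real n * norm (x - y)"
  using norm_prod_list_diff[of "replicate n ()" "\<lambda>_. x" "\<lambda>_. y"] assms
  by (simp add: sum_list_replicate)

lemma norm_prod_exps_le_1:
  assumes "\<forall>A\<in>set As. contraction_group A"
  shows "norm (prod_exps As t) \<le> 1"
  unfolding prod_exps_def using assms by (intro norm_prod_list_le_1 contraction_groupD) auto

lemma exp_scaleR_power:
  fixes A :: "'a::{real_normed_algebra_1,banach}"
  shows "exp (t *\<^sub>R A) ^ n = exp ((real n * t) *\<^sub>R A)"
proof (induction n)
  case (Suc n)
  have "exp (t *\<^sub>R A + (real n * t) *\<^sub>R A) = exp (t *\<^sub>R A) * exp ((real n * t) *\<^sub>R A)"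
    by (rule exp_add_commuting) simp
  then show ?case using Suc by (simp add: algebra_simps)
qed simp

section \<open>Sums over the stages of a product formula\<close>

lemma length_stage:
  assumes "valid_pf G \<Upsilon> A pf" "st \<in> set pf"
  shows "length st = G"
proof -
  have "distinct (map fst st)" "set (map fst st) = {..<G}"
    using assms by (auto simp: valid_pf_def)
  then show ?thesis by (metis card_lessThan distinct_card length_map)
qed

lemma length_concat_pf:
  assumes "valid_pf G \<Upsilon> A pf"
  shows "length (concat pf) = \<Upsilon> * G"
proof -
  have "length (concat pf) = (\<Sum>st\<leftarrow>pf. G)"
    unfolding length_concat
    by (intro arg_cong[of _ _ sum_list] map_cong refl length_stage[OF assms])
  then show ?thesis using assms by (simp add: sum_list_triv valid_pf_def)
qed

lemma in_concat_pf:
  assumes "valid_pf G \<Upsilon> A pf" "(g, a) \<in> set (concat pf)"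
  shows "g < G" "\<bar>a\<bar> \<le> A"
proof -
  obtain st where st: "st \<in> set pf" "(g, a) \<in> set st" using assms(2) by auto
  then have "set (map fst st) = {..<G}" "\<forall>(g, a)\<in>set st. \<bar>a\<bar> \<le> A"
    using assms(1) by (auto simp: valid_pf_def)
  with st(2) show "g < G" "\<bar>a\<bar> \<le> A" by force+
qed

text \<open>Each stage lists every term exactly once and so contributes one full sum over the terms,
  with coefficients at most \<open>|A|\<close>; there are \<open>\<Upsilon>\<close> stages.\<close>

lemma pf_sum_le:
  assumes pf: "valid_pf G \<Upsilon> A pf" and f: "\<And>g. f g \<ge> 0"
  shows "(\<Sum>(g, a)\<leftarrow>concat pf. \<bar>a\<bar> * f g) \<le> \<bar>A\<bar> * real \<Upsilon> * (\<Sum>g<G. f g)"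
proof -
  have stage: "(\<Sum>(g, a)\<leftarrow>st. \<bar>a\<bar> * f g) \<le> \<bar>A\<bar> * (\<Sum>g<G. f g)" if st: "st \<in> set pf" for st
  proof -
    have "distinct (map fst st)" "set (map fst st) = {..<G}"
      using st pf by (auto simp: valid_pf_def)
    then have "(\<Sum>g\<leftarrow>map fst st. f g) = (\<Sum>g<G. f g)"
      by (metis sum_list_distinct_conv_sum_set)
    moreover have "(\<Sum>(g, a)\<leftarrow>st. \<bar>a\<bar> * f g) \<le> (\<Sum>(g, a)\<leftarrow>st. \<bar>A\<bar> * f g)"
    proof (rule sum_list_mono)
      fix ga assume "ga \<in> set st"
      then have "(fst ga, snd ga) \<in> set (concat pf)" using st by auto
      from in_concat_pf(2)[OF pf this] have "\<bar>snd ga\<bar> \<le> \<bar>A\<bar>" by simp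
      then show "(case ga of (g, a) \<Rightarrow> \<bar>a\<bar> * f g) \<le> (case ga of (g, a) \<Rightarrow> \<bar>A\<bar> * f g)"
        by (auto simp: f mult_right_mono split: prod.split)
    qed
    moreover have "(\<Sum>(g, a)\<leftarrow>st. \<bar>A\<bar> * f g) = \<bar>A\<bar> * (\<Sum>g\<leftarrow>map fst st. f g)"
      by (simp add: case_prod_unfold sum_list_const_mult o_def)
    ultimately show ?thesis by simp
  qed
  have "(\<Sum>(g, a)\<leftarrow>concat pf. \<bar>a\<bar> * f g) = (\<Sum>st\<leftarrow>pf. \<Sum>(g, a)\<leftarrow>st. \<bar>a\<bar> * f g)"
    by (induction pf) auto
  also have "\<dots> \<le> (\<Sum>st\<leftarrow>pf. \<bar>A\<bar> * (\<Sum>g<G. f g))"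
    by (intro sum_list_mono stage)
  also have "\<dots> = \<bar>A\<bar> * real \<Upsilon> * (\<Sum>g<G. f g)"
    using pf by (simp add: sum_list_triv valid_pf_def)
  finally show ?thesis .
qed

text \<open>Stated for every nonnegative, absolutely homogeneous \<open>F\<close> because it is
  needed for the norm itself and for the norm of the commutator with a fixed
  \<open>X\<close>.\<close>

lemma pf_factors_sum_le:
  fixes h :: "nat \<Rightarrow> 'a::real_vector"
  assumes pf: "valid_pf G \<Upsilon> A pf"
    and F: "\<And>a g. F (a *\<^sub>R h g) = \<bar>a\<bar> * F (h g)" "\<And>x. F x \<ge> (0 :: real)"
  shows "(\<Sum>x\<leftarrow>pf_factors h pf. F x) \<le> \<bar>A\<bar> * real \<Upsilon> * (\<Sum>g<G. F (h g))"
proof -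
  have "(\<Sum>x\<leftarrow>pf_factors h pf. F x) = (\<Sum>(g, a)\<leftarrow>concat pf. \<bar>a\<bar> * F (h g))"
    by (simp add: pf_factors_def map_concat[symmetric] o_def case_prod_unfold F(1))
  also have "\<dots> \<le> \<bar>A\<bar> * real \<Upsilon> * (\<Sum>g<G. F (h g))"
    by (rule pf_sum_le[OF pf]) (rule F(2))
  finally show ?thesis .
qed

lemma set_pf_factors:
  assumes "valid_pf G \<Upsilon> A pf" "x \<in> set (pf_factors h pf)"
  obtains g a where "g < G" "x = a *\<^sub>R h g"
  using assms in_concat_pf(1)[OF assms(1)] by (fastforce simp: pf_factors_def)

lemma commutator_scaleR: "commutator (a *\<^sub>R (X :: 'a::real_algebra)) Y = a *\<^sub>R commutator X Y"
  by (simp add: commutator_def algebra_simps)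

lemma norm_commutator_le:
  fixes X Y :: "'a::real_normed_algebra"
  shows "norm (commutator X Y) \<le> 2 * norm X * norm Y"
  unfolding commutator_def
  using norm_triangle_ineq4[of "X * Y" "Y * X"] norm_mult_ineq[of X Y] norm_mult_ineq[of Y X]
  by (simp add: mult.commute[of "norm Y"])

text \<open>Common form for both levels: for the outer formula \<open>P\<close> will bound supports,
  for the inner one it is trivially true. The constant \<open>K\<close> of
  \<open>trotter_error\<close> becomes \<open>|A| * \<Upsilon> * \<alpha>\<close>, where
  \<open>\<alpha>\<close> bounds the commutators with the bare terms, each of which occurs once per
  stage.\<close>

lemma pf_step_error:
  assumes Q: "finite Q" and pf: "valid_pf (length hs) \<Upsilon> A pf"
    and herm: "\<And>B. B \<in> set hs \<Longrightarrow> herm Q B" and p: "p \<ge> 1"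
    and ord: "pf_order Q hs pf p"
    and h: "h = (\<lambda>g. emb Q (msmult (- \<i>) (hs ! g)))"
    and \<alpha>: "\<alpha> \<ge> 0"
    and comm: "\<And>n X. n < p \<Longrightarrow> P n X \<Longrightarrow> (\<Sum>g<length hs. norm (commutator (h g) X)) \<le> \<alpha> * norm X"
    and step: "\<And>n X g a. n < p \<Longrightarrow> P n X \<Longrightarrow> g < length hs \<Longrightarrow> P (Suc n) (commutator (a *\<^sub>R h g) X)"
    and base: "\<And>g a. g < length hs \<Longrightarrow> P 0 (a *\<^sub>R h g)"
  shows "norm (unit_emb Q (pf_eval Q hs pf t)) \<le> 1"
    and "norm (unit_emb Q (pf_eval Q hs pf t) - exp (t *\<^sub>R emb Q (msmult (- \<i>) (msum_list hs))))
      \<le> (\<bar>A\<bar> * \<Upsilon> * \<alpha>) ^ p * (\<bar>A\<bar> * \<Upsilon> * (\<Sum>g<length hs. norm (h g))) * \<bar>t\<bar> ^ (p + 1)"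
proof -
  define As where "As = pf_factors h pf"
  have hcg: "contraction_group (h g)" if "g < length hs" for g
    unfolding h using that by (intro contraction_group_herm Q herm) auto
  have As: "\<forall>A\<in>set As. contraction_group A"
    unfolding As_def by (auto elim!: set_pf_factors[OF pf] intro!: contraction_group_scaleR hcg)
  have eval: "unit_emb Q (pf_eval Q hs pf t) = prod_exps As t" for t
    unfolding As_def h by (rule unit_emb_pf_eval[OF Q])
  then show "norm (unit_emb Q (pf_eval Q hs pf t)) \<le> 1"
    using norm_prod_exps_le_1[OF As] by simp
  have "(\<lambda>t. norm (prod_exps As t - exp (t *\<^sub>R emb Q (msmult (- \<i>) (msum_list hs)))))
      \<in> O[at 0](\<lambda>t. t ^ (p + 1))"
    using ord unfolding pf_order_def
    by (simp only: norm_emb_eq_opnorm[OF Q, symmetric] emb_mdiff_unit[OF Q] eval unit_emb_mexp[OF Q])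
  then have "norm (prod_exps As t - exp (t *\<^sub>R emb Q (msmult (- \<i>) (msum_list hs))))
      \<le> (\<bar>A\<bar> * \<Upsilon> * \<alpha>) ^ p * (\<Sum>B\<leftarrow>As. norm B) * \<bar>t\<bar> ^ (p + 1)"
  proof (intro trotter_error[where P = P] p As)
    show "contraction_group (emb Q (msmult (- \<i>) (msum_list hs)))"
      by (intro contraction_group_herm Q herm_msum_list herm)
    show "0 \<le> \<bar>A\<bar> * \<Upsilon> * \<alpha>" using \<alpha> by simp
    show "(\<Sum>B\<leftarrow>As. norm (commutator B X)) \<le> \<bar>A\<bar> * \<Upsilon> * \<alpha> * norm X" if "n < p" "P n X" for n X
    proof -
      have "(\<Sum>B\<leftarrow>As. norm (commutator B X)) \<le> \<bar>A\<bar> * \<Upsilon> * (\<Sum>g<length hs. norm (commutator (h g) X))"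
        unfolding As_def by (rule pf_factors_sum_le[OF pf]) (simp_all add: commutator_scaleR)
      also have "\<dots> \<le> \<bar>A\<bar> * \<Upsilon> * (\<alpha> * norm X)"
        by (intro mult_left_mono comm[OF that]) simp
      finally show ?thesis by (simp only: mult.assoc)
    qed
    show "P (Suc n) (commutator B X)" if "n < p" "P n X" "B \<in> set As" for n X B
      using that step unfolding As_def by (auto elim!: set_pf_factors[OF pf])
    show "P 0 B" if "B \<in> set As" for B
      using that base unfolding As_def by (auto elim!: set_pf_factors[OF pf])
  qed
  also have "\<dots> \<le> (\<bar>A\<bar> * \<Upsilon> * \<alpha>) ^ p * (\<bar>A\<bar> * \<Upsilon> * (\<Sum>g<length hs. norm (h g))) * \<bar>t\<bar> ^ (p + 1)"
    unfolding As_def using \<alpha>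
    by (intro mult_right_mono mult_left_mono pf_factors_sum_le[OF pf]) simp_all
  finally show "norm (unit_emb Q (pf_eval Q hs pf t) - exp (t *\<^sub>R emb Q (msmult (- \<i>) (msum_list hs))))
      \<le> (\<bar>A\<bar> * \<Upsilon> * \<alpha>) ^ p * (\<bar>A\<bar> * \<Upsilon> * (\<Sum>g<length hs. norm (h g))) * \<bar>t\<bar> ^ (p + 1)"
    unfolding eval .
qed

section \<open>Local Hamiltonians\<close>

lemma klocal_hamD:
  assumes "klocal_ham \<Lambda> nq k S dec"
  shows "finite \<Lambda>" "\<Lambda> \<noteq> {}" "finite S" "finite (qubits \<Lambda> nq)"
    and "\<And>J. J \<in> S \<Longrightarrow> length J = k" "\<And>J. J \<in> S \<Longrightarrow> set J \<subseteq> \<Lambda>"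
    and "\<And>J. J \<in> S \<Longrightarrow> distinct (map snd (dec J))"
    and "\<And>J c P q. J \<in> S \<Longrightarrow> (c, P) \<in> set (dec J) \<Longrightarrow> fst q \<notin> set J \<Longrightarrow> P q = PI"
    and "\<And>J c P q. J \<in> S \<Longrightarrow> (c, P) \<in> set (dec J) \<Longrightarrow> q \<notin> qubits \<Lambda> nq \<Longrightarrow> P q = PI"
    and "\<And>J. J \<in> S \<Longrightarrow> herm (qubits \<Lambda> nq) (HJ (qubits \<Lambda> nq) dec J)"
proof -
  have supp: "P q = PI" if "J \<in> S" "(c, P) \<in> set (dec J)" "q \<notin> set J \<times> {..<nq}" for J c P q
    using assms that unfolding klocal_ham_def by blast
  show "finite \<Lambda>" "\<Lambda> \<noteq> {}" "finite S" "finite (qubits \<Lambda> nq)"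
    and "\<And>J. J \<in> S \<Longrightarrow> length J = k" and sub: "\<And>J. J \<in> S \<Longrightarrow> set J \<subseteq> \<Lambda>"
    and "\<And>J. J \<in> S \<Longrightarrow> distinct (map snd (dec J))"
    and "\<And>J. J \<in> S \<Longrightarrow> herm (qubits \<Lambda> nq) (HJ (qubits \<Lambda> nq) dec J)"
    using assms by (auto simp: klocal_ham_def qubits_def)
  show "P q = PI" if "J \<in> S" "(c, P) \<in> set (dec J)" "fst q \<notin> set J" for J c P q
    using that by (intro supp[OF that(1,2)]) auto
  show "P q = PI" if "J \<in> S" "(c, P) \<in> set (dec J)" "q \<notin> qubits \<Lambda> nq" for J c P q
    using that sub[OF that(1)] by (intro supp[OF that(1,2)]) (auto simp: qubits_def)
qed

lemma length_dec_le_NP: "finite S \<Longrightarrow> J \<in> S \<Longrightarrow> length (dec J) \<le> NP S dec"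
  unfolding NP_def by (intro Max_ge) auto

lemma finite_coeffs:
  assumes "finite S"
  shows "finite {cmod c | c J P. J \<in> S \<and> (c, P) \<in> set (dec J)}"
proof -
  have "{cmod c | c J P. J \<in> S \<and> (c, P) \<in> set (dec J)} \<subseteq> (\<lambda>(c, P). cmod c) ` (\<Union>J\<in>S. set (dec J))"
    by force
  then show ?thesis by (rule finite_subset) (use assms in simp)
qed

lemma cP_nonneg: "finite S \<Longrightarrow> 0 \<le> cP S dec"
  unfolding cP_def by (intro Max_ge finite.insertI finite_coeffs) simp_all

lemma cmod_le_cP: "finite S \<Longrightarrow> J \<in> S \<Longrightarrow> (c, P) \<in> set (dec J) \<Longrightarrow> cmod c \<le> cP S dec"
  unfolding cP_def by (intro Max_ge finite.insertI finite_coeffs) auto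

lemma sum_coeffs_le:
  assumes "finite S" "J \<in> S"
  shows "(\<Sum>(c, P)\<leftarrow>dec J. cmod c) \<le> real (NP S dec) * cP S dec"
proof -
  have "(\<Sum>(c, P)\<leftarrow>dec J. cmod c) \<le> (\<Sum>_\<leftarrow>dec J. cP S dec)"
    by (intro sum_list_mono) (auto intro: cmod_le_cP[OF assms])
  also have "\<dots> \<le> real (NP S dec) * cP S dec"
    using length_dec_le_NP[OF assms, of dec] cP_nonneg[OF assms(1), of dec]
    by (simp add: sum_list_triv mult_right_mono)
  finally show ?thesis .
qed

text \<open>The minimum that defines \<open>Nind\<close> is attained at a pair where the induced
  norm is attained as well. The number of terms there, times the bound \<open>NP * cP\<close> on the
  norm of one term, therefore bounds every \<open>ind_sum\<close>.\<close>

lemma ind_sum_le: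
  assumes H: "klocal_ham \<Lambda> nq k S dec" and "l < k" "j \<in> \<Lambda>"
  shows "ind_sum (qubits \<Lambda> nq) S dec l j \<le> real (Nind \<Lambda> nq k S dec) * (real (NP S dec) * cP S dec)"
proof -
  note D = klocal_hamD[OF H]
  let ?Q = "qubits \<Lambda> nq"
  define M where "M = {(l, j) \<in> {..<k} \<times> \<Lambda>. ind_sum ?Q S dec l j = ind1norm \<Lambda> nq k S dec}"
  have fin: "finite ((\<lambda>(l, j). ind_sum ?Q S dec l j) ` ({..<k} \<times> \<Lambda>))" using D by simp
  have "ind1norm \<Lambda> nq k S dec \<in> (\<lambda>(l, j). ind_sum ?Q S dec l j) ` ({..<k} \<times> \<Lambda>)"
    unfolding ind1norm_def using assms by (intro Max_in fin) auto
  then obtain l0 j0 where "l0 < k" "j0 \<in> \<Lambda>" "ind_sum ?Q S dec l0 j0 = ind1norm \<Lambda> nq k S dec"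
    by auto
  then have "M \<noteq> {}" by (auto simp: M_def)
  moreover have "finite M" unfolding M_def using D by (auto intro: finite_subset[of _ "{..<k} \<times> \<Lambda>"])
  ultimately have "Nind \<Lambda> nq k S dec \<in> (\<lambda>(l, j). card {J\<in>S. J ! l = j}) ` M"
    unfolding Nind_def M_def[symmetric] by (intro Min_in) auto
  then obtain l' j' where M: "(l', j') \<in> M" and N: "Nind \<Lambda> nq k S dec = card {J\<in>S. J ! l' = j'}"
    by auto
  have "ind_sum ?Q S dec l j \<le> ind1norm \<Lambda> nq k S dec"
    unfolding ind1norm_def using assms by (intro Max_ge fin) force
  also have "\<dots> = ind_sum ?Q S dec l' j'" using M by (simp add: M_def)
  also have "\<dots> \<le> (\<Sum>J\<in>{J\<in>S. J ! l' = j'}. real (NP S dec) * cP S dec)"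
    unfolding ind_sum_def
    by (intro sum_mono order_trans[OF opnorm_HJ_le[OF D(4)] sum_coeffs_le[OF D(3)]]) auto
  finally show ?thesis by (simp add: N)
qed

section \<open>Commutators with local terms\<close>

definition term_op :: "qubit set \<Rightarrow> pdec \<Rightarrow> nat list \<Rightarrow> cfg bop" where
  "term_op Q dec J = emb Q (msmult (- \<i>) (HJ Q dec J))"

lemma norm_term_op_le: "finite Q \<Longrightarrow> norm (term_op Q dec J) \<le> opnorm Q (HJ Q dec J)"
  using norm_emb_msmult_le[of Q "- \<i>" "HJ Q dec J"]
  by (simp add: term_op_def norm_emb_eq_opnorm[symmetric])

text \<open>Commuting with every term that avoids \<open>T\<close> replaces being supported on \<open>T\<close>.\<close>

definition supported :: "qubit set \<Rightarrow> pdec \<Rightarrow> nat list set \<Rightarrow> nat set \<Rightarrow> cfg bop \<Rightarrow> bool" where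
  "supported Q dec S T X \<longleftrightarrow>
     (\<forall>K\<in>S. set K \<inter> T = {} \<longrightarrow> term_op Q dec K * X = X * term_op Q dec K)"

lemma supported_term_op:
  assumes H: "klocal_ham \<Lambda> nq k S dec" and J: "J \<in> S"
  shows "supported (qubits \<Lambda> nq) dec S (set J) (a *\<^sub>R term_op (qubits \<Lambda> nq) dec J)"
  unfolding supported_def
proof (intro ballI impI)
  fix K assume K: "K \<in> S" "set K \<inter> set J = {}"
  have "term_op (qubits \<Lambda> nq) dec K * term_op (qubits \<Lambda> nq) dec J
      = term_op (qubits \<Lambda> nq) dec J * term_op (qubits \<Lambda> nq) dec K"
    unfolding term_op_def
  proof (rule emb_HJ_commute[OF klocal_hamD(4)[OF H]])
    fix c P d P' q assume "(c, P) \<in> set (dec K)" "(d, P') \<in> set (dec J)"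
    then show "P q = PI \<or> P' q = PI"
      using klocal_hamD(8)[OF H K(1)] klocal_hamD(8)[OF H J] K(2) by (metis disjoint_iff)
  qed
  then show "term_op (qubits \<Lambda> nq) dec K * (a *\<^sub>R term_op (qubits \<Lambda> nq) dec J)
      = a *\<^sub>R term_op (qubits \<Lambda> nq) dec J * term_op (qubits \<Lambda> nq) dec K" by simp
qed

text \<open>The operators that commute with a given term form an algebra.\<close>

lemma supported_commutator:
  assumes "supported Q dec S T X" "supported Q dec S U Y"
  shows "supported Q dec S (T \<union> U) (commutator X Y)"
  unfolding supported_def
proof (intro ballI impI)
  fix K assume "K \<in> S" "set K \<inter> (T \<union> U) = {}"
  then have X: "term_op Q dec K * X = X * term_op Q dec K"
    and Y: "term_op Q dec K * Y = Y * term_op Q dec K"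
    using assms by (auto simp: supported_def)
  have "term_op Q dec K * (X * Y) = X * Y * term_op Q dec K"
    "term_op Q dec K * (Y * X) = Y * X * term_op Q dec K"
    by (metis X Y mult.assoc)+
  then show "term_op Q dec K * commutator X Y = commutator X Y * term_op Q dec K"
    by (simp add: commutator_def left_diff_distrib right_diff_distrib)
qed

text \<open>Terms avoiding \<open>T\<close> commute with \<open>X\<close> and drop out. Every other
  term has some site \<open>j\<close> of \<open>T\<close> in some position \<open>l\<close>, so the
  rest is covered by \<open>card T * k\<close> induced sums; the factor 2 is that of a
  commutator.\<close>

lemma sum_norm_commutator_le:
  assumes H: "klocal_ham \<Lambda> nq k S dec"
    and X: "supported (qubits \<Lambda> nq) dec S T X" and T: "finite T" "T \<subseteq> \<Lambda>"
  shows "(\<Sum>J\<in>S. norm (commutator (term_op (qubits \<Lambda> nq) dec J) X))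
    \<le> 2 * (real (card T) * real k * (real (Nind \<Lambda> nq k S dec) * (real (NP S dec) * cP S dec))) * norm X"
proof -
  note D = klocal_hamD[OF H]
  let ?Q = "qubits \<Lambda> nq"
  define f where "f J = opnorm ?Q (HJ ?Q dec J)" for J
  have f: "f J \<ge> 0" for J by (simp add: f_def norm_emb_eq_opnorm[OF D(4), symmetric])
  have each: "norm (commutator (term_op ?Q dec J) X)
      \<le> 2 * (\<Sum>(j, l)\<in>T \<times> {..<k}. if J ! l = j then f J else 0) * norm X" if J: "J \<in> S" for J
  proof (cases "set J \<inter> T = {}")
    case True
    then have "commutator (term_op ?Q dec J) X = 0"
      using X J by (simp add: supported_def commutator_def)
    then show ?thesis using f by (auto intro!: mult_nonneg_nonneg sum_nonneg)
  next
    case False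
    then obtain l where l: "l < length J" "J ! l \<in> T" by (auto simp: in_set_conv_nth)
    \<comment> \<open>The single pair \<open>(J ! l, l)\<close> already contributes
      \<open>f J\<close>; a term that meets \<open>T\<close> several times is merely
      overcounted.\<close>
    have "(case (J ! l, l) of (j, l) \<Rightarrow> if J ! l = j then f J else 0)
        \<le> (\<Sum>(j, l)\<in>T \<times> {..<k}. if J ! l = j then f J else 0)"
      using l D(5)[OF J] T(1) f by (intro member_le_sum) (auto simp: case_prod_unfold)
    then have "f J \<le> (\<Sum>(j, l)\<in>T \<times> {..<k}. if J ! l = j then f J else 0)" by simp
    moreover have "norm (commutator (term_op ?Q dec J) X) \<le> 2 * norm (term_op ?Q dec J) * norm X"
      by (rule norm_commutator_le)
    moreover have "norm (term_op ?Q dec J) \<le> f J"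
      unfolding f_def by (rule norm_term_op_le[OF D(4)])
    ultimately show ?thesis
      by (smt (verit) mult_left_mono mult_right_mono norm_ge_zero)
  qed
  have "(\<Sum>J\<in>S. norm (commutator (term_op ?Q dec J) X))
      \<le> (\<Sum>J\<in>S. 2 * (\<Sum>(j, l)\<in>T \<times> {..<k}. if J ! l = j then f J else 0) * norm X)"
    by (intro sum_mono each)
  also have "\<dots> = 2 * (\<Sum>J\<in>S. \<Sum>(j, l)\<in>T \<times> {..<k}. if J ! l = j then f J else 0) * norm X"
    by (simp add: sum_distrib_left sum_distrib_right)
  \<comment> \<open>Exchanging the sums groups the terms by position and site.\<close>
  also have "\<dots> = 2 * (\<Sum>(j, l)\<in>T \<times> {..<k}. ind_sum ?Q S dec l j) * norm X"
    unfolding ind_sum_def f_def using D(3)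
    by (subst sum.swap) (simp add: case_prod_unfold sum.inter_filter)
  also have "\<dots> \<le> 2 * (\<Sum>(j, l)\<in>T \<times> {..<k}. real (Nind \<Lambda> nq k S dec) * (real (NP S dec) * cP S dec)) * norm X"
    using T(2) by (intro mult_right_mono mult_left_mono sum_mono) (auto intro!: ind_sum_le[OF H])
  also have "\<dots> = 2 * (real (card T) * real k * (real (Nind \<Lambda> nq k S dec) * (real (NP S dec) * cP S dec))) * norm X"
    by (simp add: case_prod_unfold card_cartesian_product)
  finally show ?thesis by simp
qed

lemma sum_nth_distinct: "distinct Js \<Longrightarrow> (\<Sum>g<length Js. f (Js ! g)) = (\<Sum>J\<in>set Js. f J)"
  by (simp add: sum_list_distinct_conv_sum_set[symmetric] sum_list_sum_nth atLeast0LessThan)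

lemma outer_step_error:
  assumes H: "klocal_ham \<Lambda> nq k S dec" and Q: "Q = qubits \<Lambda> nq"
    and Js: "distinct Js" "set Js = S"
    and pf: "valid_pf (length Js) \<Upsilon> A pf"
    and ord: "pf_order Q (map (HJ Q dec) Js) pf p" and p: "p \<ge> 1"
  shows "norm (unit_emb Q (pf_eval Q (map (HJ Q dec) Js) pf t)) \<le> 1" (is ?bound)
    and "norm (unit_emb Q (pf_eval Q (map (HJ Q dec) Js) pf t) - exp (t *\<^sub>R emb Q (msmult (- \<i>) (Htot Q S dec))))
      \<le> (\<bar>A\<bar> * \<Upsilon> * (2 * p * k * k)) ^ p * (\<bar>A\<bar> * \<Upsilon>)
        * (real (Nind \<Lambda> nq k S dec) ^ p * real (NH S) * (real (NP S dec) * cP S dec) ^ (p + 1)) * \<bar>t\<bar> ^ (p + 1)"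
      (is ?error)
proof -
  note D = klocal_hamD[OF H]
  define x where "x = real (NP S dec) * cP S dec"
  define N where "N = real (Nind \<Lambda> nq k S dec)"
  have x: "x \<ge> 0" using cP_nonneg[OF D(3)] by (simp add: x_def)
  \<comment> \<open>Supports met at depth \<open>n < p\<close> have at most \<open>p * k\<close>
    sites; each can occupy \<open>k\<close> positions, with induced sum at most
    \<open>N * x\<close>, and 2 is the commutator factor.\<close>
  define \<alpha> where "\<alpha> = 2 * (real p * real k * real k * (N * x))"
  define h where "h = (\<lambda>g. emb Q (msmult (- \<i>) (map (HJ Q dec) Js ! g)))"
  have h: "h g = term_op Q dec (Js ! g)" "Js ! g \<in> S" if "g < length Js" for g
    using that Js by (auto simp: h_def term_op_def)
  \<comment> \<open>A nested commutator of depth \<open>n\<close> is built from \<open>n + 1\<close>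
    terms, each on at most \<open>k\<close> sites.\<close>
  define P where "P n X \<longleftrightarrow> (\<exists>T. T \<subseteq> \<Lambda> \<and> card T \<le> (n + 1) * k \<and> supported Q dec S T X)" for n X
  note step_err = pf_step_error[OF D(4)[folded Q], where hs = "map (HJ Q dec) Js" and pf = pf and \<Upsilon> = \<Upsilon>
      and A = A and p = p and h = h and \<alpha> = \<alpha> and P = P and t = t, unfolded length_map, OF pf _ p ord h_def]
  have herm: "herm Q B" if "B \<in> set (map (HJ Q dec) Js)" for B
    using that Js D(10) by (auto simp: Q)
  have \<alpha>: "\<alpha> \<ge> 0" using x by (simp add: \<alpha>_def N_def)
  have comm: "(\<Sum>g<length Js. norm (commutator (h g) X)) \<le> \<alpha> * norm X" if n: "n < p" "P n X" for n X
  proof -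
    obtain T where T: "T \<subseteq> \<Lambda>" "card T \<le> (n + 1) * k" "supported Q dec S T X"
      using n(2) by (auto simp: P_def)
    have "(\<Sum>g<length Js. norm (commutator (h g) X)) = (\<Sum>g<length Js. norm (commutator (term_op Q dec (Js ! g)) X))"
      using h by simp
    also have "\<dots> = (\<Sum>J\<in>S. norm (commutator (term_op Q dec J) X))"
      using sum_nth_distinct[OF Js(1), of "\<lambda>J. norm (commutator (term_op Q dec J) X)"] Js(2) by simp
    also have "\<dots> \<le> 2 * (real (card T) * real k * (N * x)) * norm X"
      unfolding Q N_def x_def using T finite_subset[OF T(1) D(1)]
      by (intro sum_norm_commutator_le[OF H]) (auto simp: Q)
    also have "\<dots> \<le> \<alpha> * norm X"
    proof -
      have "(n + 1) * k \<le> p * k" using n(1) by (intro mult_right_mono) auto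
      then have "card T \<le> p * k" using T(2) by linarith
      then have "real (card T) \<le> real p * real k" by (metis of_nat_le_iff of_nat_mult)
      then show ?thesis
        unfolding \<alpha>_def using x by (intro mult_right_mono mult_left_mono) (auto simp: N_def)
    qed
    finally show ?thesis .
  qed
  have step: "P (Suc n) (commutator (a *\<^sub>R h g) X)" if n: "n < p" "P n X" and g: "g < length Js" for n X g a
  proof -
    obtain T where T: "T \<subseteq> \<Lambda>" "card T \<le> (n + 1) * k" "supported Q dec S T X"
      using n(2) by (auto simp: P_def)
    let ?J = "Js ! g"
    have "card (set ?J \<union> T) \<le> (Suc n + 1) * k"
      using card_Un_le[of "set ?J" T] card_length[of ?J] D(5)[OF h(2)[OF g]] T(2) by simp
    moreover have "supported Q dec S (set ?J \<union> T) (commutator (a *\<^sub>R h g) X)"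
      using supported_commutator[OF supported_term_op[OF H h(2)[OF g], folded Q] T(3)] h(1)[OF g] by simp
    ultimately show ?thesis
      unfolding P_def using T(1) D(6)[OF h(2)[OF g]] by (intro exI[of _ "set ?J \<union> T"]) simp
  qed
  have base: "P 0 (a *\<^sub>R h g)" if g: "g < length Js" for g a
    unfolding P_def
  proof (intro exI[of _ "set (Js ! g)"] conjI)
    show "card (set (Js ! g)) \<le> (0 + 1) * k"
      using card_length[of "Js ! g"] D(5)[OF h(2)[OF g]] by simp
    show "supported Q dec S (set (Js ! g)) (a *\<^sub>R h g)"
      using supported_term_op[OF H h(2)[OF g], folded Q] h(1)[OF g] by simp
  qed (rule D(6)[OF h(2)[OF g]])
  show ?bound by (rule step_err(1)[OF herm \<alpha> comm step base])
  have msum: "msum_list (map (HJ Q dec) Js) = Htot Q S dec"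
    using Js by (simp add: fun_eq_iff msum_list_def Htot_def o_def sum_list_distinct_conv_sum_set)
  have "(\<Sum>g<length Js. norm (h g)) \<le> real (NH S) * x"
  proof -
    have "(\<Sum>g<length Js. norm (h g)) = (\<Sum>g<length Js. norm (term_op Q dec (Js ! g)))"
      using h by simp
    also have "\<dots> = (\<Sum>J\<in>S. norm (term_op Q dec J))"
      using sum_nth_distinct[OF Js(1), of "\<lambda>J. norm (term_op Q dec J)"] Js(2) by simp
    also have "\<dots> \<le> (\<Sum>J\<in>S. x)"
      unfolding x_def Q
      by (intro sum_mono order_trans[OF norm_term_op_le[OF D(4)]] order_trans[OF opnorm_HJ_le[OF D(4)]]
          sum_coeffs_le[OF D(3)])
    finally show ?thesis by (simp add: NH_def)
  qed
  then have "(\<bar>A\<bar> * \<Upsilon> * \<alpha>) ^ p * (\<bar>A\<bar> * \<Upsilon> * (\<Sum>g<length Js. norm (h g))) * \<bar>t\<bar> ^ (p + 1)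
     \<le> (\<bar>A\<bar> * \<Upsilon> * \<alpha>) ^ p * (\<bar>A\<bar> * \<Upsilon> * (real (NH S) * x)) * \<bar>t\<bar> ^ (p + 1)"
    using \<alpha> by (intro mult_right_mono mult_left_mono) simp_all
  also have "\<dots> = (\<bar>A\<bar> * \<Upsilon> * (2 * p * k * k)) ^ p * (\<bar>A\<bar> * \<Upsilon>) * (N ^ p * real (NH S) * x ^ (p + 1)) * \<bar>t\<bar> ^ (p + 1)"
    by (simp add: \<alpha>_def power_mult_distrib mult_ac)
  finally show ?error
    unfolding N_def x_def
    by (rule order_trans[rotated]) (rule step_err(2)[unfolded msum]; (rule herm \<alpha> comm step base; assumption))
qed

text \<open>No locality is exploited: a single \<open>H_J\<close> has at most \<open>NP\<close>
  Pauli terms of norm at most \<open>cP\<close>, so the commutators cost \<open>2 * NP * cP\<close>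
  in total and the invariant \<open>P\<close> can be trivial.\<close>

lemma inner_step_error:
  assumes H: "klocal_ham \<Lambda> nq k S dec" and Q: "Q = qubits \<Lambda> nq" and J: "J \<in> S"
    and pf: "valid_pf (length (dec J)) \<Upsilon> A pf"
    and ord: "pf_order Q (pterms Q dec J) pf p" and p: "p \<ge> 1"
  shows "norm (unit_emb Q (pf_eval Q (pterms Q dec J) pf t)) \<le> 1" (is ?bound)
    and "norm (unit_emb Q (pf_eval Q (pterms Q dec J) pf t) - exp (t *\<^sub>R emb Q (msmult (- \<i>) (HJ Q dec J))))
      \<le> (\<bar>A\<bar> * \<Upsilon> * 2) ^ p * (\<bar>A\<bar> * \<Upsilon>) * (real (NP S dec) * cP S dec) ^ (p + 1) * \<bar>t\<bar> ^ (p + 1)"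
      (is ?error)
proof -
  note D = klocal_hamD[OF H]
  define x where "x = real (NP S dec) * cP S dec"
  have x: "x \<ge> 0" using cP_nonneg[OF D(3)] by (simp add: x_def)
  define h where "h = (\<lambda>g. emb Q (msmult (- \<i>) (pterms Q dec J ! g)))"
  have len: "length (pterms Q dec J) = length (dec J)" by (simp add: pterms_def)
  have herm: "herm Q B" if B: "B \<in> set (pterms Q dec J)" for B
  proof -
    obtain c P where c: "(c, P) \<in> set (dec J)" "B = msmult c (pstr Q P)"
      using B by (auto simp: pterms_def)
    \<comment> \<open>Each Pauli term must be Hermitian for its exponentials to be contractions, but
      only the sum \<open>H_J\<close> is assumed so.\<close>
    have "cnj c = c"
      by (rule pauli_coeff_real[OF D(4) D(10)[OF J] D(7)[OF J] _ c(1)]) (rule D(9)[OF J])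
    then show ?thesis unfolding c(2) by (intro herm_msmult_real herm_pstr)
  qed
  have "(\<Sum>g<length (dec J). norm (h g)) \<le> (\<Sum>g<length (dec J). cmod (fst (dec J ! g)))"
  proof (rule sum_mono)
    fix g assume "g \<in> {..<length (dec J)}"
    then have "h g = emb Q (msmult (- \<i> * fst (dec J ! g)) (pstr Q (snd (dec J ! g))))"
      by (simp add: h_def pterms_def case_prod_unfold msmult_msmult)
    also have "norm \<dots> \<le> cmod (- \<i> * fst (dec J ! g)) * 1"
      unfolding Q by (intro order_trans[OF norm_emb_msmult_le[OF D(4)]] mult_left_mono norm_emb_pstr_le D(4)) simp
    finally show "norm (h g) \<le> cmod (fst (dec J ! g))" by (simp add: norm_mult)
  qed
  also have "\<dots> = (\<Sum>(c, P)\<leftarrow>dec J. cmod c)"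
    by (simp add: sum_list_sum_nth atLeast0LessThan case_prod_unfold)
  also have "\<dots> \<le> x" unfolding x_def by (rule sum_coeffs_le[OF D(3) J])
  finally have hx: "(\<Sum>g<length (dec J). norm (h g)) \<le> x" .
  have comm: "(\<Sum>g<length (dec J). norm (commutator (h g) X)) \<le> 2 * x * norm X" for X
  proof -
    have "(\<Sum>g<length (dec J). norm (commutator (h g) X)) \<le> (\<Sum>g<length (dec J). 2 * norm (h g) * norm X)"
      by (intro sum_mono norm_commutator_le)
    also have "\<dots> = 2 * (\<Sum>g<length (dec J). norm (h g)) * norm X"
      by (simp add: sum_distrib_left sum_distrib_right)
    also have "\<dots> \<le> 2 * x * norm X"
      using hx by (intro mult_right_mono mult_left_mono) auto
    finally show ?thesis .
  qed
  note step_err = pf_step_error[OF D(4)[folded Q], where hs = "pterms Q dec J" and pf = pf and \<Upsilon> = \<Upsilon>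
      and A = A and p = p and h = h and \<alpha> = "2 * x" and P = "\<lambda>_ _. True" and t = t, unfolded len, OF pf herm p ord h_def]
  have x2: "0 \<le> 2 * x" using x by simp
  show ?bound using step_err(1)[OF _ x2] comm by simp
  have "(\<bar>A\<bar> * \<Upsilon> * (2 * x)) ^ p * (\<bar>A\<bar> * \<Upsilon> * (\<Sum>g<length (dec J). norm (h g))) * \<bar>t\<bar> ^ (p + 1)
     \<le> (\<bar>A\<bar> * \<Upsilon> * (2 * x)) ^ p * (\<bar>A\<bar> * \<Upsilon> * x) * \<bar>t\<bar> ^ (p + 1)"
    using x hx by (intro mult_right_mono mult_left_mono) simp_all
  also have "\<dots> = (\<bar>A\<bar> * \<Upsilon> * 2) ^ p * (\<bar>A\<bar> * \<Upsilon>) * x ^ (p + 1) * \<bar>t\<bar> ^ (p + 1)"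
    by (simp add: power_mult_distrib mult_ac)
  finally show ?error
    using step_err(2)[OF _ x2] comm unfolding HJ_def[symmetric] x_def by simp
qed

section \<open>Trotter number and gate count\<close>

lemma powr_power_root:
  fixes x a :: real
  assumes "x \<ge> 0" "p \<ge> 1"
  shows "(x powr (1 / real p)) ^ p = x" "(x powr (1 + 1 / real p)) ^ p = x ^ (p + 1)"
proof -
  have "(x powr (1 / real p)) ^ p = x \<and> (x powr (1 + 1 / real p)) ^ p = x ^ (p + 1)"
  proof (cases "x = 0")
    case False
    then have x: "x > 0" using assms(1) by simp
    have "real p * (1 / real p) = 1" "real p * (1 + 1 / real p) = real (p + 1)"
      using assms(2) by (simp_all add: field_simps)
    then show ?thesis
      using x by (simp only: powr_power[OF False] powr_realpow) simp
  qed (use assms in auto)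
  then show "(x powr (1 / real p)) ^ p = x" "(x powr (1 + 1 / real p)) ^ p = x ^ (p + 1)"
    by auto
qed

text \<open>The \<open>p\<close>-th power of the lower bound on \<open>r\<close> clears all roots;
  the exponent \<open>1 + 1 / p\<close> turns into \<open>p + 1\<close>.\<close>

lemma trotter_number_bound:
  fixes N M z \<epsilon> c r :: real
  assumes p: "p \<ge> 1" and "N \<ge> 0" "M \<ge> 0" "z \<ge> 0" "\<epsilon> > 0" "c > 0" "r > 0"
    and r: "c * (N * M powr (1 / real p) * z powr (1 + 1 / real p) / \<epsilon> powr (1 / real p)) \<le> r"
  shows "N ^ p * M * z ^ (p + 1) / r ^ p \<le> \<epsilon> / c ^ p"
proof -
  have "(c * (N * M powr (1 / real p) * z powr (1 + 1 / real p) / \<epsilon> powr (1 / real p))) ^ p \<le> r ^ p"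
    using assms by (intro power_mono r mult_nonneg_nonneg divide_nonneg_nonneg) auto
  also have "(c * (N * M powr (1 / real p) * z powr (1 + 1 / real p) / \<epsilon> powr (1 / real p))) ^ p
      = c ^ p * (N ^ p * M * z ^ (p + 1) / \<epsilon>)"
    using assms by (simp only: power_mult_distrib power_divide powr_power_root less_imp_le)
  finally show ?thesis
    using assms by (simp add: field_simps)
qed

lemma power_step_total:
  fixes c C t r :: real
  assumes "r > 0" "t > 0"
  shows "r * (C * \<bar>t / r\<bar> ^ (p + 1)) = C * t ^ (p + 1) / r ^ p"
  using assms by (simp add: power_divide field_simps)

section \<open>Accumulated errors of the outer and inner formulas\<close>

definition outer_const :: "nat \<Rightarrow> nat \<Rightarrow> nat \<Rightarrow> real \<Rightarrow> real" where
  "outer_const p k \<Upsilon> A = (\<bar>A\<bar> * \<Upsilon> * (2 * p * k * k)) ^ p * (\<bar>A\<bar> * \<Upsilon>)"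

text \<open>The first two factors are the constant of one inner step; \<open>|A| ^ (p + 1)\<close>
  comes from running it for time \<open>s * a\<close> with \<open>|a| \<le> |A|\<close>, and the
  last \<open>\<Upsilon>\<close> from the \<open>\<Upsilon> * NH\<close> factors of an outer
  step.\<close>

definition inner_const :: "nat \<Rightarrow> nat \<Rightarrow> real \<Rightarrow> real" where
  "inner_const p \<Upsilon> A = (\<bar>A\<bar> * \<Upsilon> * 2) ^ p * (\<bar>A\<bar> * \<Upsilon>) * \<bar>A\<bar> ^ (p + 1) * \<Upsilon>"

lemma outer_total_error:
  assumes H: "klocal_ham \<Lambda> nq k S dec" and Q: "Q = qubits \<Lambda> nq"
    and Js: "distinct Js" "set Js = S"
    and pf: "valid_pf (length Js) \<Upsilon> A pf"
    and ord: "pf_order Q (map (HJ Q dec) Js) pf p" and p: "p \<ge> 1"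
    and pos: "t > 0" "\<epsilon> > 0" "r > 0" "c > 0"
    and r: "c * (real (Nind \<Lambda> nq k S dec) * real (NH S) powr (1 / real p)
                 * (real (NP S dec) * cP S dec * t) powr (1 + 1 / real p)
                 / \<epsilon> powr (1 / real p)) \<le> real r"
  shows "norm (unit_emb Q (pf_eval Q (map (HJ Q dec) Js) pf (t / real r)) ^ r
      - exp (t *\<^sub>R emb Q (msmult (- \<i>) (Htot Q S dec)))) \<le> outer_const p k \<Upsilon> A * (\<epsilon> / c ^ p)"
proof -
  define x where "x = real (NP S dec) * cP S dec"
  have x: "x \<ge> 0" using cP_nonneg[OF klocal_hamD(3)[OF H]] by (simp add: x_def)
  define X where "X = unit_emb Q (pf_eval Q (map (HJ Q dec) Js) pf (t / real r))"
  define T where "T = emb Q (msmult (- \<i>) (Htot Q S dec))"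
  define C where "C = outer_const p k \<Upsilon> A * (real (Nind \<Lambda> nq k S dec) ^ p * real (NH S) * x ^ (p + 1))"
  note step = outer_step_error[OF H Q Js pf ord p, of "t / real r"]
  have "herm Q (Htot Q S dec)"
  proof -
    have "herm Q (msum_list (map (HJ Q dec) Js))"
      using klocal_hamD(10)[OF H] Js by (intro herm_msum_list) (auto simp: Q)
    then show ?thesis
      using Js by (simp add: herm_def msum_list_def Htot_def o_def sum_list_distinct_conv_sum_set)
  qed
  then have T: "norm (exp (s *\<^sub>R T)) \<le> 1" for s
    unfolding T_def using klocal_hamD(4)[OF H]
    by (intro contraction_groupD contraction_group_herm) (simp_all add: Q)
  \<comment> \<open>The exact evolution is an \<open>r\<close>-th power as well, so the errors of
    \<open>r\<close> contractive steps add up.\<close>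
  have "exp (t *\<^sub>R T) = exp ((t / real r) *\<^sub>R T) ^ r"
    using pos by (simp add: exp_scaleR_power)
  then have "norm (X ^ r - exp (t *\<^sub>R T)) \<le> real r * norm (X - exp ((t / real r) *\<^sub>R T))"
    using step(1) T by (simp add: X_def norm_power_diff_le)
  also have "\<dots> \<le> real r * (C * \<bar>t / real r\<bar> ^ (p + 1))"
    using step(2) unfolding X_def T_def C_def x_def outer_const_def
    by (intro mult_left_mono) (simp_all only: of_nat_0_le_iff mult.assoc)
  also have "\<dots> = C * t ^ (p + 1) / real r ^ p"
    using pos by (intro power_step_total) auto
  also have "\<dots> = outer_const p k \<Upsilon> A * (real (Nind \<Lambda> nq k S dec) ^ p * real (NH S) * (x * t) ^ (p + 1) / real r ^ p)"
    by (simp add: C_def power_mult_distrib mult_ac)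
  also have "\<dots> \<le> outer_const p k \<Upsilon> A * (\<epsilon> / c ^ p)"
    using pos x p r unfolding x_def[symmetric]
    by (intro mult_left_mono trotter_number_bound) (auto simp: outer_const_def)
  finally show ?thesis unfolding X_def T_def .
qed

text \<open>For \<open>m\<close> constantly 1 a factor is determined by its pair
  \<open>(g, a)\<close>, so the circuit flattens to a product over \<open>concat pf\<close>,
  parallel to the outer formula.\<close>

lemma unit_emb_circuit:
  assumes Q: "finite Q"
  shows "unit_emb Q (circuit Q dec Js pf ipf (\<lambda>_ _. 1) t r) =
    prod_list (map (\<lambda>(g, a). unit_emb Q (pf_eval Q (pterms Q dec (Js ! g)) (ipf (Js ! g)) (t / real r * a))) (concat pf)) ^ r"
proof -
  have "map (\<lambda>v. mprod Q (map (\<lambda>(g, a). mpow Q (pf_eval Q (pterms Q dec (Js ! g)) (ipf (Js ! g))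
            (t * a / (real r * real 1))) 1) (pf ! v))) [0..<length pf]
      = map (\<lambda>st. mprod Q (map (\<lambda>(g, a). mpow Q (pf_eval Q (pterms Q dec (Js ! g)) (ipf (Js ! g))
            (t * a / (real r * real 1))) 1) st)) pf"
    by (rule nth_equalityI) auto
  moreover have "unit_emb Q (mprod Q (map (\<lambda>st. mprod Q (map (\<lambda>(g, a). mpow Q (pf_eval Q (pterms Q dec (Js ! g)) (ipf (Js ! g))
            (t * a / (real r * real 1))) 1) st)) pf))
      = prod_list (map (\<lambda>(g, a). unit_emb Q (pf_eval Q (pterms Q dec (Js ! g)) (ipf (Js ! g)) (t / real r * a))) (concat pf))"
    unfolding unit_emb_mprod[OF Q] map_map o_def case_prod_unfold unit_emb_mpow[OF Q]
    by (induction pf) (simp_all add: o_def unit_emb_mprod[OF Q] unit_emb_mpow[OF Q] del: mpow.simps)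
  ultimately show ?thesis
    unfolding circuit_def unit_emb_mpow[OF Q] by simp
qed

text \<open>Inner and outer step are products over the same list, so they are compared factor by
  factor; \<open>\<Upsilon> * NH\<close> factors in each of \<open>r\<close> steps
  contribute.\<close>

lemma circuit_error:
  assumes H: "klocal_ham \<Lambda> nq k S dec" and Q: "Q = qubits \<Lambda> nq"
    and Js: "distinct Js" "set Js = S"
    and pf: "valid_pf (length Js) \<Upsilon> A pf"
    and ord: "pf_order Q (map (HJ Q dec) Js) pf p" and p: "p \<ge> 1"
    and ipf: "\<And>J. J \<in> S \<Longrightarrow> valid_pf (length (dec J)) \<Upsilon> A (ipf J)"
      "\<And>J. J \<in> S \<Longrightarrow> pf_order Q (pterms Q dec J) (ipf J) p"
    and pos: "t > 0" "\<epsilon> > 0" "r > 0" "c > 0" and N: "Nind \<Lambda> nq k S dec \<ge> 1"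
    and r: "c * (real (Nind \<Lambda> nq k S dec) * real (NH S) powr (1 / real p)
                 * (real (NP S dec) * cP S dec * t) powr (1 + 1 / real p)
                 / \<epsilon> powr (1 / real p)) \<le> real r"
  shows "norm (unit_emb Q (circuit Q dec Js pf ipf (\<lambda>_ _. 1) t r)
      - unit_emb Q (pf_eval Q (map (HJ Q dec) Js) pf (t / real r)) ^ r) \<le> inner_const p \<Upsilon> A * (\<epsilon> / c ^ p)"
proof -
  define x where "x = real (NP S dec) * cP S dec"
  have x: "x \<ge> 0" using cP_nonneg[OF klocal_hamD(3)[OF H]] by (simp add: x_def)
  have fin: "finite Q" using klocal_hamD(4)[OF H] Q by simp
  define s where "s = t / real r"
  define F where "F = (\<lambda>(g, a). exp ((s * a) *\<^sub>R emb Q (msmult (- \<i>) (HJ Q dec (Js ! g)))))"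
  define G where "G = (\<lambda>(g, a). unit_emb Q (pf_eval Q (pterms Q dec (Js ! g)) (ipf (Js ! g)) (s * a)))"
  define C where "C = (\<bar>A\<bar> * \<Upsilon> * 2) ^ p * (\<bar>A\<bar> * \<Upsilon>) * x ^ (p + 1)"
  have C: "C \<ge> 0" using x by (simp add: C_def)
  have mem: "Js ! g \<in> S" "\<bar>a\<bar> \<le> \<bar>A\<bar>" if "(g, a) \<in> set (concat pf)" for g a
    using in_concat_pf[OF pf that] Js by auto
  have outer: "unit_emb Q (pf_eval Q (map (HJ Q dec) Js) pf s) = prod_list (map F (concat pf))"
  proof -
    have "map (\<lambda>A. exp (s *\<^sub>R A)) (pf_factors (\<lambda>g. emb Q (msmult (- \<i>) (map (HJ Q dec) Js ! g))) pf)
        = map (\<lambda>(g, a). exp ((s * a) *\<^sub>R emb Q (msmult (- \<i>) (map (HJ Q dec) Js ! g)))) (concat pf)"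
      by (simp add: pf_factors_def map_concat[symmetric] case_prod_unfold o_def)
    also have "\<dots> = map F (concat pf)"
      using in_concat_pf(1)[OF pf] by (intro map_cong refl) (auto simp: F_def simp del: set_concat)
    finally show ?thesis unfolding unit_emb_pf_eval[OF fin] prod_exps_def by simp
  qed
  have F1: "norm (F ga) \<le> 1" if "ga \<in> set (concat pf)" for ga
  proof -
    have "contraction_group (emb Q (msmult (- \<i>) (HJ Q dec (Js ! fst ga))))"
      using mem(1)[of "fst ga" "snd ga"] that klocal_hamD(10)[OF H]
      by (intro contraction_group_herm fin) (simp add: Q)
    then show ?thesis by (simp add: F_def case_prod_unfold contraction_groupD)
  qed
  have G1: "norm (G ga) \<le> 1" and GF: "norm (G ga - F ga) \<le> C * (\<bar>A\<bar> * \<bar>s\<bar>) ^ (p + 1)"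
    if ga: "ga \<in> set (concat pf)" for ga
  proof -
    have J: "Js ! fst ga \<in> S" and a: "\<bar>snd ga\<bar> \<le> \<bar>A\<bar>" using mem[of "fst ga" "snd ga"] ga by auto
    note inner = inner_step_error[OF H Q J ipf(1)[OF J] ipf(2)[OF J] p, of "s * snd ga"]
    show "norm (G ga) \<le> 1" using inner(1) by (simp add: G_def case_prod_unfold)
    have "norm (G ga - F ga) \<le> C * \<bar>s * snd ga\<bar> ^ (p + 1)"
      using inner(2) by (simp only: G_def F_def C_def x_def case_prod_unfold)
    also have "\<dots> \<le> C * (\<bar>A\<bar> * \<bar>s\<bar>) ^ (p + 1)"
      unfolding abs_mult mult.commute[of "\<bar>s\<bar>"] using a C by (intro mult_left_mono power_mono mult_right_mono) auto
    finally show "norm (G ga - F ga) \<le> C * (\<bar>A\<bar> * \<bar>s\<bar>) ^ (p + 1)" .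
  qed
  have "norm (prod_list (map G (concat pf)) - prod_list (map F (concat pf))) \<le> (\<Sum>ga\<leftarrow>concat pf. norm (G ga - F ga))"
    by (rule norm_prod_list_diff) (use F1 G1 in auto)
  also have "\<dots> \<le> (\<Sum>ga\<leftarrow>concat pf. C * (\<bar>A\<bar> * \<bar>s\<bar>) ^ (p + 1))"
    by (intro sum_list_mono GF)
  also have "\<dots> = real (\<Upsilon> * NH S) * (C * (\<bar>A\<bar> * \<bar>s\<bar>) ^ (p + 1))"
    using length_concat_pf[OF pf] distinct_card[OF Js(1)] Js(2) by (simp add: sum_list_triv NH_def del: length_concat)
  finally have diff: "norm (prod_list (map G (concat pf)) - prod_list (map F (concat pf)))
      \<le> real (\<Upsilon> * NH S) * (C * (\<bar>A\<bar> * \<bar>s\<bar>) ^ (p + 1))" .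
  have "norm (prod_list (map G (concat pf)) ^ r - prod_list (map F (concat pf)) ^ r)
      \<le> real r * norm (prod_list (map G (concat pf)) - prod_list (map F (concat pf)))"
    by (intro norm_power_diff_le norm_prod_list_le_1 F1 G1)
  also have "\<dots> \<le> real r * (real (\<Upsilon> * NH S) * (C * (\<bar>A\<bar> * \<bar>s\<bar>) ^ (p + 1)))"
    by (intro mult_left_mono diff) simp
  also have "\<dots> = real r * ((inner_const p \<Upsilon> A * (real (NH S) * x ^ (p + 1))) * \<bar>t / real r\<bar> ^ (p + 1))"
    unfolding inner_const_def C_def s_def power_mult_distrib[of "\<bar>A\<bar>"] by (simp only: of_nat_mult mult_ac)
  also have "\<dots> = (inner_const p \<Upsilon> A * (real (NH S) * x ^ (p + 1))) * t ^ (p + 1) / real r ^ p"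
    using pos by (intro power_step_total) auto
  also have "\<dots> = inner_const p \<Upsilon> A * (1 * (real (NH S) * (x * t) ^ (p + 1) / real r ^ p))"
    by (simp add: power_mult_distrib mult_ac)
  \<comment> \<open>The accumulated inner error lacks the factor \<open>Nind ^ p\<close>; inserting
    it, by \<open>Nind \<ge> 1\<close>, lets the same lower bound on \<open>r\<close> serve both
    errors.\<close>
  also have "\<dots> \<le> inner_const p \<Upsilon> A * (real (Nind \<Lambda> nq k S dec) ^ p * (real (NH S) * (x * t) ^ (p + 1) / real r ^ p))"
    using N x pos by (intro mult_left_mono mult_right_mono one_le_power) (auto simp: inner_const_def)
  also have "\<dots> = inner_const p \<Upsilon> A * (real (Nind \<Lambda> nq k S dec) ^ p * real (NH S) * (x * t) ^ (p + 1) / real r ^ p)"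
    by simp
  also have "\<dots> \<le> inner_const p \<Upsilon> A * (\<epsilon> / c ^ p)"
    using pos x p r unfolding x_def[symmetric]
    by (intro mult_left_mono trotter_number_bound) (auto simp: inner_const_def)
  finally show ?thesis
    unfolding unit_emb_circuit[OF fin] s_def[symmetric] outer G_def[symmetric] .
qed

text \<open>One factor \<open>\<Upsilon>\<close> counts outer stages, the other inner
  stages.\<close>

lemma gate_count_le:
  assumes H: "klocal_ham \<Lambda> nq k S dec"
    and Js: "distinct Js" "set Js = S"
    and pf: "valid_pf (length Js) \<Upsilon> A pf"
    and ipf: "\<And>J. J \<in> S \<Longrightarrow> valid_pf (length (dec J)) \<Upsilon> A (ipf J)"
  shows "gate_count Js pf ipf (\<lambda>_ _. 1) r \<le> r * (\<Upsilon> * NH S * (\<Upsilon> * NP S dec))"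
proof -
  have "(\<Sum>v<length pf. \<Sum>(g, a)\<leftarrow>pf ! v. 1 * length (concat (ipf (Js ! g))))
      = (\<Sum>ga\<leftarrow>concat pf. length (concat (ipf (Js ! fst ga))))"
  proof -
    have "(\<Sum>v<length pf. \<Sum>ga\<leftarrow>pf ! v. f ga) = (\<Sum>ga\<leftarrow>concat pf. f ga)" for f :: "nat \<times> real \<Rightarrow> nat"
    proof -
      have "(\<Sum>v<length pf. \<Sum>ga\<leftarrow>pf ! v. f ga) = (\<Sum>st\<leftarrow>pf. \<Sum>ga\<leftarrow>st. f ga)"
        by (simp add: sum_list_sum_nth atLeast0LessThan)
      also have "\<dots> = (\<Sum>ga\<leftarrow>concat pf. f ga)" by (induction pf) auto
      finally show ?thesis .
    qed
    then show ?thesis by (simp add: case_prod_unfold)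
  qed
  also have "\<dots> \<le> (\<Sum>ga\<leftarrow>concat pf. \<Upsilon> * NP S dec)"
  proof (rule sum_list_mono)
    fix ga assume ga: "ga \<in> set (concat pf)"
    have J: "Js ! fst ga \<in> S" using in_concat_pf(1)[OF pf, of "fst ga" "snd ga"] ga Js by auto
    show "length (concat (ipf (Js ! fst ga))) \<le> \<Upsilon> * NP S dec"
      unfolding length_concat_pf[OF ipf[OF J]]
      using length_dec_le_NP[OF klocal_hamD(3)[OF H] J, of dec] by simp
  qed
  also have "\<dots> = \<Upsilon> * NH S * (\<Upsilon> * NP S dec)"
    using length_concat_pf[OF pf] distinct_card[OF Js(1)] Js(2) by (simp add: sum_list_triv NH_def del: length_concat)
  finally show ?thesis unfolding gate_count_def by (rule mult_left_mono) simp
qed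

text \<open>The gates per step multiply the Trotter number by \<open>M * m\<close>. The factor
  \<open>M\<close> completes \<open>M powr (1 / real p)\<close> to the exponent
  \<open>1 + 1 / p\<close> and goes inside; \<open>m\<close> already occurs inside with that
  exponent, so the extra \<open>m\<close> stays outside.\<close>

lemma gate_scaling_eq:
  fixes N M m c t \<epsilon> :: real
  assumes "M \<ge> 0"
  shows "N * M powr (1 / real p) * (m * c * t) powr (1 + 1 / real p) / \<epsilon> powr (1 / real p) * (M * m)
      = N * m * (M * m * c * t) powr (1 + 1 / real p) / \<epsilon> powr (1 / real p)"
proof -
  have "M powr (1 + 1 / real p) = M * M powr (1 / real p)"
    using assms by (simp add: powr_add)
  moreover have "(M * m * c * t) powr (1 + 1 / real p) = M powr (1 + 1 / real p) * (m * c * t) powr (1 + 1 / real p)"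
    using powr_mult[of M "m * c * t"] by (simp only: mult.assoc)
  ultimately show ?thesis by simp
qed

theorem theorem3p3:
  fixes p k \<Upsilon> :: nat and A :: real
  assumes "p \<ge> 1" and "k \<ge> 1"
  shows
  "(\<exists>C1>0. \<exists>C2>0. \<forall>\<Lambda> nq S dec Js pf t \<epsilon> (r::nat).
      klocal_ham \<Lambda> nq k S dec \<longrightarrow>
      distinct Js \<longrightarrow> set Js = S \<longrightarrow>
      valid_pf (length Js) \<Upsilon> A pf \<longrightarrow>
      pf_order (qubits \<Lambda> nq) (map (HJ (qubits \<Lambda> nq) dec) Js) pf p \<longrightarrow>
      t > 0 \<longrightarrow> \<epsilon> > 0 \<longrightarrow> r > 0 \<longrightarrow>
      real r \<ge> C1 * (real (Nind \<Lambda> nq k S dec) * real (NH S) powr (1 / real p)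
                 * (real (NP S dec) * cP S dec * t) powr (1 + 1 / real p)
                 / \<epsilon> powr (1 / real p)) \<longrightarrow>
      opnorm (qubits \<Lambda> nq)
        (mdiff (mpow (qubits \<Lambda> nq)
                  (pf_eval (qubits \<Lambda> nq) (map (HJ (qubits \<Lambda> nq) dec) Js) pf (t / real r)) r)
               (mexp (qubits \<Lambda> nq)
                  (msmult (- \<i> * complex_of_real t) (Htot (qubits \<Lambda> nq) S dec))))
        \<le> C2 * \<epsilon>)
   \<and>
   (\<forall>clo>0. \<forall>chi>0. \<exists>C3>0. \<exists>C4>0. \<forall>\<Lambda> nq S dec Js pf ipf t \<epsilon> (r::nat).
      klocal_ham \<Lambda> nq k S dec \<longrightarrow>
      distinct Js \<longrightarrow> set Js = S \<longrightarrow>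
      valid_pf (length Js) \<Upsilon> A pf \<longrightarrow>
      pf_order (qubits \<Lambda> nq) (map (HJ (qubits \<Lambda> nq) dec) Js) pf p \<longrightarrow>
      (\<forall>J\<in>S. valid_pf (length (dec J)) \<Upsilon> A (ipf J) \<and>
              pf_order (qubits \<Lambda> nq) (pterms (qubits \<Lambda> nq) dec J) (ipf J) p) \<longrightarrow>
      t > 0 \<longrightarrow> \<epsilon> > 0 \<longrightarrow> r > 0 \<longrightarrow>
      clo * (real (Nind \<Lambda> nq k S dec) * real (NH S) powr (1 / real p)
                 * (real (NP S dec) * cP S dec * t) powr (1 + 1 / real p)
                 / \<epsilon> powr (1 / real p)) \<le> real r \<longrightarrow>
      real r \<le> chi * (real (Nind \<Lambda> nq k S dec) * real (NH S) powr (1 / real p)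
                 * (real (NP S dec) * cP S dec * t) powr (1 + 1 / real p)
                 / \<epsilon> powr (1 / real p)) \<longrightarrow>
      (\<exists>m. (\<forall>v g. m v g \<ge> 1) \<and>
        opnorm (qubits \<Lambda> nq)
          (mdiff (circuit (qubits \<Lambda> nq) dec Js pf ipf m t r)
                 (mexp (qubits \<Lambda> nq)
                    (msmult (- \<i> * complex_of_real t) (Htot (qubits \<Lambda> nq) S dec))))
          \<le> C4 * \<epsilon> \<and>
        real (gate_count Js pf ipf m r)
          \<le> C3 * (real (Nind \<Lambda> nq k S dec) * real (NP S dec)
                  * (real (NH S) * real (NP S dec) * cP S dec * t) powr (1 + 1 / real p)
                  / \<epsilon> powr (1 / real p))))"
proof (intro conjI allI impI, goal_cases)
  case 1
  show ?case
  \<comment> \<open>1 is added to \<open>outer_const\<close> because that constant can vanish, for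
    instance when \<open>A = 0\<close>, while \<open>C2\<close> has to be positive.\<close>
  proof (rule exI[of _ 1], rule conjI[OF zero_less_one],
      rule exI[of _ "outer_const p k \<Upsilon> A + 1"], intro conjI allI impI)
    show "outer_const p k \<Upsilon> A + 1 > 0"
      by (auto simp: outer_const_def intro: add_nonneg_pos)
    fix \<Lambda> nq S dec Js pf and t \<epsilon> :: real and r :: nat
    assume H: "klocal_ham \<Lambda> nq k S dec" and Js: "distinct Js" "set Js = S"
      and pf: "valid_pf (length Js) \<Upsilon> A pf"
      and ord: "pf_order (qubits \<Lambda> nq) (map (HJ (qubits \<Lambda> nq) dec) Js) pf p"
      and pos: "t > 0" "\<epsilon> > 0" "r > 0"
      and r: "1 * (real (Nind \<Lambda> nq k S dec) * real (NH S) powr (1 / real p)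
                 * (real (NP S dec) * cP S dec * t) powr (1 + 1 / real p)
                 / \<epsilon> powr (1 / real p)) \<le> real r"
    note fin = klocal_hamD(4)[OF H]
    have "norm (unit_emb (qubits \<Lambda> nq) (pf_eval (qubits \<Lambda> nq) (map (HJ (qubits \<Lambda> nq) dec) Js) pf (t / real r)) ^ r
        - exp (t *\<^sub>R emb (qubits \<Lambda> nq) (msmult (- \<i>) (Htot (qubits \<Lambda> nq) S dec)))) \<le> outer_const p k \<Upsilon> A * (\<epsilon> / 1 ^ p)"
      by (rule outer_total_error[OF H refl Js pf ord assms(1) pos zero_less_one r])
    also have "\<dots> \<le> (outer_const p k \<Upsilon> A + 1) * \<epsilon>"
      using pos by (simp add: algebra_simps)
    finally show "opnorm (qubits \<Lambda> nq)
        (mdiff (mpow (qubits \<Lambda> nq)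
                  (pf_eval (qubits \<Lambda> nq) (map (HJ (qubits \<Lambda> nq) dec) Js) pf (t / real r)) r)
               (mexp (qubits \<Lambda> nq)
                  (msmult (- \<i> * complex_of_real t) (Htot (qubits \<Lambda> nq) S dec))))
        \<le> (outer_const p k \<Upsilon> A + 1) * \<epsilon>"
      unfolding norm_emb_eq_opnorm[OF fin, symmetric] emb_mdiff_unit[OF fin] unit_emb_mpow[OF fin]
        unit_emb_mexp[OF fin] .
  qed
next
  case (2 clo chi)
  \<comment> \<open>Division by \<open>clo ^ p\<close> is what a lower bound with constant
    \<open>clo\<close> leaves in \<open>trotter_number_bound\<close>.\<close>
  define C where "C = (outer_const p k \<Upsilon> A + inner_const p \<Upsilon> A) / clo ^ p"
  have C: "C \<ge> 0" using 2 by (simp add: C_def outer_const_def inner_const_def)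
  have C3: "chi * real (\<Upsilon> * \<Upsilon>) + 1 > 0" using 2 by (intro add_nonneg_pos) auto
  show ?case
  proof (rule exI[of _ "chi * real (\<Upsilon> * \<Upsilon>) + 1"], rule conjI[OF C3],
      rule exI[of _ "C + 1"], intro conjI allI impI)
    show "C + 1 > 0" using C by simp
    fix \<Lambda> nq S dec Js pf ipf and t \<epsilon> :: real and r :: nat
    define Q where "Q = qubits \<Lambda> nq"
    define y where "y = real (Nind \<Lambda> nq k S dec) * real (NH S) powr (1 / real p)
                 * (real (NP S dec) * cP S dec * t) powr (1 + 1 / real p)
                 / \<epsilon> powr (1 / real p)"
    assume H: "klocal_ham \<Lambda> nq k S dec" and Js: "distinct Js" "set Js = S"
      and pf: "valid_pf (length Js) \<Upsilon> A pf"
      and ord: "pf_order (qubits \<Lambda> nq) (map (HJ (qubits \<Lambda> nq) dec) Js) pf p"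
      and ipf: "\<forall>J\<in>S. valid_pf (length (dec J)) \<Upsilon> A (ipf J) \<and>
              pf_order (qubits \<Lambda> nq) (pterms (qubits \<Lambda> nq) dec J) (ipf J) p"
      and pos: "t > 0" "\<epsilon> > 0" "r > 0"
      and lo: "clo * (real (Nind \<Lambda> nq k S dec) * real (NH S) powr (1 / real p)
                 * (real (NP S dec) * cP S dec * t) powr (1 + 1 / real p)
                 / \<epsilon> powr (1 / real p)) \<le> real r"
      and hi: "real r \<le> chi * (real (Nind \<Lambda> nq k S dec) * real (NH S) powr (1 / real p)
                 * (real (NP S dec) * cP S dec * t) powr (1 + 1 / real p)
                 / \<epsilon> powr (1 / real p))"
    have fin: "finite Q" using klocal_hamD(4)[OF H] by (simp add: Q_def)
    \<comment> \<open>If \<open>Nind\<close> were 0, the upper bound on \<open>r\<close> would be 0,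
      contradicting \<open>r > 0\<close>.\<close>
    have N: "Nind \<Lambda> nq k S dec \<ge> 1"
    proof (rule ccontr)
      assume "\<not> Nind \<Lambda> nq k S dec \<ge> 1"
      then have "Nind \<Lambda> nq k S dec = 0" by simp
      then show False using hi pos by simp
    qed
    have ipf1: "valid_pf (length (dec J)) \<Upsilon> A (ipf J)" and ipf2: "pf_order Q (pterms Q dec J) (ipf J) p"
      if "J \<in> S" for J using ipf that by (auto simp: Q_def)
    define X where "X = unit_emb Q (pf_eval Q (map (HJ Q dec) Js) pf (t / real r)) ^ r"
    define E where "E = exp (t *\<^sub>R emb Q (msmult (- \<i>) (Htot Q S dec)))"
    \<comment> \<open>One inner step per factor will be the witness for \<open>m\<close>.\<close>
    define Y where "Y = unit_emb Q (circuit Q dec Js pf ipf (\<lambda>_ _. 1) t r)"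
    have "norm (Y - X) \<le> inner_const p \<Upsilon> A * (\<epsilon> / clo ^ p)"
      unfolding X_def Y_def
      by (rule circuit_error[OF H Q_def Js pf ord[folded Q_def] assms(1) ipf1 ipf2 pos \<open>clo > 0\<close> N lo])
    moreover have "norm (X - E) \<le> outer_const p k \<Upsilon> A * (\<epsilon> / clo ^ p)"
      unfolding X_def E_def
      by (rule outer_total_error[OF H Q_def Js pf ord[folded Q_def] assms(1) pos \<open>clo > 0\<close> lo])
    ultimately have "norm (Y - E) \<le> C * \<epsilon>"
      using norm_triangle_ineq[of "Y - X" "X - E"] by (simp add: C_def algebra_simps add_divide_distrib)
    also have "\<dots> \<le> (C + 1) * \<epsilon>" using pos by (simp add: algebra_simps)
    finally have err: "opnorm (qubits \<Lambda> nq)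
          (mdiff (circuit (qubits \<Lambda> nq) dec Js pf ipf (\<lambda>_ _. 1) t r)
                 (mexp (qubits \<Lambda> nq)
                    (msmult (- \<i> * complex_of_real t) (Htot (qubits \<Lambda> nq) S dec))))
          \<le> (C + 1) * \<epsilon>"
      unfolding Q_def[symmetric] norm_emb_eq_opnorm[OF fin, symmetric] emb_mdiff_unit[OF fin]
        unit_emb_mexp[OF fin] Y_def E_def .
    have y0: "y \<ge> 0" unfolding y_def by (intro divide_nonneg_nonneg mult_nonneg_nonneg) auto
    have "real (gate_count Js pf ipf (\<lambda>_ _. 1) r) \<le> real r * real (\<Upsilon> * NH S * (\<Upsilon> * NP S dec))"
      using gate_count_le[OF H Js pf ipf1, of r] by (metis of_nat_le_iff of_nat_mult)
    also have "\<dots> \<le> (chi * y) * real (\<Upsilon> * NH S * (\<Upsilon> * NP S dec))"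
      using hi unfolding y_def by (intro mult_right_mono) auto
    also have "\<dots> = chi * real (\<Upsilon> * \<Upsilon>) * (y * (real (NH S) * real (NP S dec)))"
      by (simp add: mult_ac)
    also have "\<dots> \<le> (chi * real (\<Upsilon> * \<Upsilon>) + 1) * (y * (real (NH S) * real (NP S dec)))"
      using y0 by (intro mult_right_mono) auto
    also have "y * (real (NH S) * real (NP S dec)) = real (Nind \<Lambda> nq k S dec) * real (NP S dec)
                  * (real (NH S) * real (NP S dec) * cP S dec * t) powr (1 + 1 / real p)
                  / \<epsilon> powr (1 / real p)"
      unfolding y_def by (rule gate_scaling_eq) simp
    finally have count: "real (gate_count Js pf ipf (\<lambda>_ _. 1) r)
          \<le> (chi * real (\<Upsilon> * \<Upsilon>) + 1) * (real (Nind \<Lambda> nq k S dec) * real (NP S dec)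
                  * (real (NH S) * real (NP S dec) * cP S dec * t) powr (1 + 1 / real p)
                  / \<epsilon> powr (1 / real p))" .
    show "\<exists>m. (\<forall>v g. m v g \<ge> 1) \<and>
        opnorm (qubits \<Lambda> nq)
          (mdiff (circuit (qubits \<Lambda> nq) dec Js pf ipf m t r)
                 (mexp (qubits \<Lambda> nq)
                    (msmult (- \<i> * complex_of_real t) (Htot (qubits \<Lambda> nq) S dec))))
          \<le> (C + 1) * \<epsilon> \<and>
        real (gate_count Js pf ipf m r)
          \<le> (chi * real (\<Upsilon> * \<Upsilon>) + 1) * (real (Nind \<Lambda> nq k S dec) * real (NP S dec)
                  * (real (NH S) * real (NP S dec) * cP S dec * t) powr (1 + 1 / real p)
                  / \<epsilon> powr (1 / real p))"
      by (intro exI[of _ "\<lambda>_ _. 1"] conjI err count) simp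
  qed
qed

end
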